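(* In $\mathrm{U}_q(\widehat{\mathfrak{gl}}_{M|N})$ one has $$B_q(L^{\pm}(zq^{-2}))=\mathfrak{z}^{\pm}(zq^{2M-2N-2})\,B_q(L^{\pm}(z)).$$
   Context: Let $M,N\ge 0$ be integers with $M\ne N$. The base field is $\mathbb{C}(q)$ ($q$ is not a root of unity). For $1\le i\le M+N$ put $\bar i=0$ if $i\le M$ and $\bar i=1$ if $i>M$, and $q_i=q^{1-2\bar i}$. $\mathbb{C}^{M|N}$ is the superspace with basis $e_i$ of parity $\bar i$, and $E_{ij}\in\mathrm{End}\,\mathbb{C}^{M|N}$ are the matrix units (of parity $\bar i+\bar j$). Tensor products of superalgebras are graded: $(a\otimes b)(a'\otimes b')=(-1)^{|b||a'|}aa'\otimes bb'$. Put $R(z,w)=\sum_i (zq_i-wq_i^{-1})E_{ii}\otimes E_{ii}+(z-w)\sum_{i\ne j}E_{ii}\otimes E_{jj}+z\sum_{i<j}(q_j-q_j^{-1})E_{ij}\otimes E_{ji}+w\sum_{i>j}(q_j-q_j^{-1})E_{ij}\otimes E_{ji}$, $\overline R(x)=R(x,1)/(xq-q^{-1})$ and $R(x)=f(x)\overline R(x)$, where $f(x)=1+\sum_{k\ge1}f_kx^{-k}$ is the formal series uniquely determined by $f(xq^{2N-2M})=f(x)\frac{(1-xq^{-2})(1-xq^{2N-2M+2})}{(1-x)(1-xq^{2N-2M})}$; $R(x)$ is expanded in powers of $x^{-1}$. $\mathrm{U}_q(\widehat{\mathfrak{gl}}_{M|N})$ is the superalgebra over $\mathbb{C}(q)$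 generated by $l_{ij}^{\pm(r)}$ ($1\le i,j\le M+N$, $r\ge 0$, parity $\bar i+\bar j$) and an invertible central even element $q^c$. Put $l_{ij}^{\pm}(z)=\sum_{r\ge0}l_{ij}^{\pm(r)}z^{\mp r}$, $L^{\pm}(z)=\sum_{i,j}l^{\pm}_{ij}(z)\otimes E_{ij}$, and let $L_a^\pm(z)$ denote $L^\pm(z)$ acting in the $a$-th copy of $\mathrm{End}\,\mathbb{C}^{M|N}$. The defining relations are: $l_{ji}^{+(0)}=l_{ij}^{-(0)}=0$ for $i<j$; $l_{ii}^{-(0)}l_{ii}^{+(0)}=l_{ii}^{+(0)}l_{ii}^{-(0)}=1$; $R(z/w)L_1^{\pm}(z)L_2^{\pm}(w)=L_2^{\pm}(w)L_1^{\pm}(z)R(z/w)$; $R(zq^{c}/w)L_1^{+}(z)L_2^{-}(w)=L_2^{-}(w)L_1^{+}(z)R(zq^{-c}/w)$. Products and inverses of matrices such as $L^\pm(z)$ are taken in $\mathrm{U}_q(\widehat{\mathfrak{gl}}_{M|N})\otimes\mathrm{End}\,\mathbb{C}^{M|N}$, and $A_{ij}$ denotes the coefficient of $E_{ij}$ in $A$. The supertranspose of $A=\sum a_{ij}E_{ij}$ is $A^{st}=\sum_{i,j}(-1)^{\bar i(\bar i+\bar j)}a_{ji}E_{ij}$. $D=\mathrm{diag}[q^{2},q^{4},\ldots,q^{2M},q^{2M},q^{2M-2},\ldots,q^{2M-2N+2}]$. The series $\mathfrak{z}^{\pm}(z)$ (a power series in $z^{\mp1}$ with coefficients in $\mathrm{U}_q(\widehat{\mathfrak{gl}}_{M|N})$)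 is the one determined by $L^{\pm}(zq^{2N-2M})^{st}D(L^{\pm}(z)^{-1})^{st}=\mathfrak{z}^{\pm}(z)D$. The quantum Berezinian is $$B_q(L^{\pm}(z))=\sum_{\sigma\in S_M}(-q)^{-l(\sigma)}L^{\pm}(z)_{\sigma(1),1}\cdots L^{\pm}(zq^{2M-2})_{\sigma(M),M}\sum_{\tau\in S_N}(-q)^{-l(\tau)}\bigl(L^{\pm}(zq^{2M-2})^{-1}\bigr)_{M+1,M+\tau(1)}\cdots\bigl(L^{\pm}(zq^{2M-2N})^{-1}\bigr)_{M+N,M+\tau(N)},$$ where in the first product the $j$-th factor has argument $zq^{2j-2}$, in the second product the $k$-th factor has argument $zq^{2M-2k}$, and $l$ is the length function on permutations.
   Formalization: The relation defining 𝔷^±(z) is taken with D^{-1} in place of D, i.e. L^±(zq^{2N-2M})^{st} D^{-1} (L^±(z)^{-1})^{st} = 𝔷^±(z) D^{-1}; with D as printed no such series exists unless M+N=1, where both versions agree. *)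

theory Defs
  imports
    "HOL-Library.Poly_Mapping"
    "HOL-Library.Type_Length"
    "HOL-Computational_Algebra.Computational_Algebra"
    "HOL-Combinatorics.Permutations"
begin

text \<open>
  The integers \<open>M, N \<ge> 0\<close> are the lengths \<open>LENGTH('m)\<close>, \<open>LENGTH('n)\<close> of two phantom types of
  class \<open>len0\<close>, so that the presented superalgebra is a type of class \<open>ring_1\<close>.
  Indices are natural numbers, only those in \<open>{1..M+N}\<close> being meaningful.
\<close>

type_synonym Cq = "complex poly fract"

definition qq :: Cq where
  "qq = to_fract [:0, 1:]"

definition par :: "nat \<Rightarrow> nat \<Rightarrow> nat" where
  "par M i = (if i \<le> M then 0 else 1)"

definition qi :: "nat \<Rightarrow> nat \<Rightarrow> Cq" where
  "qi M i = qq powi (1 - 2 * int (par M i))"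

text \<open>
  A series in \<open>x\<^sup>-\<^sup>1\<close> is an \<open>fps\<close> whose variable \<open>fps_X\<close> stands for \<open>x\<^sup>-\<^sup>1\<close>.  A 4-index family
  \<open>X i j k l\<close> is the coefficient of \<open>E\<^sub>i\<^sub>j \<otimes> E\<^sub>k\<^sub>l\<close>.
\<close>

text \<open>
  The functional equation of \<open>f\<close> with denominators cleared and multiplied by \<open>x\<^sup>-\<^sup>2\<close>;
  \<open>f(x q\<^sup>2\<^sup>N\<^sup>-\<^sup>2\<^sup>M)\<close> substitutes \<open>q\<^sup>2\<^sup>M\<^sup>-\<^sup>2\<^sup>N x\<^sup>-\<^sup>1\<close> for \<open>x\<^sup>-\<^sup>1\<close>.
\<close>

definition f_ser :: "nat \<Rightarrow> nat \<Rightarrow> Cq fps" where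
  "f_ser M N = (THE f. fps_nth f 0 = 1 \<and>
     (let p = qq powi (2 * int N - 2 * int M) in
       fps_compose f (fps_const (inverse p) * fps_X) * ((fps_X - 1) * (fps_X - fps_const p))
         = f * ((fps_X - fps_const (qq powi (-2))) * (fps_X - fps_const (p * qq ^ 2)))))"

definition Rmat :: "nat \<Rightarrow> Cq fps \<Rightarrow> Cq fps \<Rightarrow> nat \<Rightarrow> nat \<Rightarrow> nat \<Rightarrow> nat \<Rightarrow> Cq fps" where
  "Rmat M z w i j k l =
     (if i = j \<and> k = l then
        (if i = k then z * fps_const (qi M i) - w * fps_const (inverse (qi M i)) else z - w)
      else if k = j \<and> l = i then
        (if i < j then z else w) * fps_const (qi M j - inverse (qi M j))
      else 0)"

text \<open>Since \<open>R(z,w)\<close> is homogeneous of degree 1,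
  \<open>R(x,1) / (x q - q\<^sup>-\<^sup>1) = R(1,x\<^sup>-\<^sup>1) / (q - q\<^sup>-\<^sup>1 x\<^sup>-\<^sup>1)\<close>.\<close>

definition R_ser :: "nat \<Rightarrow> nat \<Rightarrow> nat \<Rightarrow> nat \<Rightarrow> nat \<Rightarrow> nat \<Rightarrow> Cq fps" where
  "R_ser M N i j k l =
     f_ser M N * (Rmat M 1 fps_X i j k l * inverse (fps_const qq - fps_const (inverse qq) * fps_X))"

text \<open>
  \<open>\<gamma>\<close> is the parity automorphism \<open>a \<mapsto> (-1)\<^bsup>|a|\<^esup> a\<close> of the coefficient superalgebra, so that moving
  a coefficient \<open>b\<close> to the left past \<open>E\<^sub>i\<^sub>j\<close> turns it into \<open>\<gamma>\<^bsup>|i|+|j|\<^esup> b\<close>.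
  In \<open>gmult2\<close> the further sign comes from exchanging \<open>E\<^sub>k\<^sub>l\<close> (second copy, left factor) and
  \<open>E\<^sub>j\<^sub>m\<close> (first copy, right factor).
\<close>

definition gmult :: "('a \<Rightarrow> 'a) \<Rightarrow> nat \<Rightarrow> nat \<Rightarrow> (nat \<Rightarrow> nat \<Rightarrow> 'a::ring_1) \<Rightarrow> (nat \<Rightarrow> nat \<Rightarrow> 'a)
    \<Rightarrow> nat \<Rightarrow> nat \<Rightarrow> 'a" where
  "gmult \<gamma> M N A B i k =
     (\<Sum>j\<in>{1..M+N}. A i j * (\<gamma> ^^ (par M i + par M j)) (B j k))"

definition gmult2 :: "('a \<Rightarrow> 'a) \<Rightarrow> nat \<Rightarrow> nat \<Rightarrow> (nat \<Rightarrow> nat \<Rightarrow> nat \<Rightarrow> nat \<Rightarrow> 'a::ring_1)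
    \<Rightarrow> (nat \<Rightarrow> nat \<Rightarrow> nat \<Rightarrow> nat \<Rightarrow> 'a) \<Rightarrow> nat \<Rightarrow> nat \<Rightarrow> nat \<Rightarrow> nat \<Rightarrow> 'a" where
  "gmult2 \<gamma> M N X Y i m k n =
     (\<Sum>j\<in>{1..M+N}. \<Sum>l\<in>{1..M+N}.
        (-1) ^ ((par M k + par M l) * (par M j + par M m)) * X i j k l *
        (\<gamma> ^^ (par M i + par M j + par M k + par M l)) (Y j m l n))"

datatype pm = Pos | Neg

text \<open>\<open>L\<^sup>\<plusminus>(z)\<close> is a series in \<open>z\<^bsup>zexp\<^esup>\<close>.\<close>

fun zexp :: "pm \<Rightarrow> int" where
  "zexp Pos = -1"
| "zexp Neg = 1"

text \<open>\<open>Lgen s r i j\<close> stands for \<open>l\<^sub>i\<^sub>j\<close> with superscript \<open>\<plusminus>(r)\<close>; \<open>Qc\<close>, \<open>Qcinv\<close> for \<open>q\<^sup>c\<close>, \<open>q\<^sup>-\<^sup>c\<close>.\<close>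

datatype gen = Lgen pm nat nat nat | Qc | Qcinv

datatype word = Word (letters: "gen list")

instantiation word :: monoid_add
begin
definition zero_word :: word where "zero_word = Word []"
definition plus_word :: "word \<Rightarrow> word \<Rightarrow> word" where
  "plus_word v w = Word (letters v @ letters w)"
instance
  by standard (auto simp: zero_word_def plus_word_def)
end

type_synonym free = "word \<Rightarrow>\<^sub>0 Cq"

definition fgen :: "gen \<Rightarrow> free" where
  "fgen g = Poly_Mapping.single (Word [g]) 1"

definition fscal :: "Cq \<Rightarrow> free" where
  "fscal c = Poly_Mapping.single 0 c"

fun gen_par :: "nat \<Rightarrow> gen \<Rightarrow> nat" where
  "gen_par M (Lgen s r i j) = par M i + par M j"
| "gen_par M Qc = 0"
| "gen_par M Qcinv = 0"

definition word_par :: "nat \<Rightarrow> word \<Rightarrow> nat" where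
  "word_par M w = sum_list (map (gen_par M) (letters w))"

definition free_par :: "nat \<Rightarrow> free \<Rightarrow> free" where
  "free_par M x = Poly_Mapping.mapp (\<lambda>w c. (-1) ^ word_par M w * c) x"

definition L1 :: "pm \<Rightarrow> nat \<Rightarrow> nat \<Rightarrow> nat \<Rightarrow> nat \<Rightarrow> nat \<Rightarrow> free" where
  "L1 s r i j k l = (if k = l then fgen (Lgen s r i j) else 0)"

definition L2 :: "pm \<Rightarrow> nat \<Rightarrow> nat \<Rightarrow> nat \<Rightarrow> nat \<Rightarrow> nat \<Rightarrow> free" where
  "L2 s r i j k l = (if i = j then fgen (Lgen s r k l) else 0)"

definition Rcoeff :: "nat \<Rightarrow> nat \<Rightarrow> free \<Rightarrow> nat \<Rightarrow> nat \<Rightarrow> nat \<Rightarrow> nat \<Rightarrow> nat \<Rightarrow> free" where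
  "Rcoeff M N u p i j k l = u ^ p * fscal (fps_nth (R_ser M N i j k l) p)"

text \<open>
  \<open>rll M N s t u v a b\<close> is the coefficient of \<open>z\<^sup>a w\<^sup>b\<close> in
  \<open>R(z u\<^sup>-\<^sup>1/w) L\<^sub>1(z) L\<^sub>2(w) - L\<^sub>2(w) L\<^sub>1(z) R(z v\<^sup>-\<^sup>1/w)\<close>, where \<open>L\<^sub>1\<close>, \<open>L\<^sub>2\<close> carry the signs \<open>s\<close>, \<open>t\<close>
  and \<open>R(x u\<^sup>-\<^sup>1) = \<Sum>\<^sub>p R\<^sub>p u\<^sup>p x\<^sup>-\<^sup>p\<close>.  The index set of the sums is finite for the sign pairs
  used below: \<open>(+,+)\<close>, \<open>(-,-)\<close> and \<open>(+,-)\<close>.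
\<close>

definition rll_exps :: "pm \<Rightarrow> pm \<Rightarrow> int \<Rightarrow> int \<Rightarrow> (nat \<times> nat \<times> nat) set" where
  "rll_exps s t a b =
     {(p, r, r'). - int p + zexp s * int r = a \<and> int p + zexp t * int r' = b}"

definition rll :: "nat \<Rightarrow> nat \<Rightarrow> pm \<Rightarrow> pm \<Rightarrow> free \<Rightarrow> free \<Rightarrow> int \<Rightarrow> int
    \<Rightarrow> nat \<Rightarrow> nat \<Rightarrow> nat \<Rightarrow> nat \<Rightarrow> free" where
  "rll M N s t u v a b i j k l =
     (let mult = gmult2 (free_par M) M N in
       (\<Sum>(p, r, r')\<in>rll_exps s t a b. mult (mult (Rcoeff M N u p) (L1 s r)) (L2 t r') i j k l)
     - (\<Sum>(p, r, r')\<in>rll_exps s t a b. mult (mult (L2 t r') (L1 s r)) (Rcoeff M N v p) i j k l))"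

text \<open>Generators with an index outside \<open>{1..M+N}\<close> do not occur in the presentation; the first rule
  removes them.\<close>

inductive_set rels :: "nat \<Rightarrow> nat \<Rightarrow> free set" for M N :: nat where
  no_index: "i \<notin> {1..M+N} \<or> j \<notin> {1..M+N} \<Longrightarrow> fgen (Lgen s r i j) \<in> rels M N"
| Qc_right: "fgen Qc * fgen Qcinv - 1 \<in> rels M N"
| Qc_left: "fgen Qcinv * fgen Qc - 1 \<in> rels M N"
| Qc_central: "fgen Qc * fgen g - fgen g * fgen Qc \<in> rels M N"
| upper: "1 \<le> i \<Longrightarrow> i < j \<Longrightarrow> j \<le> M + N \<Longrightarrow> fgen (Lgen Pos 0 j i) \<in> rels M N"
| lower: "1 \<le> i \<Longrightarrow> i < j \<Longrightarrow> j \<le> M + N \<Longrightarrow> fgen (Lgen Neg 0 i j) \<in> rels M N"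
| diag1: "i \<in> {1..M+N} \<Longrightarrow> fgen (Lgen Neg 0 i i) * fgen (Lgen Pos 0 i i) - 1 \<in> rels M N"
| diag2: "i \<in> {1..M+N} \<Longrightarrow> fgen (Lgen Pos 0 i i) * fgen (Lgen Neg 0 i i) - 1 \<in> rels M N"
| RLL_same: "i \<in> {1..M+N} \<Longrightarrow> j \<in> {1..M+N} \<Longrightarrow> k \<in> {1..M+N} \<Longrightarrow> l \<in> {1..M+N}
    \<Longrightarrow> rll M N s s 1 1 a b i j k l \<in> rels M N"
| RLL_mixed: "i \<in> {1..M+N} \<Longrightarrow> j \<in> {1..M+N} \<Longrightarrow> k \<in> {1..M+N} \<Longrightarrow> l \<in> {1..M+N}
    \<Longrightarrow> rll M N Pos Neg (fgen Qcinv) (fgen Qc) a b i j k l \<in> rels M N"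

inductive_set two_sided :: "'a::ring_1 set \<Rightarrow> 'a set" for S :: "'a set" where
  zero: "0 \<in> two_sided S"
| mult: "x \<in> S \<Longrightarrow> a * x * b \<in> two_sided S"
| add: "x \<in> two_sided S \<Longrightarrow> y \<in> two_sided S \<Longrightarrow> x + y \<in> two_sided S"

lemma two_sided_mult: "x \<in> two_sided S \<Longrightarrow> a * x * b \<in> two_sided S"
proof (induction rule: two_sided.induct)
  case (mult x c d)
  have "a * (c * x * d) * b = (a * c) * x * (d * b)" by (simp add: mult.assoc)
  then show ?case using two_sided.mult[OF mult] by metis
qed (auto simp: algebra_simps intro: two_sided.intros)

lemma two_sided_base: "x \<in> S \<Longrightarrow> x \<in> two_sided S"
  using two_sided.mult[of x S 1 1] by simp

lemma two_sided_left: "x \<in> two_sided S \<Longrightarrow> a * x \<in> two_sided S"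
  using two_sided_mult[of x S a 1] by simp

lemma two_sided_right: "x \<in> two_sided S \<Longrightarrow> x * b \<in> two_sided S"
  using two_sided_mult[of x S 1 b] by simp

lemma two_sided_uminus: "x \<in> two_sided S \<Longrightarrow> - x \<in> two_sided S"
  using two_sided_left[of x S "-1"] by simp

lemma two_sided_diff: "x \<in> two_sided S \<Longrightarrow> y \<in> two_sided S \<Longrightarrow> x - y \<in> two_sided S"
  using two_sided.add[OF _ two_sided_uminus[of y S], of x] by simp

lemma free_induct:
  fixes x :: "'b \<Rightarrow>\<^sub>0 'c::comm_monoid_add"
  assumes "\<And>w c. P (Poly_Mapping.single w c)" "\<And>x y. P x \<Longrightarrow> P y \<Longrightarrow> P (x + y)"
  shows "P x"
proof (induction x rule: Poly_Mapping.update_induct)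
  case const
  show ?case using assms(1)[of _ 0] by simp
next
  case (update f k v)
  have "Poly_Mapping.update k v f = f + Poly_Mapping.single k v"
    using update.hyps
    by (intro poly_mapping_eqI)
      (auto simp: lookup_update lookup_add lookup_single when_def in_keys_iff)
  then show ?case using assms update.IH by auto
qed

lemma free_hom_mult:
  fixes F :: "('b::monoid_add \<Rightarrow>\<^sub>0 'c::ring_1) \<Rightarrow> 'd::ring_1"
  assumes add: "\<And>x y. F (x + y) = F x + F y"
    and single: "\<And>v c w d. F (Poly_Mapping.single v c * Poly_Mapping.single w d)
      = F (Poly_Mapping.single v c) * F (Poly_Mapping.single w d)"
  shows "F (x * y) = F x * F y"
proof (induction x rule: free_induct)
  case (1 v c)
  show ?case
    by (induction y rule: free_induct) (simp_all add: single add distrib_left)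
qed (simp add: add distrib_right)

lemma free_par_add: "free_par M (x + y) = free_par M x + free_par M y"
  unfolding free_par_def
  by (rule poly_mapping_eqI)
    (auto simp: lookup_mapp lookup_add when_def in_keys_iff simp flip: distrib_left)

lemma free_par_single:
  "free_par M (Poly_Mapping.single w c) = Poly_Mapping.single w ((-1) ^ word_par M w * c)"
  unfolding free_par_def
  by (rule poly_mapping_eqI) (auto simp: lookup_mapp lookup_single when_def in_keys_iff)

lemma word_par_add: "word_par M (v + w) = word_par M v + word_par M w"
  by (simp add: word_par_def plus_word_def)

lemma word_par_zero: "word_par M 0 = 0"
  by (simp add: word_par_def zero_word_def)

lemma free_par_mult: "free_par M (x * y) = free_par M x * free_par M y"
  by (rule free_hom_mult[OF free_par_add])
    (simp add: free_par_single mult_single word_par_add power_add algebra_simps)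

lemma free_par_0: "free_par M 0 = 0"
  by (metis free_par_single mult_zero_right single_zero)

lemma free_par_uminus: "free_par M (- x) = - free_par M x"
  using free_par_add[of M x "- x"] free_par_0[of M] by (simp add: eq_neg_iff_add_eq_0 add.commute)

lemma free_par_diff: "free_par M (x - y) = free_par M x - free_par M y"
  using free_par_add[of M x "- y"] by (simp add: free_par_uminus)

lemma free_par_scal: "free_par M (fscal c) = fscal c"
  by (simp add: fscal_def free_par_single word_par_zero)

lemma free_par_1: "free_par M 1 = 1"
  using free_par_scal[of M 1] by (simp add: fscal_def)

lemma free_par_gen: "free_par M (fgen g) = (-1) ^ gen_par M g * fgen g"
proof -
  have "(-1::free) ^ n * fgen g = Poly_Mapping.single (Word [g]) ((-1) ^ n)" for n
    by (induction n) (auto simp: fgen_def single_uminus)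
  then show ?thesis by (simp add: fgen_def free_par_single word_par_def)
qed

lemma free_par_sum: "free_par M (sum f A) = (\<Sum>x\<in>A. free_par M (f x))"
  by (induction A rule: infinite_finite_induct) (auto simp: free_par_0 free_par_add)

lemma free_par_sign: "free_par M ((-1) ^ n * x) = (-1) ^ n * free_par M x"
  by (cases "even n") (auto simp: free_par_uminus)

lemma free_par_involution: "free_par M (free_par M x) = x"
  by (induction x rule: free_induct)
    (simp_all add: free_par_single free_par_add flip: mult.assoc power_add)

definition even4 :: "nat \<Rightarrow> (nat \<Rightarrow> nat \<Rightarrow> nat \<Rightarrow> nat \<Rightarrow> free) \<Rightarrow> bool" where
  "even4 M X \<longleftrightarrow> (\<forall>i j k l. free_par M (X i j k l)
     = (-1) ^ (par M i + par M j + par M k + par M l) * X i j k l)"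

lemma free_par_power: "(free_par M ^^ n) x = (if even n then x else free_par M x)"
  by (induction n) (auto simp: free_par_involution)

lemma sign_swap:
  fixes X Z :: "'a::ring_1"
  assumes "even t \<longleftrightarrow> even (x + y)"
  shows "(-1) ^ a * ((-1) ^ x * X) * ((-1) ^ y * Z) = (-1) ^ t * ((-1) ^ a * X * Z)"
proof -
  have c: "(-1 :: 'a) ^ n = 1 \<or> (-1 :: 'a) ^ n = -1" for n by (cases "even n") auto
  have "(-1 :: 'a) ^ t = (-1) ^ x * (-1) ^ y"
    using assms by (cases "even x"; cases "even y") auto
  then show ?thesis using c[of x] c[of y] c[of a] by auto
qed

lemma even4_gmult2:
  assumes X: "even4 M X" and Y: "even4 M Y"
  shows "even4 M (gmult2 (free_par M) M N X Y)"
  unfolding even4_def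
proof (intro allI)
  fix i m k n
  have *: "free_par M ((-1) ^ a * X i j k l * (free_par M ^^ b) (Y j m l n))
      = (-1) ^ (par M i + par M m + par M k + par M n) *
        ((-1) ^ a * X i j k l * (free_par M ^^ b) (Y j m l n))" for a b j l
  proof -
    let ?x = "par M i + par M j + par M k + par M l" and ?y = "par M j + par M m + par M l + par M n"
    have 1: "free_par M (X i j k l) = (-1) ^ ?x * X i j k l"
      using X by (simp add: even4_def)
    have 2: "free_par M ((free_par M ^^ b) (Y j m l n)) = (-1) ^ ?y * (free_par M ^^ b) (Y j m l n)"
      using Y by (simp add: even4_def free_par_power free_par_sign)
    have "free_par M ((-1) ^ a * X i j k l * (free_par M ^^ b) (Y j m l n))
      = (-1) ^ a * ((-1) ^ ?x * X i j k l) * ((-1) ^ ?y * (free_par M ^^ b) (Y j m l n))"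
      by (simp only: free_par_mult[of M "_ * _"] free_par_sign 1 2)
    also have "\<dots> = (-1) ^ (par M i + par M m + par M k + par M n) *
        ((-1) ^ a * X i j k l * (free_par M ^^ b) (Y j m l n))"
    proof (rule sign_swap)
      show "even (par M i + par M m + par M k + par M n) \<longleftrightarrow> even (?x + ?y)"
        by (simp only: even_add)
          (cases "even (par M i)"; cases "even (par M j)"; cases "even (par M k)";
           cases "even (par M l)"; cases "even (par M m)"; cases "even (par M n)"; simp)
    qed
    finally show ?thesis .
  qed
  show "free_par M (gmult2 (free_par M) M N X Y i m k n)
      = (-1) ^ (par M i + par M m + par M k + par M n) * gmult2 (free_par M) M N X Y i m k n"
    by (simp only: gmult2_def free_par_sum * sum_distrib_left)
qed

lemma sign_parity: "(-1 :: 'a::ring_1) ^ m = (-1) ^ n" if "even m \<longleftrightarrow> even n"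
  using that by (cases "even n") auto

lemma even4_L1: "even4 M (L1 s r)" and even4_L2: "even4 M (L2 s r)"
  unfolding even4_def L1_def L2_def
  by (auto simp: free_par_gen free_par_0 intro!: arg_cong[of _ _ "\<lambda>c. c * _"] sign_parity)

lemma R_ser_off: "\<not> (i = j \<and> k = l) \<Longrightarrow> \<not> (k = j \<and> l = i) \<Longrightarrow> R_ser M N i j k l = 0"
  unfolding R_ser_def Rmat_def by (simp only: if_False mult_zero_left mult_zero_right)

lemma free_par_pow: "free_par M u = u \<Longrightarrow> free_par M (u ^ p) = u ^ p"
  by (induction p) (auto simp: free_par_1 free_par_mult)

lemma even4_Rcoeff: "free_par M u = u \<Longrightarrow> even4 M (Rcoeff M N u p)"
  unfolding even4_def
proof (intro allI)
  fix i j k l assume u: "free_par M u = u"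
  have "free_par M (Rcoeff M N u p i j k l) = Rcoeff M N u p i j k l"
    by (simp add: Rcoeff_def free_par_mult free_par_pow u free_par_scal)
  moreover have "Rcoeff M N u p i j k l = 0 \<or> even (par M i + par M j + par M k + par M l)"
  proof (cases "(i = j \<and> k = l) \<or> (k = j \<and> l = i)")
    case False
    then show ?thesis by (simp add: Rcoeff_def R_ser_off fscal_def)
  next
    case True
    then have "even (par M i + par M j + par M k + par M l)" by auto
    then show ?thesis by blast
  qed
  ultimately show "free_par M (Rcoeff M N u p i j k l)
      = (-1) ^ (par M i + par M j + par M k + par M l) * Rcoeff M N u p i j k l"
    by (elim disjE) (simp_all only: mult_zero_right neg_one_even_power mult_1)
qed

lemma even4_rll:
  assumes "free_par M u = u" "free_par M v = v"
  shows "even4 M (rll M N s t u v a b)"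
proof -
  note left = even4_gmult2[OF even4_gmult2[OF even4_Rcoeff[OF assms(1)] even4_L1] even4_L2]
  note right = even4_gmult2[OF even4_gmult2[OF even4_L2 even4_L1] even4_Rcoeff[OF assms(2)]]
  show ?thesis
    unfolding even4_def rll_def Let_def case_prod_unfold free_par_diff free_par_sum
      right_diff_distrib sum_distrib_left
      left[unfolded even4_def, rule_format] right[unfolded even4_def, rule_format]
    by blast
qed

lemma free_par_rels: "x \<in> rels M N \<Longrightarrow> \<exists>n. free_par M x = (-1) ^ n * x"
proof (induction rule: rels.induct)
  case (Qc_central g)
  show ?case
    by (intro exI[of _ "gen_par M g"], cases "even (gen_par M g)")
      (simp_all add: free_par_diff free_par_mult free_par_gen)
next
  case (diag1 i)
  have "even (par M i + par M i)" by simp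
  then show ?case
    by (intro exI[of _ 0]) (simp add: free_par_diff free_par_mult free_par_gen free_par_1)
next
  case (diag2 i)
  have "even (par M i + par M i)" by simp
  then show ?case
    by (intro exI[of _ 0]) (simp add: free_par_diff free_par_mult free_par_gen free_par_1)
next
  case (RLL_same i j k l s a b)
  show ?case using even4_rll[OF free_par_1 free_par_1] unfolding even4_def by blast
next
  case (RLL_mixed i j k l a b)
  have "free_par M (fgen Qc) = fgen Qc" "free_par M (fgen Qcinv) = fgen Qcinv"
    by (simp_all add: free_par_gen)
  then show ?case using even4_rll unfolding even4_def by blast
qed (auto simp: free_par_diff free_par_mult free_par_gen free_par_1 intro: exI[of _ 0])

lemma free_par_ideal:
  assumes "x \<in> two_sided (rels M N)"
  shows "free_par M x \<in> two_sided (rels M N)"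
  using assms
proof (induction rule: two_sided.induct)
  case (mult x a b)
  then obtain n where "free_par M x = (-1) ^ n * x" using free_par_rels by blast
  then have "free_par M (a * x * b) = (free_par M a * (-1) ^ n) * x * free_par M b"
    by (simp add: free_par_mult mult.assoc)
  then show ?case using two_sided.mult[OF mult] by metis
qed (auto simp: free_par_0 free_par_add intro: two_sided.intros)

text \<open>The ideal of relations is proper, being annihilated by the counit, \<open>L\<^sup>\<plusminus>(z) \<mapsto> 1\<close>, \<open>q\<^sup>c \<mapsto> 1\<close>.\<close>

fun gen_counit :: "nat \<Rightarrow> gen \<Rightarrow> Cq" where
  "gen_counit n (Lgen s r i j) = (if i = j \<and> i \<in> {1..n} \<and> r = 0 then 1 else 0)"
| "gen_counit n Qc = 1"
| "gen_counit n Qcinv = 1"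

definition counit :: "nat \<Rightarrow> free \<Rightarrow> Cq" where
  "counit n x = (\<Sum>w\<in>Poly_Mapping.keys x.
     Poly_Mapping.lookup x w * prod_list (map (gen_counit n) (letters w)))"

lemma counit_superset:
  assumes "finite A" "Poly_Mapping.keys x \<subseteq> A"
  shows "counit n x = (\<Sum>w\<in>A. Poly_Mapping.lookup x w * prod_list (map (gen_counit n) (letters w)))"
  unfolding counit_def using assms
  by (intro sum.mono_neutral_left) (auto simp: in_keys_iff)

lemma counit_add: "counit n (x + y) = counit n x + counit n y"
proof -
  let ?A = "Poly_Mapping.keys x \<union> Poly_Mapping.keys y"
  have "finite ?A" "Poly_Mapping.keys x \<subseteq> ?A" "Poly_Mapping.keys y \<subseteq> ?A"
    "Poly_Mapping.keys (x + y) \<subseteq> ?A"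
    by (auto simp: keys_add)
  then show ?thesis
    using Poly_Mapping.keys_add[of x y]
    by (simp add: counit_superset[of ?A] lookup_add distrib_right sum.distrib)
qed

lemma counit_single:
  "counit n (Poly_Mapping.single w c) = c * prod_list (map (gen_counit n) (letters w))"
  by (subst counit_superset[of "{w}"]) (auto simp: lookup_single)

lemma counit_mult: "counit n (x * y) = counit n x * counit n y"
  by (rule free_hom_mult[OF counit_add])
    (simp add: counit_single mult_single plus_word_def algebra_simps)

lemma counit_0: "counit n 0 = 0"
  by (simp add: counit_def)

lemma counit_uminus: "counit n (- x) = - counit n x"
  using counit_add[of n x "- x"] counit_0[of n] by (simp add: eq_neg_iff_add_eq_0 add.commute)

lemma counit_diff: "counit n (x - y) = counit n x - counit n y"
  using counit_add[of n x "- y"] by (simp add: counit_uminus)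

lemma counit_scal: "counit n (fscal c) = c"
  by (simp add: fscal_def counit_single zero_word_def)

lemma counit_1: "counit n 1 = 1"
  using counit_scal[of n 1] by (simp add: fscal_def)

lemma counit_gen: "counit n (fgen g) = gen_counit n g"
  by (simp add: fgen_def counit_single)

lemma counit_sum: "counit n (sum f A) = (\<Sum>x\<in>A. counit n (f x))"
  by (induction A rule: infinite_finite_induct) (auto simp: counit_0 counit_add)

lemma counit_pow: "counit n (x ^ k) = counit n x ^ k"
  by (induction k) (auto simp: counit_1 counit_mult)

lemma prod_counit_odd: "odd (word_par M w) \<Longrightarrow> prod_list (map (gen_counit n) (letters w)) = 0"
proof -
  have "odd (sum_list (map (gen_par M) gs)) \<Longrightarrow> prod_list (map (gen_counit n) gs) = 0" for gs
  proof (induction gs)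
    case (Cons g gs)
    show ?case
    proof (cases "odd (gen_par M g)")
      case True
      then have "gen_counit n g = 0" by (cases g) auto
      then show ?thesis by simp
    qed (use Cons in auto)
  qed simp
  then show "odd (word_par M w) \<Longrightarrow> prod_list (map (gen_counit n) (letters w)) = 0"
    by (simp add: word_par_def)
qed

lemma counit_par: "counit n (free_par M x) = counit n x"
proof (induction x rule: free_induct)
  case (1 w c)
  show ?case
    by (cases "even (word_par M w)")
      (simp_all add: free_par_single counit_single prod_counit_odd)
qed (simp add: free_par_add counit_add)

lemma counit_par_pow: "counit n ((free_par M ^^ k) x) = counit n x"
  by (induction k) (simp_all add: counit_par)

lemma counit_gmult2:
  "counit n (gmult2 (free_par M) M N X Y i m k l)
     = gmult2 id M N (\<lambda>i j k l. counit n (X i j k l)) (\<lambda>i j k l. counit n (Y i j k l)) i m k l"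
  by (simp add: gmult2_def counit_sum counit_mult counit_pow counit_uminus counit_1
      counit_par_pow)

lemma id_pow: "(id ^^ n) x = x"
  by (induction n) auto

lemma gmult2_diag_right:
  assumes "m \<in> {1..M+N}" "n \<in> {1..M+N}"
    and Y: "\<And>j l. j \<in> {1..M+N} \<Longrightarrow> l \<in> {1..M+N} \<Longrightarrow> Y j m l n = (if j = m \<and> l = n then c else 0)"
  shows "gmult2 id M N X Y i m k n = X i m k n * (c::Cq)"
proof -
  have "gmult2 id M N X Y i m k n
    = (\<Sum>j\<in>{1..M+N}. \<Sum>l\<in>{1..M+N}. if j = m then if l = n then X i m k n * c else 0 else 0)"
    unfolding gmult2_def id_pow by (intro sum.cong refl) (auto simp: Y)
  also have "\<dots> = (\<Sum>j\<in>{1..M+N}. if j = m then (\<Sum>l\<in>{1..M+N}. if l = n then X i m k n * c else 0) else 0)"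
    by (intro sum.cong refl) auto
  finally show ?thesis using assms(1,2) by (simp add: sum.delta)
qed

lemma gmult2_diag_left:
  assumes "i \<in> {1..M+N}" "k \<in> {1..M+N}"
    and X: "\<And>j l. j \<in> {1..M+N} \<Longrightarrow> l \<in> {1..M+N} \<Longrightarrow> X i j k l = (if j = i \<and> l = k then c else 0)"
  shows "gmult2 id M N X Y i m k n = (c::Cq) * Y i m k n"
proof -
  have "gmult2 id M N X Y i m k n
    = (\<Sum>j\<in>{1..M+N}. \<Sum>l\<in>{1..M+N}. if j = i then if l = k then c * Y i m k n else 0 else 0)"
    unfolding gmult2_def id_pow by (intro sum.cong refl) (auto simp: X)
  also have "\<dots> = (\<Sum>j\<in>{1..M+N}. if j = i then (\<Sum>l\<in>{1..M+N}. if l = k then c * Y i m k n else 0) else 0)"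
    by (intro sum.cong refl) auto
  finally show ?thesis using assms(1,2) by (simp add: sum.delta)
qed

lemma counit_rll:
  assumes ijkl: "i \<in> {1..M+N}" "j \<in> {1..M+N}" "k \<in> {1..M+N}" "l \<in> {1..M+N}"
    and uv: "counit (M+N) u = 1" "counit (M+N) v = 1"
  shows "counit (M+N) (rll M N s t u v a b i j k l) = 0"
proof -
  let ?e = "counit (M+N)" and ?m = "gmult2 (free_par M) M N"
  have L1: "?e (L1 s r i j k l) = (if i = j \<and> k = l then if r = 0 then 1 else 0 else 0)"
    if "i \<in> {1..M+N}" for s r i j k l
    using that by (auto simp: L1_def counit_gen counit_0)
  have L2: "?e (L2 s r i j k l) = (if i = j \<and> k = l then if r = 0 then 1 else 0 else 0)"
    if "k \<in> {1..M+N}" for s r i j k l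
    using that by (auto simp: L2_def counit_gen counit_0)
  have R: "?e (Rcoeff M N w p i j k l) = fps_nth (R_ser M N i j k l) p" if "?e w = 1" for w p i j k l
    using that by (simp add: Rcoeff_def counit_mult counit_pow counit_scal)
  note dR = gmult2_diag_right[OF ijkl(2,4)] and dL = gmult2_diag_left[OF ijkl(1,3)]
  have left: "?e (?m (?m (Rcoeff M N u p) (L1 s r)) (L2 t r') i j k l)
     = fps_nth (R_ser M N i j k l) p * (if r = 0 then 1 else 0) * (if r' = 0 then 1 else 0)" for p r r'
  proof -
    have "?e (?m (?m (Rcoeff M N u p) (L1 s r)) (L2 t r') i j k l)
      = ?e (?m (Rcoeff M N u p) (L1 s r) i j k l) * (if r' = 0 then 1 else 0)"
      unfolding counit_gmult2[of _ M N "?m _ _"] by (rule dR) (rule L2)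
    also have "?e (?m (Rcoeff M N u p) (L1 s r) i j k l)
      = ?e (Rcoeff M N u p i j k l) * (if r = 0 then 1 else 0)"
      unfolding counit_gmult2 by (rule dR) (rule L1)
    finally show ?thesis by (simp only: R[OF uv(1)])
  qed
  have 1: "?e (?m (L2 t r') (L1 s r) i j' k l')
     = (if j' = i \<and> l' = k then (if r' = 0 then 1 else 0) * (if r = 0 then 1 else 0) else 0)" for r r' j' l'
  proof -
    have "?e (?m (L2 t r') (L1 s r) i j' k l')
      = (if r' = 0 then 1 else 0) * ?e (L1 s r i j' k l')"
      unfolding counit_gmult2 by (rule dL) (auto simp: L2[OF ijkl(3)])
    then show ?thesis by (auto simp: L1[OF ijkl(1)])
  qed
  have right: "?e (?m (?m (L2 t r') (L1 s r)) (Rcoeff M N v p) i j k l)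
     = fps_nth (R_ser M N i j k l) p * (if r = 0 then 1 else 0) * (if r' = 0 then 1 else 0)" for p r r'
  proof -
    have "?e (?m (?m (L2 t r') (L1 s r)) (Rcoeff M N v p) i j k l)
      = ((if r' = 0 then 1 else 0) * (if r = 0 then 1 else 0)) * ?e (Rcoeff M N v p i j k l)"
      unfolding counit_gmult2[of _ M N "?m _ _"] by (rule dL) (rule 1)
    then show ?thesis by (simp add: R[OF uv(2)])
  qed
  show ?thesis
    unfolding rll_def Let_def counit_diff counit_sum case_prod_unfold left right by simp
qed

lemma counit_rels: "x \<in> rels M N \<Longrightarrow> counit (M+N) x = 0"
  by (induction rule: rels.induct)
    (auto simp: counit_diff counit_mult counit_gen counit_1 intro!: counit_rll)

lemma one_notin_ideal: "1 \<notin> two_sided (rels M N)"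
proof -
  have "counit (M+N) x = 0" if "x \<in> two_sided (rels M N)" for x
    using that by induction (auto simp: counit_0 counit_add counit_mult counit_rels)
  then show ?thesis by (metis counit_1 one_neq_zero)
qed

quotient_type (overloaded) ('m, 'n) Uq = free /
  "\<lambda>x y. x - y \<in> two_sided (rels LENGTH('m::len0) LENGTH('n::len0))"
proof (rule equivpI)
  let ?I = "two_sided (rels LENGTH('m) LENGTH('n))"
  show "reflp (\<lambda>x y. x - y \<in> ?I)" by (rule reflpI) (simp add: two_sided.zero)
  show "symp (\<lambda>x y. x - y \<in> ?I)" by (rule sympI) (metis minus_diff_eq two_sided_uminus)
  show "transp (\<lambda>x y. x - y \<in> ?I)"
  proof (rule transpI)
    fix x y z assume "x - y \<in> ?I" "y - z \<in> ?I"
    then have "(x - y) + (y - z) \<in> ?I" by (rule two_sided.add)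
    then show "x - z \<in> ?I" by simp
  qed
qed

instantiation Uq :: (len0, len0) ring_1
begin

lift_definition zero_Uq :: "('a, 'b) Uq" is 0 .
lift_definition one_Uq :: "('a, 'b) Uq" is 1 .
lift_definition plus_Uq :: "('a, 'b) Uq \<Rightarrow> ('a, 'b) Uq \<Rightarrow> ('a, 'b) Uq" is "(+)"
  by (metis add_diff_add two_sided.add)
lift_definition uminus_Uq :: "('a, 'b) Uq \<Rightarrow> ('a, 'b) Uq" is uminus
  by (metis minus_diff_minus two_sided_uminus)
lift_definition minus_Uq :: "('a, 'b) Uq \<Rightarrow> ('a, 'b) Uq \<Rightarrow> ('a, 'b) Uq" is "(-)"
proof -
  fix x y x' y' :: free
  let ?I = "two_sided (rels LENGTH('a) LENGTH('b))"
  assume "x - y \<in> ?I" "x' - y' \<in> ?I"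
  then have "(x - y) - (x' - y') \<in> ?I" by (rule two_sided_diff)
  then show "x - x' - (y - y') \<in> ?I" by (simp add: algebra_simps)
qed
lift_definition times_Uq :: "('a, 'b) Uq \<Rightarrow> ('a, 'b) Uq \<Rightarrow> ('a, 'b) Uq" is "(*)"
proof -
  fix x y x' y' :: free
  let ?I = "two_sided (rels LENGTH('a) LENGTH('b))"
  assume "x - y \<in> ?I" "x' - y' \<in> ?I"
  then have "(x - y) * x' + y * (x' - y') \<in> ?I"
    by (intro two_sided.add two_sided_left two_sided_right)
  then show "x * x' - y * y' \<in> ?I" by (simp add: algebra_simps)
qed

instance
proof
  show "(0::('a, 'b) Uq) \<noteq> 1"
  proof transfer
    show "0 - 1 \<notin> two_sided (rels LENGTH('a) LENGTH('b))"
    proof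
      assume "0 - 1 \<in> two_sided (rels LENGTH('a) LENGTH('b))"
      from two_sided_uminus[OF this] show False by (simp add: one_notin_ideal)
    qed
  qed
  fix a b c :: "('a, 'b) Uq"
  show "a * b * c = a * (b * c)"
    by transfer (simp add: mult.assoc two_sided.zero)
  show "a + b + c = a + (b + c)"
    by transfer (simp add: add.assoc two_sided.zero)
  show "a + b = b + a"
    by transfer (simp add: add.commute two_sided.zero)
  show "(a + b) * c = a * c + b * c"
    by transfer (simp add: distrib_right two_sided.zero)
  show "a * (b + c) = a * b + a * c"
    by transfer (simp add: distrib_left two_sided.zero)
qed (transfer; simp add: two_sided.zero)+

end

lift_definition lgen :: "pm \<Rightarrow> nat \<Rightarrow> nat \<Rightarrow> nat \<Rightarrow> ('m::len0, 'n::len0) Uq" is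
  "\<lambda>s r i j. fgen (Lgen s r i j)" .

lift_definition scal :: "Cq \<Rightarrow> ('m::len0, 'n::len0) Uq" is fscal .

lift_definition Uq_par :: "('m::len0, 'n::len0) Uq \<Rightarrow> ('m, 'n) Uq" is "free_par LENGTH('m)"
  by (metis free_par_diff free_par_ideal)

text \<open>Depending on the sign \<open>s\<close>, the variable of an \<open>fps\<close> stands for \<open>z\<^sup>-\<^sup>1\<close> or for \<open>z\<close>.\<close>

type_synonym ('m, 'n) umat = "nat \<Rightarrow> nat \<Rightarrow> ('m, 'n) Uq fps"

definition Lser :: "pm \<Rightarrow> ('m::len0, 'n::len0) umat" where
  "Lser s i j = Abs_fps (\<lambda>r. lgen s r i j)"

text \<open>\<open>F(z) \<mapsto> F(z q\<^sup>e)\<close>\<close>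

definition qshift :: "pm \<Rightarrow> int \<Rightarrow> ('m::len0, 'n::len0) Uq fps \<Rightarrow> ('m, 'n) Uq fps" where
  "qshift s e F = Abs_fps (\<lambda>r. scal (qq powi (zexp s * int r * e)) * fps_nth F r)"

definition mshift :: "pm \<Rightarrow> int \<Rightarrow> ('m::len0, 'n::len0) umat \<Rightarrow> ('m, 'n) umat" where
  "mshift s e A = (\<lambda>i j. qshift s e (A i j))"

definition ser_par :: "('m::len0, 'n::len0) Uq fps \<Rightarrow> ('m, 'n) Uq fps" where
  "ser_par F = Abs_fps (\<lambda>r. Uq_par (fps_nth F r))"

definition mmult :: "('m::len0, 'n::len0) umat \<Rightarrow> ('m, 'n) umat \<Rightarrow> ('m, 'n) umat" where
  "mmult A B = gmult ser_par LENGTH('m) LENGTH('n) A B"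

definition mone :: "('m::len0, 'n::len0) umat" where
  "mone i j = (if i = j then 1 else 0)"

definition meq :: "('m::len0, 'n::len0) umat \<Rightarrow> ('m, 'n) umat \<Rightarrow> bool" where
  "meq A B \<longleftrightarrow> (\<forall>i\<in>{1..LENGTH('m)+LENGTH('n)}. \<forall>j\<in>{1..LENGTH('m)+LENGTH('n)}. A i j = B i j)"

definition minv :: "('m::len0, 'n::len0) umat \<Rightarrow> ('m, 'n) umat" where
  "minv A = (THE B. meq (mmult A B) mone \<and> meq (mmult B A) mone \<and>
     (\<forall>i j. i \<notin> {1..LENGTH('m)+LENGTH('n)} \<or> j \<notin> {1..LENGTH('m)+LENGTH('n)} \<longrightarrow> B i j = 0))"

definition strans :: "('m::len0, 'n::len0) umat \<Rightarrow> ('m, 'n) umat" where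
  "strans A = (\<lambda>i j. (-1) ^ (par LENGTH('m) i * (par LENGTH('m) i + par LENGTH('m) j)) * A j i)"

definition D_exp :: "nat \<Rightarrow> nat \<Rightarrow> int" where
  "D_exp M i = (if i \<le> M then 2 * int i else 2 * int M - 2 * (int i - int M - 1))"

definition D_inv :: "('m::len0, 'n::len0) umat" where
  "D_inv i j = (if i = j then fps_const (scal (qq powi (- D_exp LENGTH('m) i))) else 0)"

text \<open>
  The relation has to be read with \<open>D\<^sup>-\<^sup>1\<close> in place of \<open>D\<close> (equivalently, \<open>\<zz>\<close> being central, with
  the two supertransposed factors around \<open>D\<close> exchanged): for the present \<open>R\<close>, no series satisfies
  it with \<open>D\<close>.  For \<open>M = 2\<close>, \<open>N = 0\<close>, with \<open>l\<^sub>i\<^sub>j\<close> the constant terms of \<open>L\<^sup>+(z)\<close>, the (2,1) entry of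
  the constant term of \<open>L(z q\<^sup>-\<^sup>4)\<^sup>t diag(d\<^sub>1,d\<^sub>2) (L(z)\<^sup>-\<^sup>1)\<^sup>t\<close> is
  \<open>(d\<^sub>1 - q\<^sup>2 d\<^sub>2) l\<^sub>1\<^sub>2 l\<^sub>1\<^sub>1\<^sup>-\<^sup>1\<close>.
\<close>

definition zser :: "pm \<Rightarrow> ('m::len0, 'n::len0) Uq fps" where
  "zser s = (THE \<zeta>. meq
     (mmult (mmult (strans (mshift s (2 * int LENGTH('n) - 2 * int LENGTH('m)) (Lser s))) D_inv)
        (strans (minv (Lser s))))
     (\<lambda>i j. \<zeta> * (D_inv :: ('m, 'n) umat) i j))"

definition perm_length :: "nat \<Rightarrow> (nat \<Rightarrow> nat) \<Rightarrow> nat" where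
  "perm_length n \<sigma> = card {(i, j). 1 \<le> i \<and> i < j \<and> j \<le> n \<and> \<sigma> j < \<sigma> i}"

definition Berezinian :: "pm \<Rightarrow> ('m::len0, 'n::len0) umat \<Rightarrow> ('m, 'n) Uq fps" where
  "Berezinian s A =
     (let M = LENGTH('m); N = LENGTH('n) in
      (\<Sum>\<sigma> | \<sigma> permutes {1..M}. fps_const (scal ((- qq) powi (- int (perm_length M \<sigma>)))) *
         (\<Prod>j\<leftarrow>[1..<M+1]. mshift s (2 * int j - 2) A (\<sigma> j) j)) *
      (\<Sum>\<tau> | \<tau> permutes {1..N}. fps_const (scal ((- qq) powi (- int (perm_length N \<tau>)))) *
         (\<Prod>k\<leftarrow>[1..<N+1]. minv (mshift s (2 * int M - 2 * int k) A) (M + k) (M + \<tau> k))))"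

end

theory Submission
  imports Defs "HOL-Combinatorics.Multiset_Permutations"
begin

text \<open>After a change of sign of the entries of the upper right block, the graded matrix product becomes
  the ordinary one, and \<open>L(z)\<close> becomes a matrix over an ordinary ring. Let \<open>X\<^sub>r(z)\<close> be the \<open>(r, r)\<close>
  entry of the inverse of the top-left \<open>r \<times> r\<close> block of \<open>L(z)\<close> and \<open>h\<^sub>r(z)\<close> its inverse (a
  quasi-determinant). All \<open>X\<^sub>r\<close> commute, and by Laplace expansion the Berezinian is
  \<open>h\<^sub>1(z) h\<^sub>2(z q\<^sup>2) \<dots> h\<^sub>M(z q\<^sup>2\<^sup>M\<^sup>-\<^sup>2) X\<^sub>M\<^sub>+\<^sub>1(z q\<^sup>2\<^sup>M\<^sup>-\<^sup>2) \<dots> X\<^sub>M\<^sub>+\<^sub>N(z q\<^sup>2\<^sup>M\<^sup>-\<^sup>2\<^sup>N)\<close>.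
  The defining relation of the series \<open>\<zz>\<close> makes sense for each of the blocks. If it holds for the
  \<open>r\<close>-th block with the series \<open>\<zeta>\<^sub>r\<close>, then the relation between \<open>L\<^sup>-\<^sup>1\<close> and \<open>L\<^sup>-\<^sup>1\<close> at the degenerate
  ratio \<open>q\<^sub>r\<^sup>2\<close> of the arguments shows that it holds for the preceding block with
  \<open>\<zeta>\<^sub>r\<^sub>-\<^sub>1(z) X\<^sub>r(z q\<^sub>r\<^sup>2) = \<zeta>\<^sub>r(z q\<^sub>r\<^sup>2) X\<^sub>r(z)\<close>. Since \<open>\<zeta>\<^sub>0 = 1\<close>, the quotient of the two Berezinians
  telescopes to \<open>\<zz> = \<zeta>\<^sub>M\<^sub>+\<^sub>N\<close>.\<close>

section \<open>Alternating sums\<close>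

text \<open>The decisive identities are degenerations of RLL: at the ratio q_r^2 the coefficient of
  R at the corner (r, r) vanishes, and a four-term relation loses terms until it describes a 2 x 2
  minor. Series in z and w cannot simply be evaluated at such a ratio. It is possible here because
  in each total degree the relation, divided by its invertible scalar factor, is a polynomial in w /
  z. For this reason everything is taken at arguments z q^e with integers e. The condition M
  \<noteq> N enters twice: in the existence and uniqueness of f, and in the existence of the central
  series, whose derivation divides by 1 - q^(2M-2N). The latter argument fails for a block with
  equally many even and odd rows, and for N > M > 0 there is one among the smaller blocks. The
  series is therefore constructed for the whole matrix and passed down to the smaller blocks instead
  of being built up from them.\<close>

locale scaled_ring =
  fixes sc :: "'k::field \<Rightarrow> 'r::ring_1 \<Rightarrow> 'r"
  assumes sc_add_right: "sc a (x + y) = sc a x + sc a y"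
    and sc_add_left: "sc (a + b) x = sc a x + sc b x"
    and sc_sc [simp]: "sc a (sc b x) = sc (a * b) x"
    and sc_1 [simp]: "sc 1 x = x"
    and sc_mult_left [simp]: "sc a x * y = sc a (x * y)"
    and sc_mult_right [simp]: "x * sc a y = sc a (x * y)"
begin

lemma sc_0_left [simp]: "sc 0 x = 0"
  using sc_add_left[of 0 0 x] by simp

lemma sc_0_right [simp]: "sc a 0 = 0"
  using sc_add_right[of a 0 0] by simp

lemma sc_minus_right [simp]: "sc a (- x) = - sc a x"
  using sc_add_right[of a x "- x"] by (simp add: eq_neg_iff_add_eq_0 add.commute)

lemma sc_minus_left [simp]: "sc (- a) x = - sc a x"
  using sc_add_left[of a "- a" x] by (simp add: eq_neg_iff_add_eq_0 add.commute)

lemma sc_diff_right: "sc a (x - y) = sc a x - sc a y"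
  using sc_add_right[of a x "- y"] by simp

lemma sc_diff_left: "sc (a - b) x = sc a x - sc b x"
  using sc_add_left[of a "- b" x] by simp

lemma sc_sum_right: "sc a (sum f A) = (\<Sum>x\<in>A. sc a (f x))"
  by (induction A rule: infinite_finite_induct) (auto simp: sc_add_right)

lemma sc_sum_left: "sc (sum f A) x = (\<Sum>a\<in>A. sc (f a) x)"
  by (induction A rule: infinite_finite_induct) (auto simp: sc_add_left)

lemma sc_cancel: "a \<noteq> 0 \<Longrightarrow> sc a x = sc a y \<longleftrightarrow> x = y"
  by (metis left_inverse sc_1 sc_sc)

lemma sc_eq_0: "a \<noteq> 0 \<Longrightarrow> sc a x = 0 \<longleftrightarrow> x = 0"
  using sc_cancel[of a x 0] by simp

text \<open>The flag selects multiplication in the ring (and the order \<open><\<close> on the columns) or in the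
  opposite ring (and the order \<open>></\<close>), so that one development covers the expansions along the
  first and along the last factor.\<close>

definition opm :: "bool \<Rightarrow> 'r \<Rightarrow> 'r \<Rightarrow> 'r" where
  "opm b x y = (if b then x * y else y * x)"

definition lt :: "bool \<Rightarrow> nat \<Rightarrow> nat \<Rightarrow> bool" where
  "lt b c d \<longleftrightarrow> (if b then c < d else d < c)"

lemma opm_assoc: "opm b (opm b x y) z = opm b x (opm b y z)"
  by (simp add: opm_def mult.assoc)

lemma opm_sc [simp]: "opm b (sc a x) y = sc a (opm b x y)" "opm b x (sc a y) = sc a (opm b x y)"
  by (simp_all add: opm_def)

lemma opm_add: "opm b (x + y) z = opm b x z + opm b y z" "opm b x (y + z) = opm b x y + opm b x z"
  by (simp_all add: opm_def algebra_simps)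

lemma opm_0 [simp]: "opm b 0 x = 0" "opm b x 0 = 0"
  by (simp_all add: opm_def)

lemma opm_sum: "opm b x (sum f A) = (\<Sum>a\<in>A. opm b x (f a))"
  by (simp add: opm_def sum_distrib_left sum_distrib_right)

lemma lt_self [simp]: "{d. d = c \<and> lt b d c} = {}"
  by (auto simp: lt_def)

text \<open>The row at the head of the list has the largest argument, the last row has the argument
  \<open>e\<close>. For \<open>v = - inverse q\<close> the weights multiply to (-q)^(-l).\<close>

fun alt :: "bool \<Rightarrow> 'k \<Rightarrow> (int \<Rightarrow> nat \<Rightarrow> nat \<Rightarrow> 'r) \<Rightarrow> int \<Rightarrow> nat set \<Rightarrow> nat list \<Rightarrow> 'r" where
  "alt b v F e C [] = 1"
| "alt b v F e C (\<rho> # \<rho>s) = (\<Sum>c\<in>C. sc (v ^ card {d \<in> C. lt b d c})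
     (opm b (F (e + 2 * int (length \<rho>s)) \<rho> c) (alt b v F e (C - {c}) \<rho>s)))"

definition pair :: "bool \<Rightarrow> 'k \<Rightarrow> (int \<Rightarrow> nat \<Rightarrow> nat \<Rightarrow> 'r) \<Rightarrow> int \<Rightarrow> nat \<Rightarrow> nat \<Rightarrow> nat \<Rightarrow> nat \<Rightarrow> 'r" where
  "pair b v F e \<rho> \<rho>' c d =
     opm b (F (e + 2) \<rho> c) (F e \<rho>' d) + sc v (opm b (F (e + 2) \<rho> d) (F e \<rho>' c))"

text \<open>Laplace expansion along two rows: the choices (c, d) and (d, c) leave the same columns
  and have weights differing by one factor \<open>v\<close>, so together they contribute one 2 x 2
  minor \<open>pair\<close>.\<close>

lemma alt_pair:
  assumes "finite C"
  shows "alt b v F e C (\<rho> # \<rho>' # \<rho>s) =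
    (\<Sum>(c, d)\<in>{(c, d) \<in> C \<times> C. lt b c d}.
       sc (v ^ card {x \<in> C. lt b x c} * v ^ (card {x \<in> C. lt b x d} - 1))
         (opm b (pair b v F (e + 2 * int (length \<rho>s)) \<rho> \<rho>' c d) (alt b v F e (C - {c, d}) \<rho>s)))"
proof -
  let ?n = "\<lambda>c. card {x \<in> C. lt b x c}" and ?e = "e + 2 * int (length \<rho>s)"
  let ?D = "\<lambda>c d. alt b v F e (C - {c, d}) \<rho>s"
  let ?U = "{(c, d) \<in> C \<times> C. lt b c d}"
  let ?T = "\<lambda>c d. opm b (opm b (F (?e + 2) \<rho> c) (F ?e \<rho>' d)) (?D c d)"
  let ?w = "\<lambda>c d. v ^ ?n c * v ^ card {x \<in> C - {c}. lt b x d}"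
  have fin: "finite ?U" using assms by (auto intro: finite_subset[of _ "C \<times> C"])
  \<comment> \<open>Removing the preceding column lowers the count by one, removing the later one
    does not. The quotient of the two weights is the \<open>v\<close> inside
    \<open>pair\<close>.\<close>
  have n1: "card {x \<in> C - {c}. lt b x d} = ?n d - 1" if "c \<in> C" "lt b c d" for c d
  proof -
    have "{x \<in> C - {c}. lt b x d} = {x \<in> C. lt b x d} - {c}" by auto
    then show ?thesis using that assms by simp
  qed
  have n2: "card {x \<in> C - {d}. lt b x c} = ?n c" if "lt b c d" for c d
  proof -
    have "{x \<in> C - {d}. lt b x c} = {x \<in> C. lt b x c}" using that by (auto simp: lt_def split: if_splits)
    then show ?thesis by simp
  qed
  have n3: "?n d = Suc (?n d - 1)" if "c \<in> C" "lt b c d" for c d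
  proof -
    have "?n d > 0" using that assms by (auto simp: card_gt_0_iff)
    then show ?thesis by simp
  qed
  have "alt b v F e C (\<rho> # \<rho>' # \<rho>s) = (\<Sum>c\<in>C. \<Sum>d\<in>C - {c}. sc (?w c d) (?T c d))"
    by (simp add: opm_sum sc_sum_right opm_assoc insert_commute algebra_simps Diff_insert2[symmetric])
  also have "\<dots> = (\<Sum>(c, d)\<in>(SIGMA c:C. C - {c}). sc (?w c d) (?T c d))"
    using assms by (subst sum.Sigma) auto
  also have "(SIGMA c:C. C - {c}) = ?U \<union> prod.swap ` ?U"
    by (auto simp: image_iff lt_def)
  also have "(\<Sum>(c, d)\<in>?U \<union> prod.swap ` ?U. sc (?w c d) (?T c d)) =
      (\<Sum>(c, d)\<in>?U. sc (?w c d) (?T c d)) + (\<Sum>(c, d)\<in>prod.swap ` ?U. sc (?w c d) (?T c d))"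
    using fin by (intro sum.union_disjoint) (auto simp: lt_def split: if_splits)
  also have "(\<Sum>(c, d)\<in>prod.swap ` ?U. sc (?w c d) (?T c d)) = (\<Sum>(c, d)\<in>?U. sc (?w d c) (?T d c))"
    by (subst sum.reindex) (auto simp: case_prod_unfold)
  also have "(\<Sum>(c, d)\<in>?U. sc (?w c d) (?T c d)) + (\<Sum>(c, d)\<in>?U. sc (?w d c) (?T d c)) =
     (\<Sum>(c, d)\<in>?U. sc (v ^ ?n c * v ^ (?n d - 1)) (opm b (pair b v F ?e \<rho> \<rho>' c d) (?D c d)))"
    unfolding sum.distrib[symmetric]
  proof (intro sum.cong refl, clarify)
    fix c d assume cd: "c \<in> C" "d \<in> C" "lt b c d"
    have w1: "?w c d = v ^ ?n c * v ^ (?n d - 1)" using n1 cd by simp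
    have w2: "?w d c = v ^ ?n c * v ^ (?n d - 1) * v"
    proof -
      obtain m where "?n d = Suc m" using n3[OF cd(1,3)] by blast
      then show ?thesis using n2[OF cd(3)] by simp
    qed
    show "sc (?w c d) (?T c d) + sc (?w d c) (?T d c) =
        sc (v ^ ?n c * v ^ (?n d - 1)) (opm b (pair b v F ?e \<rho> \<rho>' c d) (?D c d))"
      unfolding w1 w2 by (simp add: pair_def opm_add sc_add_right insert_commute)
  qed
  finally show ?thesis .
qed

text \<open>The first row is moved past its successors until it meets its copy, where every minor
  \<open>pair\<close> vanishes. The scalar of each exchange must be the same for all arguments and
  columns, since it is taken out of the sum in \<open>alt_pair\<close>.\<close>

lemma alt_repeated:
  assumes zero: "\<And>e \<rho> c d. \<rho> \<in> P \<Longrightarrow> c \<in> Cs \<Longrightarrow> d \<in> Cs \<Longrightarrow> lt b c d \<Longrightarrow> pair b v F e \<rho> \<rho> c d = 0"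
    and swap: "\<And>\<rho> \<rho>'. \<rho> \<in> P \<Longrightarrow> \<rho>' \<in> P \<Longrightarrow> \<rho> \<noteq> \<rho>' \<Longrightarrow> \<exists>k. \<forall>e. \<forall>c\<in>Cs. \<forall>d\<in>Cs. lt b c d \<longrightarrow>
      pair b v F e \<rho> \<rho>' c d = sc k (pair b v F e \<rho>' \<rho> c d)"
    and "finite C" "C \<subseteq> Cs" "set \<rho>s \<subseteq> P" "\<rho> \<in> set \<rho>s"
  shows "alt b v F e C (\<rho> # \<rho>s) = 0"
  using assms(3-)
proof (induction \<rho>s arbitrary: C)
  case (Cons \<rho>' \<rho>s)
  note C = Cons.prems
  show ?case
  proof (cases "\<rho>' = \<rho>")
    case True
    have "pair b v F e' \<rho> \<rho> c d = 0" if "c \<in> C" "d \<in> C" "lt b c d" for e' c d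
      using C that by (intro zero) auto
    then show ?thesis
      unfolding alt_pair[OF C(1)] True by (intro sum.neutral) auto
  next
    case False
    from C have "\<rho> \<in> P" "\<rho>' \<in> P" by auto
    with swap[of \<rho> \<rho>'] False obtain k where k: "\<And>e c d. c \<in> Cs \<Longrightarrow> d \<in> Cs \<Longrightarrow> lt b c d \<Longrightarrow>
      pair b v F e \<rho> \<rho>' c d = sc k (pair b v F e \<rho>' \<rho> c d)" by auto
    have "alt b v F e C (\<rho> # \<rho>' # \<rho>s) = sc k (alt b v F e C (\<rho>' # \<rho> # \<rho>s))"
      unfolding alt_pair[OF C(1)] sc_sum_right
    proof (intro sum.cong refl, clarify)
      fix c d assume cd: "c \<in> C" "d \<in> C" "lt b c d"
      then have "pair b v F e' \<rho> \<rho>' c d = sc k (pair b v F e' \<rho>' \<rho> c d)" for e'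
        using C(2) by (intro k) auto
      then show "sc (v ^ card {x \<in> C. lt b x c} * v ^ (card {x \<in> C. lt b x d} - 1))
          (opm b (pair b v F (e + 2 * int (length \<rho>s)) \<rho> \<rho>' c d) (alt b v F e (C - {c, d}) \<rho>s)) =
        sc k (sc (v ^ card {x \<in> C. lt b x c} * v ^ (card {x \<in> C. lt b x d} - 1))
          (opm b (pair b v F (e + 2 * int (length \<rho>s)) \<rho>' \<rho> c d) (alt b v F e (C - {c, d}) \<rho>s)))"
        by (simp add: mult.commute)
    qed
    \<comment> \<open>Expansion along \<open>\<rho>'\<close> leaves lists that start with
      \<open>\<rho>\<close> and still contain its copy, which the induction hypothesis
      covers.\<close>
    also have "alt b v F e C (\<rho>' # \<rho> # \<rho>s) = 0"
    proof (subst alt.simps, rule sum.neutral, rule ballI)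
      fix c assume "c \<in> C"
      have "alt b v F e (C - {c}) (\<rho> # \<rho>s) = 0" using Cons False by (intro Cons.IH) auto
      then show "sc (v ^ card {d \<in> C. lt b d c}) (opm b (F (e + 2 * int (length (\<rho> # \<rho>s))) \<rho>' c)
           (alt b v F e (C - {c}) (\<rho> # \<rho>s))) = 0" by (simp only: opm_0 sc_0_right)
    qed
    finally show ?thesis by simp
  qed
qed simp

end

section \<open>RLL relations for inverses of blocks\<close>

definition blk :: "nat \<Rightarrow> nat set" where
  "blk r = {1..r}"

lemma in_blk: "i \<in> blk r \<longleftrightarrow> 1 \<le> i \<and> i \<le> r"
  by (simp add: blk_def)

lemma finite_blk [simp]: "finite (blk r)"
  by (simp add: blk_def)

lemma blk_mono: "i \<in> blk r \<Longrightarrow> r \<le> r' \<Longrightarrow> i \<in> blk r'"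
  by (simp add: in_blk)

lemma blk_Suc: "blk (Suc r) = insert (Suc r) (blk r)"
  by (auto simp: blk_def)

lemma Suc_notin_blk [simp]: "Suc r \<notin> blk r"
  by (simp add: blk_def)

lemma Suc_in_blk [simp]: "Suc r \<in> blk (Suc r)"
  by (simp add: blk_def)

lemma blk_SucI: "i \<in> blk r \<Longrightarrow> i \<in> blk (Suc r)"
  by (simp add: blk_def)

lemma blk_neq_Suc: "i \<in> blk r \<Longrightarrow> i \<noteq> Suc r" "i \<in> blk r \<Longrightarrow> Suc r \<noteq> i"
  by (auto simp: blk_def)

lemma blk_less: "i \<in> blk r \<Longrightarrow> i < Suc r" "i \<in> blk r \<Longrightarrow> \<not> Suc r < i"
  by (auto simp: blk_def)

text \<open>\<open>l e\<close> and \<open>li r e\<close> stand for \<open>L(z q\<^sup>e)\<close> and for the inverse of its top-left \<open>r \<times> r\<close> block, \<open>sh d\<close> for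
  the substitution \<open>z \<mapsto> z q\<^sup>d\<close>. The factor \<open>1 - t\<close> in \<open>RLL\<close> vanishes at equal arguments; the last
  assumption recovers commutation there.\<close>

locale rll_family = scaled_ring sc for sc :: "'k::field \<Rightarrow> 'r::ring_1 \<Rightarrow> 'r" +
  fixes M n :: nat and q :: 'k
    and l :: "int \<Rightarrow> nat \<Rightarrow> nat \<Rightarrow> 'r"
    and li :: "nat \<Rightarrow> int \<Rightarrow> nat \<Rightarrow> nat \<Rightarrow> 'r"
    and s2 :: "nat \<Rightarrow> nat \<Rightarrow> 'k" and qr :: "nat \<Rightarrow> 'k"
    and aa cc :: "nat \<Rightarrow> nat \<Rightarrow> 'k \<Rightarrow> 'k"
    and sh :: "int \<Rightarrow> 'r \<Rightarrow> 'r"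
  defines "s2 \<equiv> \<lambda>i j. if i \<le> M \<or> j \<le> M then 1 else -1"
    and "qr \<equiv> \<lambda>i. if i \<le> M then q else inverse q"
    and "aa \<equiv> \<lambda>i k t. if i = k then qr i - t * inverse (qr i) else 1 - t"
    and "cc \<equiv> \<lambda>i k t. if i = k then 0 else if i < k then q - inverse q else t * (q - inverse q)"
  assumes q_0: "q \<noteq> 0"
    and q_powi: "d \<noteq> 0 \<Longrightarrow> q powi d \<noteq> 1"
    and RLL: "\<lbrakk>i \<in> blk n; k \<in> blk n; m \<in> blk n; j \<in> blk n; t = q powi (f - e)\<rbrakk> \<Longrightarrow>
        sc (s2 i k * s2 m k * s2 i m * aa i k t) (l e i m * l f k j) + sc (cc i k t) (l e k m * l f i j)
      = sc (s2 m j * s2 i j * s2 i m * aa m j t) (l f k j * l e i m) + sc (cc j m t) (l f k m * l e i j)"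
    and l_li: "r \<le> n \<Longrightarrow> i \<in> blk r \<Longrightarrow> k \<in> blk r \<Longrightarrow>
      (\<Sum>j\<in>blk r. l e i j * li r e j k) = (if i = k then 1 else 0)"
    and li_l: "r \<le> n \<Longrightarrow> i \<in> blk r \<Longrightarrow> k \<in> blk r \<Longrightarrow>
      (\<Sum>j\<in>blk r. li r e i j * l e j k) = (if i = k then 1 else 0)"
    and sh_add: "sh d (x + y) = sh d x + sh d y"
    and sh_mult: "sh d (x * y) = sh d x * sh d y"
    and sh_1: "sh d 1 = 1"
    and sh_l: "sh d (l e i j) = l (e + d) i j"
    and sh_continuation: "(\<And>d. d \<noteq> 0 \<Longrightarrow> sh d x * y = y * sh d x) \<Longrightarrow> x * y = y * x"
begin

lemma s2_sym: "s2 i j = s2 j i"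
  by (auto simp: s2_def)

lemma s2_square [simp]: "s2 i j * s2 i j = 1" "s2 i j * (s2 i j * x) = x"
  by (auto simp: s2_def)

lemma mult_if: "x * (if P then y else 0) = (if P then x * y else 0)"
    "(if P then y else 0) * x = (if P then y * x else 0)" for x y :: 'r
  by auto

text \<open>RLL is multiplied on both sides by the inverse block at the argument \<open>f\<close>.
  This stays within the block because RLL only permutes the indices of its entries. In each of the
  four terms one product of the block and its inverse contracts to a Kronecker delta.\<close>

lemma inv_rll:
  assumes r: "r \<le> n" and ix: "i \<in> blk r" "m \<in> blk r" "x \<in> blk r" "y \<in> blk r"
    and t: "t = q powi (f - e)"
  shows "sc (s2 i y * s2 m y * s2 i m * aa i y t) (li r f x y * l e i m)
      + (if i = y then \<Sum>k\<in>blk r. sc (cc i k t) (li r f x k * l e k m) else 0)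
    = sc (s2 m x * s2 i x * s2 i m * aa m x t) (l e i m * li r f x y)
      + (if x = m then \<Sum>k\<in>blk r. sc (cc k m t) (l e i k * li r f k y) else 0)"
proof -
  let ?W = "\<lambda>z. \<Sum>k\<in>blk r. \<Sum>j\<in>blk r. li r f x k * z k j * li r f j y"
  have W_add: "?W (\<lambda>k j. z k j + z' k j) = ?W z + ?W z'" for z z'
    by (simp add: algebra_simps sum.distrib)
  have right: "(\<Sum>j\<in>blk r. l f k j * li r f j y) = (if k = y then 1 else 0)" if "k \<in> blk r" for k
    using l_li[OF r that ix(4)] .
  have left: "(\<Sum>k\<in>blk r. li r f x k * l f k j) = (if x = j then 1 else 0)" if "j \<in> blk r" for j
    using li_l[OF r ix(3) that] .
  let ?A = "\<lambda>k. s2 i k * s2 m k * s2 i m * aa i k t"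
  let ?B = "\<lambda>j. s2 m j * s2 i j * s2 i m * aa m j t"
  have 1: "?W (\<lambda>k j. sc (?A k) (l e i m * l f k j)) = sc (?A y) (li r f x y * l e i m)"
  proof -
    have "?W (\<lambda>k j. sc (?A k) (l e i m * l f k j))
      = (\<Sum>k\<in>blk r. sc (?A k) (li r f x k * (l e i m * (\<Sum>j\<in>blk r. l f k j * li r f j y))))"
      by (simp add: sum_distrib_left sc_sum_right mult.assoc)
    also have "\<dots> = (\<Sum>k\<in>blk r. if k = y then sc (?A k) (li r f x k * l e i m) else 0)"
      by (intro sum.cong refl) (simp add: right)
    finally show ?thesis using ix by (simp add: sum.delta)
  qed
  have 2: "?W (\<lambda>k j. sc (cc i k t) (l e k m * l f i j))
     = (if i = y then \<Sum>k\<in>blk r. sc (cc i k t) (li r f x k * l e k m) else 0)"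
  proof -
    have "?W (\<lambda>k j. sc (cc i k t) (l e k m * l f i j))
      = (\<Sum>k\<in>blk r. sc (cc i k t) (li r f x k * (l e k m * (\<Sum>j\<in>blk r. l f i j * li r f j y))))"
      by (simp add: sum_distrib_left sc_sum_right mult.assoc)
    then show ?thesis by (simp add: right[OF ix(1)])
  qed
  have 3: "?W (\<lambda>k j. sc (?B j) (l f k j * l e i m)) = sc (?B x) (l e i m * li r f x y)"
  proof -
    have "?W (\<lambda>k j. sc (?B j) (l f k j * l e i m))
      = (\<Sum>j\<in>blk r. sc (?B j) ((\<Sum>k\<in>blk r. li r f x k * l f k j) * (l e i m * li r f j y)))"
      by (subst sum.swap) (simp add: sum_distrib_right sc_sum_right mult.assoc)
    also have "\<dots> = (\<Sum>j\<in>blk r. if j = x then sc (?B j) (l e i m * li r f j y) else 0)"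
      by (intro sum.cong refl) (simp add: left)
    finally show ?thesis using ix by (simp add: sum.delta)
  qed
  have 4: "?W (\<lambda>k j. sc (cc j m t) (l f k m * l e i j))
     = (if x = m then \<Sum>k\<in>blk r. sc (cc k m t) (l e i k * li r f k y) else 0)"
  proof -
    have "?W (\<lambda>k j. sc (cc j m t) (l f k m * l e i j))
      = (\<Sum>j\<in>blk r. sc (cc j m t) ((\<Sum>k\<in>blk r. li r f x k * l f k m) * (l e i j * li r f j y)))"
      by (subst sum.swap) (simp add: sum_distrib_right sc_sum_right mult.assoc)
    then show ?thesis by (simp add: left[OF ix(2)])
  qed
  have "?W (\<lambda>k j. sc (?A k) (l e i m * l f k j) + sc (cc i k t) (l e k m * l f i j))
    = ?W (\<lambda>k j. sc (?B j) (l f k j * l e i m) + sc (cc j m t) (l f k m * l e i j))"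
    using r ix t by (intro sum.cong refl arg_cong2[of _ _ _ _ "(*)"] RLL) (auto intro: blk_mono)
  then show ?thesis unfolding W_add 1 2 3 4 .
qed

text \<open>The same contraction, applied to \<open>inv_rll\<close> with the inverse block at the
  argument \<open>e\<close>. The weights \<open>s2 i x * s2 m i * s2 m y\<close> make the
  coefficient of each term independent of the index that is contracted.\<close>

lemma inv_inv_rll:
  assumes r: "r \<le> n" and ix: "a \<in> blk r" "b \<in> blk r" "x \<in> blk r" "y \<in> blk r"
    and t: "t = q powi (f - e)"
  shows "sc (s2 b x * s2 b y * aa b y t) (li r e a b * li r f x y)
      + sc (s2 x y * cc y b t) (li r e a y * li r f x b)
    = sc (s2 a x * s2 a y * aa a x t) (li r f x y * li r e a b)
      + sc (s2 x y * cc a x t) (li r f a y * li r e x b)"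
proof -
  let ?W = "\<lambda>z. \<Sum>i\<in>blk r. \<Sum>m\<in>blk r. sc (s2 i x * s2 m i * s2 m y) (li r e a i * z i m * li r e m b)"
  have W_add: "?W (\<lambda>k j. z k j + z' k j) = ?W z + ?W z'" for z z'
    by (simp add: algebra_simps sum.distrib sc_add_right)
  have right: "(\<Sum>m\<in>blk r. l e i m * li r e m b) = (if i = b then 1 else 0)" if "i \<in> blk r" for i
    using l_li[OF r that ix(2)] .
  have left: "(\<Sum>i\<in>blk r. li r e a i * l e i m) = (if a = m then 1 else 0)" if "m \<in> blk r" for m
    using li_l[OF r ix(1) that] .
  have 1: "?W (\<lambda>i m. sc (s2 i y * s2 m y * s2 i m * aa i y t) (li r f x y * l e i m))
    = sc (s2 b x * s2 b y * aa b y t) (li r e a b * li r f x y)"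
  proof -
    have s: "s2 i x * s2 m i * s2 m y * (s2 i y * s2 m y * s2 i m * aa i y t) = s2 i x * s2 i y * aa i y t" for i m
      by (auto simp: s2_def)
    have "?W (\<lambda>i m. sc (s2 i y * s2 m y * s2 i m * aa i y t) (li r f x y * l e i m))
      = (\<Sum>i\<in>blk r. sc (s2 i x * s2 i y * aa i y t) (li r e a i * (li r f x y * (\<Sum>m\<in>blk r. l e i m * li r e m b))))"
      by (simp add: s sum_distrib_left sc_sum_right mult.assoc[where 'a='r])
    also have "\<dots> = (\<Sum>i\<in>blk r. if i = b then sc (s2 i x * s2 i y * aa i y t) (li r e a i * li r f x y) else 0)"
      by (intro sum.cong refl) (simp add: right)
    finally show ?thesis using ix by (simp add: sum.delta)
  qed
  have 2: "?W (\<lambda>i m. if i = y then \<Sum>k\<in>blk r. sc (cc i k t) (li r f x k * l e k m) else 0)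
    = sc (s2 x y * cc y b t) (li r e a y * li r f x b)"
  proof -
    have s: "s2 y x * s2 m y * s2 m y * c = s2 x y * c" for m c
      by (auto simp: s2_def)
    have "?W (\<lambda>i m. if i = y then \<Sum>k\<in>blk r. sc (cc i k t) (li r f x k * l e k m) else 0)
      = (\<Sum>i\<in>blk r. if i = y then \<Sum>m\<in>blk r. sc (s2 i x * s2 m i * s2 m y) (li r e a i *
           (\<Sum>k\<in>blk r. sc (cc i k t) (li r f x k * l e k m)) * li r e m b) else 0)"
      by (intro sum.cong refl) auto
    also have "\<dots> = (\<Sum>m\<in>blk r. \<Sum>k\<in>blk r. sc (s2 x y * cc y k t) (li r e a y * (li r f x k * (l e k m * li r e m b))))"
      using ix by (simp add: sum.delta sum_distrib_left sum_distrib_right sc_sum_right s mult.assoc[where 'a='r])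
    also have "\<dots> = (\<Sum>k\<in>blk r. sc (s2 x y * cc y k t) (li r e a y * (li r f x k * (\<Sum>m\<in>blk r. l e k m * li r e m b))))"
      by (subst sum.swap) (simp add: sum_distrib_left sc_sum_right mult.assoc[where 'a='r])
    also have "\<dots> = (\<Sum>k\<in>blk r. if k = b then sc (s2 x y * cc y k t) (li r e a y * li r f x k) else 0)"
      by (intro sum.cong refl) (simp add: right)
    finally show ?thesis using ix by (simp add: sum.delta)
  qed
  have 3: "?W (\<lambda>i m. sc (s2 m x * s2 i x * s2 i m * aa m x t) (l e i m * li r f x y))
    = sc (s2 a x * s2 a y * aa a x t) (li r f x y * li r e a b)"
  proof -
    have s: "s2 i x * s2 m i * s2 m y * (s2 m x * s2 i x * s2 i m * aa m x t) = s2 m x * s2 m y * aa m x t" for i m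
      by (auto simp: s2_def)
    have "?W (\<lambda>i m. sc (s2 m x * s2 i x * s2 i m * aa m x t) (l e i m * li r f x y))
      = (\<Sum>m\<in>blk r. sc (s2 m x * s2 m y * aa m x t) ((\<Sum>i\<in>blk r. li r e a i * l e i m) * (li r f x y * li r e m b)))"
      by (subst sum.swap) (simp add: s sum_distrib_right sc_sum_right mult.assoc[where 'a='r])
    also have "\<dots> = (\<Sum>m\<in>blk r. if m = a then sc (s2 m x * s2 m y * aa m x t) (li r f x y * li r e m b) else 0)"
      by (intro sum.cong refl) (simp add: left)
    finally show ?thesis using ix by (simp add: sum.delta)
  qed
  have 4: "?W (\<lambda>i m. if x = m then \<Sum>k\<in>blk r. sc (cc k m t) (l e i k * li r f k y) else 0)
    = sc (s2 x y * cc a x t) (li r f a y * li r e x b)"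
  proof -
    have s: "s2 i x * s2 x i * s2 x y * c = s2 x y * c" for i c
      by (auto simp: s2_def)
    have "?W (\<lambda>i m. if x = m then \<Sum>k\<in>blk r. sc (cc k m t) (l e i k * li r f k y) else 0)
      = (\<Sum>i\<in>blk r. \<Sum>m\<in>blk r. if m = x then sc (s2 i x * s2 m i * s2 m y) (li r e a i *
           (\<Sum>k\<in>blk r. sc (cc k m t) (l e i k * li r f k y)) * li r e m b) else 0)"
      by (intro sum.cong refl) auto
    also have "\<dots> = (\<Sum>i\<in>blk r. \<Sum>k\<in>blk r. sc (s2 x y * cc k x t) (li r e a i * (l e i k * (li r f k y * li r e x b))))"
      using ix by (simp add: sum.delta sum_distrib_left sum_distrib_right sc_sum_right s mult.assoc[where 'a='r])
    also have "\<dots> = (\<Sum>k\<in>blk r. sc (s2 x y * cc k x t) ((\<Sum>i\<in>blk r. li r e a i * l e i k) * (li r f k y * li r e x b)))"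
      by (subst sum.swap) (simp add: sum_distrib_right sc_sum_right mult.assoc[where 'a='r])
    also have "\<dots> = (\<Sum>k\<in>blk r. if k = a then sc (s2 x y * cc k x t) (li r f k y * li r e x b) else 0)"
      by (intro sum.cong refl) (simp add: left)
    finally show ?thesis using ix by (simp add: sum.delta)
  qed
  have "?W (\<lambda>i m. sc (s2 i y * s2 m y * s2 i m * aa i y t) (li r f x y * l e i m)
      + (if i = y then \<Sum>k\<in>blk r. sc (cc i k t) (li r f x k * l e k m) else 0))
    = ?W (\<lambda>i m. sc (s2 m x * s2 i x * s2 i m * aa m x t) (l e i m * li r f x y)
      + (if x = m then \<Sum>k\<in>blk r. sc (cc k m t) (l e i k * li r f k y) else 0))"
    using ix by (intro sum.cong refl arg_cong2[of _ _ _ _ "(*)"] arg_cong2[of _ _ _ _ sc] inv_rll[OF r _ _ _ _ t]) auto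
  then show ?thesis unfolding W_add 1 2 3 4 .
qed

lemma q_inv: "q - inverse q \<noteq> 0"
proof -
  have "q * q \<noteq> 1" using q_powi[of 2] by (simp add: power_int_def power2_eq_square)
  then show ?thesis using q_0 by (auto simp: field_simps)
qed

lemma qr_0: "qr i \<noteq> 0"
  using q_0 by (simp add: qr_def)

definition eps :: "nat \<Rightarrow> int" where
  "eps r = (if r \<le> M then 2 else -2)"

lemma powi_eps: "q powi eps r = qr r * qr r"
  by (simp add: eps_def qr_def power_int_def power2_eq_square)

lemma one_minus_sq: "1 - qr r * qr r = - (qr r * s2 r r * (q - inverse q))"
  using q_0 by (simp add: qr_def s2_def field_simps)

lemma li_unique:
  assumes r: "r \<le> n" and "\<And>i. i \<in> blk r \<Longrightarrow> (\<Sum>j\<in>blk r. l e i j * B j) = (if i = k then 1 else 0)"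
    and "a \<in> blk r" "k \<in> blk r"
  shows "B a = li r e a k"
proof -
  have "(\<Sum>i\<in>blk r. \<Sum>j\<in>blk r. li r e a i * (l e i j * B j)) = (\<Sum>i\<in>blk r. if i = k then li r e a i else 0)"
    using assms(2) by (simp add: sum_distrib_left[symmetric] mult_if)
  also have "(\<Sum>i\<in>blk r. \<Sum>j\<in>blk r. li r e a i * (l e i j * B j)) = (\<Sum>j\<in>blk r. (\<Sum>i\<in>blk r. li r e a i * l e i j) * B j)"
    by (subst sum.swap) (simp add: sum_distrib_right mult.assoc)
  also have "\<dots> = (\<Sum>j\<in>blk r. if j = a then B j else 0)"
    by (intro sum.cong refl) (use li_l[OF r assms(3)] in auto)
  finally show ?thesis using assms(3,4) by simp
qed

lemma sh_0: "sh d 0 = 0"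
  using sh_add[of d 0 0] by simp

lemma sh_sum: "sh d (sum f A) = (\<Sum>x\<in>A. sh d (f x))"
  by (induction A rule: infinite_finite_induct) (auto simp: sh_0 sh_add)

lemma sh_li:
  assumes "r \<le> n" "i \<in> blk r" "k \<in> blk r"
  shows "sh d (li r e i k) = li r (e + d) i k"
proof (rule li_unique[OF assms(1) _ assms(2,3)])
  fix i assume "i \<in> blk r"
  have "(\<Sum>j\<in>blk r. l (e + d) i j * sh d (li r e j k)) = sh d (\<Sum>j\<in>blk r. l e i j * li r e j k)"
    by (simp add: sh_sum sh_mult sh_l)
  then show "(\<Sum>j\<in>blk r. l (e + d) i j * sh d (li r e j k)) = (if i = k then 1 else 0)"
    using l_li[OF assms(1) \<open>i \<in> blk r\<close> assms(3)] by (simp add: sh_1 sh_0)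
qed

lemma commute_li:
  assumes r: "r \<le> n" and x: "\<And>i j. i \<in> blk r \<Longrightarrow> j \<in> blk r \<Longrightarrow> x * l e i j = l e i j * x"
    and ik: "i \<in> blk r" "k \<in> blk r"
  shows "x * li r e i k = li r e i k * x"
proof -
  have "(\<Sum>a\<in>blk r. \<Sum>b\<in>blk r. li r e i a * (x * l e a b) * li r e b k) = (\<Sum>a\<in>blk r. if a = k then li r e i a * x else 0)"
    using l_li[OF r _ ik(2)] by (simp add: mult.assoc sum_distrib_left[symmetric] mult_if)
  also have "(\<Sum>a\<in>blk r. \<Sum>b\<in>blk r. li r e i a * (x * l e a b) * li r e b k)
     = (\<Sum>b\<in>blk r. (\<Sum>a\<in>blk r. li r e i a * l e a b) * (x * li r e b k))"
    by (subst sum.swap) (simp add: x sum_distrib_right mult.assoc)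
  also have "\<dots> = (\<Sum>b\<in>blk r. if b = i then x * li r e b k else 0)"
    by (intro sum.cong refl) (use li_l[OF r ik(1)] in auto)
  finally show ?thesis using ik by simp
qed

section \<open>Corner entries of the block inverses\<close>

definition X :: "nat \<Rightarrow> int \<Rightarrow> 'r" where
  "X r e = li r e r r"

text \<open>For \<open>x = y = Suc r\<close> both sums in \<open>inv_rll\<close> disappear, as
  \<open>i\<close> and \<open>m\<close> differ from \<open>Suc r\<close>, and the two remaining
  terms have the same multiple of \<open>1 - t\<close> as coefficient. At equal arguments this is
  zero, and \<open>sh_continuation\<close> takes over.\<close>

lemma X_l:
  assumes r: "Suc r \<le> n" and ix: "i \<in> blk r" "m \<in> blk r"
  shows "X (Suc r) f * l e i m = l e i m * X (Suc r) f"
proof -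
  have neq: "X (Suc r) f * l e i m = l e i m * X (Suc r) f" if "e \<noteq> f" for f
  proof -
    have t: "1 - q powi (f - e) \<noteq> 0" using q_powi[of "f - e"] that by simp
    have "sc (s2 i (Suc r) * s2 m (Suc r) * s2 i m * (1 - q powi (f - e))) (X (Suc r) f * l e i m)
      = sc (s2 m (Suc r) * s2 i (Suc r) * s2 i m * (1 - q powi (f - e))) (l e i m * X (Suc r) f)"
      using inv_rll[OF r, of i m "Suc r" "Suc r" "q powi (f - e)" f e] ix blk_neq_Suc
      by (simp add: blk_SucI aa_def X_def)
    moreover have "s2 i (Suc r) * s2 m (Suc r) * s2 i m * (1 - q powi (f - e)) \<noteq> 0"
      using t by (auto simp: s2_def)
    ultimately show ?thesis by (metis sc_cancel mult.commute)
  qed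
  show ?thesis
  proof (cases "e = f")
    case True
    show ?thesis unfolding True
    proof (rule sh_continuation)
      fix d :: int assume "d \<noteq> 0"
      then show "sh d (X (Suc r) f) * l f i m = l f i m * sh d (X (Suc r) f)"
        using neq[of "f + d"] True by (simp add: X_def sh_li[OF r])
    qed
  qed (rule neq)
qed

text \<open>With all indices equal to \<open>r\<close>, \<open>inv_inv_rll\<close> has the factor
  \<open>aa r r t\<close> on both sides. It vanishes only at the ratio \<open>qr r * qr r\<close>.
  As \<open>q\<close> is not a root of unity, the inverse ratio is then a different one, and
  exchanging \<open>e\<close> and \<open>f\<close> settles the exceptional case.\<close>

lemma X_X:
  assumes r: "r \<in> blk n"
  shows "X r e * X r f = X r f * X r e"
proof -
  have *: "X r e * X r f = X r f * X r e" if "q powi (f - e) \<noteq> qr r * qr r" for e f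
  proof -
    have r': "r \<le> n" "r \<in> blk r" using r by (auto simp: in_blk)
    have "aa r r (q powi (f - e)) \<noteq> 0"
      using that qr_0[of r] by (auto simp: aa_def field_simps)
    then show ?thesis
      using inv_inv_rll[OF r'(1) r'(2) r'(2) r'(2) r'(2) refl, of f e]
      by (simp add: cc_def sc_cancel X_def)
  qed
  show ?thesis
  proof (cases "q powi (f - e) = qr r * qr r \<and> q powi (e - f) = qr r * qr r")
    case True
    have "q powi (f - e) * q powi (e - f) = 1"
      using q_0 by (simp add: power_int_add[symmetric])
    then have "q powi eps r * q powi eps r = 1"
      using True by (simp add: powi_eps)
    then have "q powi (eps r + eps r) = 1"
      using q_0 by (simp only: power_int_add[OF disjI1] not_False_eq_True)
    then show ?thesis using q_powi[of "eps r + eps r"] by (simp add: eps_def split: if_splits)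
  next
    case False
    then show ?thesis using *[of f e] *[of e f] by auto
  qed
qed

definition yy :: "nat \<Rightarrow> int \<Rightarrow> nat \<Rightarrow> 'r" where
  "yy r e j = (\<Sum>m\<in>blk r. l e (Suc r) m * li r e m j)"

text \<open>Schur complement formula: the first \<open>r\<close> columns of the left inverse
  identity for block \<open>Suc r\<close> are multiplied from the right by the inverse of block
  \<open>r\<close>.\<close>

lemma li_Suc:
  assumes r: "Suc r \<le> n" and k: "k \<in> blk (Suc r)" and j: "j \<in> blk r"
  shows "li (Suc r) e k j = (if k = Suc r then 0 else li r e k j) - li (Suc r) e k (Suc r) * yy r e j"
proof -
  let ?L = "\<Sum>m\<in>blk r. (\<Sum>i\<in>blk (Suc r). li (Suc r) e k i * l e i m) * li r e m j"
  have "?L = (\<Sum>m\<in>blk r. if m = k then li r e m j else 0)"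
    by (intro sum.cong refl) (use li_l[OF r k] in \<open>auto simp: blk_SucI\<close>)
  also have "\<dots> = (if k = Suc r then 0 else li r e k j)"
    using k by (auto simp: blk_Suc)
  finally have 1: "?L = (if k = Suc r then 0 else li r e k j)" .
  have "?L = (\<Sum>m\<in>blk r. li (Suc r) e k (Suc r) * (l e (Suc r) m * li r e m j))
     + (\<Sum>m\<in>blk r. \<Sum>i\<in>blk r. li (Suc r) e k i * (l e i m * li r e m j))"
    by (simp add: blk_Suc sum_distrib_right algebra_simps sum.distrib)
  also have "(\<Sum>m\<in>blk r. \<Sum>i\<in>blk r. li (Suc r) e k i * (l e i m * li r e m j))
     = (\<Sum>i\<in>blk r. li (Suc r) e k i * (\<Sum>m\<in>blk r. l e i m * li r e m j))"
    by (subst sum.swap) (simp add: sum_distrib_left)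
  also have "\<dots> = (\<Sum>i\<in>blk r. if i = j then li (Suc r) e k i else 0)"
    by (intro sum.cong refl) (use l_li[OF _ _ j] r in \<open>auto simp: mult_if\<close>)
  finally show ?thesis using 1 j by (simp add: yy_def sum_distrib_left algebra_simps)
qed

text \<open>Written as the Schur complement of the preceding block, so that the invertibility of
  \<open>X\<close> is derived in \<open>X_hh\<close> rather than assumed.\<close>

definition hh :: "nat \<Rightarrow> int \<Rightarrow> 'r" where
  "hh r e = l e r r - (\<Sum>j\<in>blk (r - 1). yy (r - 1) e j * l e j r)"

lemma X_hh:
  assumes "r \<in> blk n"
  shows "X r e * hh r e = 1" "hh r e * X r e = 1"
proof -
  from assms obtain k where k: "r = Suc k" by (cases r) (auto simp: in_blk)
  have r: "Suc k \<le> n" using assms k by (simp add: in_blk)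
  have "(\<Sum>j\<in>blk (Suc k). li (Suc k) e (Suc k) j * l e j (Suc k)) = 1"
    using li_l[OF r, of "Suc k" "Suc k"] by simp
  then have *: "X r e * l e r r + (\<Sum>j\<in>blk k. li r e r j * l e j r) = 1"
    by (simp add: blk_Suc X_def k)
  have "li r e r j = - X r e * yy k e j" if "j \<in> blk k" for j
    using li_Suc[OF r _ that, of "Suc k"] by (simp add: k X_def)
  then have "(\<Sum>j\<in>blk k. li r e r j * l e j r) = - X r e * (\<Sum>j\<in>blk k. yy k e j * l e j r)"
    by (simp add: sum_distrib_left mult.assoc)
  with * show 1: "X r e * hh r e = 1" by (simp add: hh_def k algebra_simps)
  have x: "li r e j r = - (\<Sum>m\<in>blk k. li k e j m * l e m r) * X r e" if j: "j \<in> blk k" for j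
  proof -
    have "0 = (\<Sum>m\<in>blk k. li k e j m * (\<Sum>i\<in>blk r. l e m i * li r e i r))"
      using l_li[OF r, of _ "Suc k" e] by (intro sum.neutral[symmetric]) (auto simp: k blk_SucI dest: blk_neq_Suc)
    also have "\<dots> = (\<Sum>m\<in>blk k. li k e j m * l e m r) * X r e
       + (\<Sum>m\<in>blk k. \<Sum>i\<in>blk k. li k e j m * l e m i * li r e i r)"
      by (simp add: k X_def blk_Suc sum_distrib_right sum_distrib_left algebra_simps sum.distrib)
    also have "(\<Sum>m\<in>blk k. \<Sum>i\<in>blk k. li k e j m * l e m i * li r e i r)
       = (\<Sum>i\<in>blk k. (\<Sum>m\<in>blk k. li k e j m * l e m i) * li r e i r)"
      by (subst sum.swap) (simp add: sum_distrib_right)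
    also have "\<dots> = (\<Sum>i\<in>blk k. if i = j then li r e i r else 0)"
      by (intro sum.cong refl) (use li_l[of k] r j in \<open>auto simp: mult_if\<close>)
    finally show ?thesis using j by (simp add: algebra_simps eq_neg_iff_add_eq_0)
  qed
  have "(\<Sum>j\<in>blk (Suc k). l e (Suc k) j * li (Suc k) e j (Suc k)) = 1"
    using l_li[OF r, of "Suc k" "Suc k"] by simp
  then have "l e r r * X r e + (\<Sum>j\<in>blk k. l e r j * li r e j r) = 1"
    by (simp add: blk_Suc X_def k)
  \<comment> \<open>Any left inverse of \<open>X r e\<close> suffices: it has to agree with the
    right inverse \<open>hh r e\<close>.\<close>
  then obtain A where A: "A * X r e = 1"
    by (simp add: x sum_distrib_right[symmetric] sum_negf mult.assoc[symmetric] flip: left_diff_distrib)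
  have "A = A * (X r e * hh r e)" by (simp add: 1)
  also have "\<dots> = hh r e" by (simp add: mult.assoc[symmetric] A)
  finally show "hh r e * X r e = 1" using A by simp
qed

text \<open>At this ratio \<open>aa\<close> vanishes at the corner, which removes the right side of
  \<open>inv_inv_rll\<close> for \<open>a = b = x = Suc r\<close>. The left side is then a two-term
  relation within the last row.\<close>

lemma li_row_X:
  assumes r: "Suc r \<le> n" and j: "j \<in> blk r" and f: "f = e + eps (Suc r)"
  shows "li (Suc r) e (Suc r) j * X (Suc r) f = sc (qr (Suc r)) (X (Suc r) e * li (Suc r) f (Suc r) j)"
proof -
  let ?R = "Suc r" and ?d = "q - inverse q"
  have t: "qr ?R * qr ?R = q powi (f - e)" by (simp add: f powi_eps)
  have "sc (s2 ?R ?R * s2 ?R j * (1 - qr ?R * qr ?R)) (X ?R e * li ?R f ?R j)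
     + sc (s2 ?R j * ?d) (li ?R e ?R j * X ?R f) = 0"
    using inv_inv_rll[OF r, of ?R ?R ?R j "qr ?R * qr ?R" f e] j blk_neq_Suc[OF j] blk_less[OF j] qr_0[of ?R]
    by (simp add: t blk_SucI X_def aa_def cc_def power_int_add mult.assoc)
       (simp add: t[symmetric] mult.assoc)
  then have "sc (s2 ?R j * ?d) (li ?R e ?R j * X ?R f) =
     sc (s2 ?R j * ?d) (sc (qr ?R) (X ?R e * li ?R f ?R j))"
    by (simp add: one_minus_sq add_eq_0_iff mult_ac)
  then show ?thesis using q_inv by (subst (asm) sc_cancel) (auto simp: s2_def)
qed

text \<open>The counterpart for the last column: with \<open>b = x = y = Suc r\<close> it is the
  left side of \<open>inv_inv_rll\<close> that vanishes.\<close>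

lemma li_col_X:
  assumes r: "Suc r \<le> n" and k: "k \<in> blk (Suc r)" and f: "f = e + eps (Suc r)" and "k \<noteq> Suc r"
  shows "li (Suc r) f k (Suc r) * X (Suc r) e = sc (qr (Suc r)) (X (Suc r) f * li (Suc r) e k (Suc r))"
proof -
  let ?R = "Suc r" and ?d = "q - inverse q"
  have t: "qr ?R * qr ?R = q powi (f - e)" by (simp add: f powi_eps)
  have kr: "k < ?R" using k assms(4) by (simp add: in_blk)
  have "sc (1 - qr ?R * qr ?R) (X ?R f * li ?R e k ?R)
     + sc (s2 ?R ?R * ?d) (li ?R f k ?R * X ?R e) = 0"
    using inv_inv_rll[OF r, of k ?R ?R ?R "qr ?R * qr ?R" f e] k kr qr_0[of ?R]
    by (simp add: t X_def aa_def cc_def power_int_add mult.assoc)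
       (simp add: t[symmetric] mult.assoc)
  then have "sc (s2 ?R ?R * ?d) (li ?R f k ?R * X ?R e) =
     sc (s2 ?R ?R * ?d) (sc (qr ?R) (X ?R f * li ?R e k ?R))"
    by (simp add: one_minus_sq add_eq_0_iff mult_ac)
  then show ?thesis using q_inv by (subst (asm) sc_cancel) (auto simp: s2_def)
qed

text \<open>The right side is a quantum 2 x 2 minor of the larger inverse. \<open>li_Suc\<close> and
  \<open>li_row_X\<close> produce a minor with the arguments in the order \<open>e\<close>,
  \<open>f\<close>, and \<open>inv_inv_rll\<close> at the degenerate ratio reverses them. With
  \<open>f\<close> in front, \<open>zsys_step\<close> can apply the relation of the larger
  block.\<close>

lemma li_X_minor:
  assumes r: "Suc r \<le> n" and kj: "k \<in> blk r" "j \<in> blk r" and f: "f = e + eps (Suc r)"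
  shows "li r e k j * X (Suc r) f = li (Suc r) f k j * X (Suc r) e
    - sc (s2 (Suc r) j * s2 k (Suc r) * s2 k j * s2 (Suc r) (Suc r) * qr (Suc r))
        (li (Suc r) f (Suc r) j * li (Suc r) e k (Suc r))"
proof -
  let ?R = "Suc r" and ?d = "q - inverse q"
  have t: "qr ?R * qr ?R = q powi (f - e)" by (simp add: f powi_eps)
  have R: "?R \<in> blk n" using r by (simp add: in_blk)
  have "X ?R e * (yy r e j * X ?R f) = X ?R e * (- sc (qr ?R) (li ?R f ?R j))"
    using li_row_X[OF r kj(2) f] li_Suc[OF r _ kj(2), of ?R e]
    by (simp add: X_def mult.assoc eq_neg_iff_add_eq_0 neg_eq_iff_add_eq_0)
  then have "hh ?R e * (X ?R e * (yy r e j * X ?R f)) = hh ?R e * (X ?R e * (- sc (qr ?R) (li ?R f ?R j)))"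
    by simp
  then have y: "yy r e j * X ?R f = - sc (qr ?R) (li ?R f ?R j)"
    by (simp add: mult.assoc[symmetric] X_hh[OF R])
  have "li r e k j = li ?R e k j + li ?R e k ?R * yy r e j"
    using li_Suc[OF r _ kj(2), of k e] kj(1) blk_neq_Suc[OF kj(1)] by (simp add: blk_SucI)
  then have 1: "li r e k j * X ?R f = li ?R e k j * X ?R f - sc (qr ?R) (li ?R e k ?R * li ?R f ?R j)"
    by (simp add: distrib_right mult.assoc y)
  have "sc (s2 ?R ?R * s2 ?R j * (1 - qr ?R * qr ?R)) (li ?R e k ?R * li ?R f ?R j)
      + sc (s2 ?R j * ?d) (li ?R e k j * X ?R f)
    = sc (s2 k ?R * s2 k j * (1 - qr ?R * qr ?R)) (li ?R f ?R j * li ?R e k ?R)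
      + sc (s2 ?R j * ?d) (li ?R f k j * X ?R e)"
    using inv_inv_rll[OF r, of k ?R ?R j "qr ?R * qr ?R" f e] kj blk_neq_Suc[OF kj(1)] blk_neq_Suc[OF kj(2)]
       blk_less[OF kj(1)] blk_less[OF kj(2)]
    by (simp add: t[symmetric] blk_SucI X_def aa_def cc_def)
  then have "sc (s2 ?R j * ?d) (li ?R e k j * X ?R f - sc (qr ?R) (li ?R e k ?R * li ?R f ?R j))
    = sc (s2 ?R j * ?d) (li ?R f k j * X ?R e
     - sc (s2 ?R j * s2 k ?R * s2 k j * s2 ?R ?R * qr ?R) (li ?R f ?R j * li ?R e k ?R))"
    by (simp add: one_minus_sq sc_diff_right mult_ac)
  then show ?thesis unfolding 1 using q_inv by (subst (asm) sc_cancel) (auto simp: s2_def)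
qed

section \<open>The central series\<close>

text \<open>Twice the superdimension of the top-left block, which is 2M - 2N for the whole
  matrix.\<close>

definition kap :: "nat \<Rightarrow> int" where
  "kap r = (if r \<le> M then 2 * int r else 4 * int M - 2 * int r)"

definition E :: "nat \<Rightarrow> 'k" where
  "E i = s2 i i * q powi (- (if i \<le> M then 2 * int i else 4 * int M - 2 * int i + 2))"

lemma E_0: "E i \<noteq> 0"
  using q_0 by (simp add: E_def s2_def)

lemma kap_Suc: "kap (Suc r) = kap r + eps (Suc r)"
  by (auto simp: kap_def eps_def)

text \<open>\<open>zsys r \<zeta>\<close> is the relation \<open>L(z q\<^sup>-\<^sup>\<kappa>)\<^sup>t D\<^sup>-\<^sup>1 (L(z)\<^sup>-\<^sup>1)\<^sup>t = \<zeta>(z) D\<^sup>-\<^sup>1\<close> for the top-left \<open>r \<times> r\<close> block, written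
  out in the entries; \<open>E\<close> is the diagonal of \<open>D\<^sup>-\<^sup>1\<close> with the signs of the supertransposes.\<close>

definition zsys :: "nat \<Rightarrow> (int \<Rightarrow> 'r) \<Rightarrow> bool" where
  "zsys r \<zeta> \<longleftrightarrow> (r = 0 \<longrightarrow> \<zeta> = (\<lambda>_. 1)) \<and>
     (\<forall>e. \<forall>i\<in>blk r. \<forall>k\<in>blk r.
       (\<Sum>j\<in>blk r. sc (s2 i j * s2 k j * E j) (l (e - kap r) j i * li r e k j)) =
       (if i = k then sc (E i) (\<zeta> e) else 0))"

text \<open>After right multiplication by \<open>X (Suc r) (e + eps (Suc r))\<close>,
  \<open>li_X_minor\<close> rewrites the sum through the larger inverse. Since \<open>kap\<close>
  grows by \<open>eps (Suc r)\<close>, the argument \<open>e - kap r\<close> of L is exactly the one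
  that \<open>zsys (Suc r)\<close> pairs with \<open>e + eps (Suc r)\<close>.\<close>

lemma zsys_step:
  assumes r: "Suc r \<le> n" and z: "zsys (Suc r) \<zeta>"
  obtains \<zeta>' where "zsys r \<zeta>'"
    "\<And>e. \<zeta>' e * X (Suc r) (e + eps (Suc r)) = \<zeta> (e + eps (Suc r)) * X (Suc r) e"
proof
  let ?R = "Suc r" and ?c = "eps (Suc r)"
  define \<zeta>' where "\<zeta>' e = \<zeta> (e + ?c) * X ?R e * hh ?R (e + ?c)" for e
  have R: "?R \<in> blk n" using r by (simp add: in_blk)
  show zX: "\<zeta>' e * X ?R (e + ?c) = \<zeta> (e + ?c) * X ?R e" for e
    by (simp add: \<zeta>'_def mult.assoc X_hh[OF R])
  have zs: "(\<Sum>j\<in>blk ?R. sc (s2 i j * s2 k j * E j) (l (f - kap ?R) j i * li ?R f k j)) =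
       (if i = k then sc (E i) (\<zeta> f) else 0)" if "i \<in> blk ?R" "k \<in> blk ?R" for i k f
    using z that by (simp add: zsys_def)
  \<comment> \<open>For \<open>r = 0\<close> there are no entries to determine the series, so
    \<open>zsys\<close> prescribes the value 1. It has to come out of the 1 x 1 block.\<close>
  have base: "\<zeta>' e = 1" if "r = 0" for e
  proof -
    have R1: "blk (Suc 0) = {Suc 0}" by (auto simp: blk_def)
    have "sc (E 1) (l (e + ?c - kap ?R) 1 1 * li ?R (e + ?c) 1 1) = sc (E 1) (\<zeta> (e + ?c))"
      using zs[of 1 1 "e + ?c"] that by (simp add: R1)
    moreover have "kap ?R = ?c" using kap_Suc[of r] that by (simp add: kap_def)
    ultimately have "\<zeta> (e + ?c) = l e 1 1 * X ?R (e + ?c)"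
      using that by (simp add: sc_cancel[OF E_0] X_def)
    then have "\<zeta> (e + ?c) * X ?R e = l e 1 1 * X ?R e * X ?R (e + ?c)"
      by (simp add: mult.assoc X_X[OF R])
    also have "l e 1 1 * X ?R e = 1"
      using l_li[OF r, of 1 1 e] that by (simp add: R1 X_def)
    finally show ?thesis by (simp add: \<zeta>'_def X_hh[OF R])
  qed
  show "zsys r \<zeta>'"
    unfolding zsys_def
  proof (intro conjI impI ext allI ballI)
    fix e i k assume ik: "i \<in> blk r" "k \<in> blk r"
    let ?f = "e + ?c"
    let ?s = "\<lambda>j. s2 i j * s2 k j * E j"
    let ?g = "\<lambda>j. s2 ?R j * s2 k ?R * s2 k j * s2 ?R ?R * qr ?R"
    let ?T = "\<lambda>j. sc (?s j) (l (e - kap r) j i * (li ?R ?f k j * X ?R e - sc (?g j) (li ?R ?f ?R j * li ?R e k ?R)))"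
    let ?L = "\<Sum>j\<in>blk r. sc (?s j) (l (e - kap r) j i * li r e k j)"
    have a: "?f - kap ?R = e - kap r" by (simp add: kap_Suc)
    have "?L * X ?R ?f = (\<Sum>j\<in>blk r. sc (?s j) (l (e - kap r) j i * (li r e k j * X ?R ?f)))"
      by (simp add: sum_distrib_right mult.assoc[where 'a='r])
    also have "\<dots> = (\<Sum>j\<in>blk r. ?T j)"
      using li_X_minor[OF r ik(2) _ refl, of _ e] by (intro sum.cong refl) simp
    \<comment> \<open>The minor vanishes at \<open>j = Suc r\<close> by \<open>li_col_X\<close>, so
      the sum may be extended to the larger block.\<close>
    also have "\<dots> = (\<Sum>j\<in>blk ?R. ?T j)"
    proof -
      have "li ?R ?f k ?R * X ?R e - sc (?g ?R) (li ?R ?f ?R ?R * li ?R e k ?R) = 0"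
        using li_col_X[OF r _ refl, of k e] ik(2) blk_neq_Suc[OF ik(2)]
        by (simp add: blk_SucI X_def mult_ac)
      then have "?T ?R = 0" by (simp only: mult_zero_right sc_0_right)
      then show ?thesis by (simp only: blk_Suc sum.insert[OF finite_blk Suc_notin_blk] add_0)
    qed
    also have "\<dots> = (\<Sum>j\<in>blk ?R. sc (?s j) (l (e - kap r) j i * li ?R ?f k j)) * X ?R e
       - sc (s2 k ?R * s2 ?R ?R * qr ?R)
          ((\<Sum>j\<in>blk ?R. sc (s2 i j * s2 ?R j * E j) (l (e - kap r) j i * li ?R ?f ?R j)) * li ?R e k ?R)"
    proof -
      have s: "?s j * ?g j = (s2 k ?R * s2 ?R ?R * qr ?R) * (s2 i j * s2 ?R j * E j)" for j
        by (auto simp: s2_def)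
      show ?thesis
        by (simp add: right_diff_distrib sc_diff_right sum_subtractf sum_distrib_right sc_sum_right s
            mult.assoc[where 'a='r])
    qed
    \<comment> \<open>Both sums are instances of \<open>zsys (Suc r)\<close>. The second has the
      distinct indices \<open>i\<close> and \<open>Suc r\<close> and is zero.\<close>
    also have "\<dots> = (if i = k then sc (E i) (\<zeta> ?f * X ?R e) else 0)"
      using zs[of i k ?f, unfolded a] zs[of i ?R ?f, unfolded a] ik blk_neq_Suc[OF ik(1)]
      by (simp add: blk_SucI)
    also have "\<dots> = (if i = k then sc (E i) (\<zeta>' e) else 0) * X ?R ?f"
      using zX[of e] by simp
    finally have "?L * X ?R ?f * hh ?R ?f = (if i = k then sc (E i) (\<zeta>' e) else 0) * X ?R ?f * hh ?R ?f"
      by simp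
    then show "?L = (if i = k then sc (E i) (\<zeta>' e) else 0)"
      by (simp only: mult.assoc X_hh[OF R] mult_1_right)
  qed (rule base)
qed

text \<open>For \<open>r > 0\<close> the series is, up to a scalar, a sum of products of entries of
  block \<open>r\<close> and of its inverse, and these commute with the next corner entry.\<close>

lemma X_zeta:
  assumes r: "Suc r \<le> n" and z: "zsys r \<zeta>"
  shows "X (Suc r) f * \<zeta> e = \<zeta> e * X (Suc r) f"
proof (cases "r = 0")
  case True
  then show ?thesis using z by (simp add: zsys_def)
next
  case False
  then have "Suc 0 \<in> blk r" by (simp add: in_blk)
  then obtain i where i: "i \<in> blk r" ..
  let ?S = "\<Sum>j\<in>blk r. sc (s2 i j * s2 i j * E j) (l (e - kap r) j i * li r e i j)"
  have S: "?S = sc (E i) (\<zeta> e)" using z[unfolded zsys_def, THEN conjunct2, rule_format, OF i i, of e] by simp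
  have "X (Suc r) f * (l (e - kap r) j i * li r e i j) = (l (e - kap r) j i * li r e i j) * X (Suc r) f"
    if j: "j \<in> blk r" for j
  proof -
    have li: "X (Suc r) f * li r e i j = li r e i j * X (Suc r) f"
      using r by (intro commute_li X_l i j) auto
    have "X (Suc r) f * (l (e - kap r) j i * li r e i j) = l (e - kap r) j i * (X (Suc r) f * li r e i j)"
      by (simp only: mult.assoc[symmetric] X_l[OF r j i])
    then show ?thesis by (simp add: li mult.assoc)
  qed
  then have "X (Suc r) f * ?S = ?S * X (Suc r) f"
    by (simp add: sum_distrib_left sum_distrib_right)
  then show ?thesis unfolding S by (simp add: sc_cancel[OF E_0])
qed

section \<open>The Berezinian as a product\<close>

text \<open>The arguments are those of the Berezinian: column \<open>j = Suc r\<close> has the shift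
  2j - 2 = 2r, and \<open>kap (M + k)\<close> is 2M - 2k.\<close>

fun Bt :: "nat \<Rightarrow> int \<Rightarrow> 'r" where
  "Bt 0 e = 1"
| "Bt (Suc r) e = Bt r e * (if Suc r \<le> M then hh (Suc r) (e + 2 * int r)
     else X (Suc r) (e + kap (Suc r)))"

lemma hh_commute:
  assumes "r \<in> blk n" "X r e * x = x * X r e"
  shows "hh r e * x = x * hh r e"
proof -
  have "hh r e * (X r e * x) * hh r e = hh r e * (x * X r e) * hh r e" by (simp add: assms(2))
  then have "(hh r e * X r e) * x * hh r e = hh r e * x * (X r e * hh r e)" by (simp only: mult.assoc)
  then show ?thesis by (simp add: X_hh[OF assms(1)])
qed

lemma X_X_less:
  assumes "Suc r \<le> n" "a \<in> blk r"
  shows "X (Suc r) f * X a e = X a e * X (Suc r) f"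
proof -
  have "X (Suc r) f * li a e a a = li a e a a * X (Suc r) f"
  proof (rule commute_li)
    fix i j assume "i \<in> blk a" "j \<in> blk a"
    then show "X (Suc r) f * l e i j = l e i j * X (Suc r) f"
      using assms by (intro X_l) (auto simp: in_blk)
  qed (use assms in \<open>auto simp: in_blk\<close>)
  then show ?thesis by (simp add: X_def)
qed

lemma X_Bt:
  assumes "Suc r \<le> n" "a \<le> r"
  shows "X (Suc r) f * Bt a e = Bt a e * X (Suc r) f"
  using assms(2)
proof (induction a)
  case (Suc a)
  then have a: "Suc a \<in> blk r" "Suc a \<in> blk n" using assms by (auto simp: in_blk)
  let ?x = "if Suc a \<le> M then hh (Suc a) (e + 2 * int a) else X (Suc a) (e + kap (Suc a))"
  have "X (Suc r) f * ?x = ?x * X (Suc r) f"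
    using X_X_less[OF assms(1) a(1)] hh_commute[OF a(2), of _ "X (Suc r) f"] by simp
  moreover have "X (Suc r) f * Bt a e = Bt a e * X (Suc r) f" using Suc by simp
  ultimately show ?case by (simp only: Bt.simps) (metis mult.assoc)
qed simp

text \<open>Passing from one central series to its predecessor exchanges one factor at
  \<open>e\<close> for the same factor at \<open>e - 2\<close>. In an even row the factor is the
  inverse of \<open>X\<close> and \<open>eps\<close> is 2, in an odd row it is \<open>X\<close>
  itself and \<open>eps\<close> is -2. The two reversals compensate, so \<open>zX\<close> serves
  both cases.\<close>

theorem Bt_shift:
  assumes "r \<le> n" "zsys r \<zeta>"
  shows "Bt r (e - 2) = \<zeta> (e + kap r - 2) * Bt r e"
  using assms
proof (induction r arbitrary: \<zeta>)
  case 0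
  then show ?case by (simp add: zsys_def)
next
  case (Suc r)
  let ?R = "Suc r"
  have R: "?R \<in> blk n" using Suc.prems by (simp add: in_blk)
  obtain \<zeta>' where z': "zsys r \<zeta>'"
    and zX: "\<And>e. \<zeta>' e * X ?R (e + eps ?R) = \<zeta> (e + eps ?R) * X ?R e"
    using zsys_step[OF Suc.prems] by blast
  have IH: "Bt r (e - 2) = \<zeta>' (e + kap r - 2) * Bt r e"
    using Suc.IH[OF _ z'] Suc.prems by simp
  note XB = X_Bt[OF Suc.prems(1) order.refl] and Xz = X_zeta[OF Suc.prems(1) z']
  show ?case
  proof (cases "?R \<le> M")
    case True
    let ?u = "e + kap r - 2" and ?w = "e + 2 * int r"
    have k: "?u + 2 = ?w" "e + kap ?R - 2 = ?w" "e - 2 + 2 * int r = ?u" and c: "eps ?R = 2"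
      using True by (simp_all add: kap_def eps_def)
    have hB: "hh ?R f * Bt r e' = Bt r e' * hh ?R f" for f e'
      by (rule hh_commute[OF R XB])
    have "\<zeta> ?w = \<zeta> ?w * (X ?R ?u * hh ?R ?u)" by (simp add: X_hh[OF R])
    also have "\<dots> = \<zeta>' ?u * X ?R ?w * hh ?R ?u"
      using zX[of ?u, unfolded c k(1)] by (simp only: mult.assoc[symmetric])
    finally have "\<zeta> ?w * hh ?R ?w = \<zeta>' ?u * (X ?R ?w * hh ?R ?u) * hh ?R ?w"
      by (simp add: mult.assoc)
    also have "\<dots> = \<zeta>' ?u * hh ?R ?u * (X ?R ?w * hh ?R ?w)"
      unfolding hh_commute[OF R X_X[OF R], of ?u ?w, symmetric] by (simp only: mult.assoc)
    also have "\<dots> = hh ?R ?u * \<zeta>' ?u"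
      using hh_commute[OF R Xz, of ?u ?u] by (simp add: X_hh[OF R])
    finally have 1: "\<zeta> ?w * hh ?R ?w = hh ?R ?u * \<zeta>' ?u" .
    have "\<zeta> (e + kap ?R - 2) * Bt ?R e = \<zeta> ?w * hh ?R ?w * Bt r e"
      unfolding k using True by (simp add: mult.assoc hB)
    also have "\<dots> = hh ?R ?u * Bt r (e - 2)" by (simp add: 1 IH mult.assoc)
    also have "\<dots> = Bt ?R (e - 2)" using True by (simp add: hB k)
    finally show ?thesis by simp
  next
    case False
    let ?u = "e + kap ?R" and ?w = "e + kap ?R - 2"
    have k: "?u + (- 2) = ?w" "e + kap r - 2 = ?u" "e - 2 + kap ?R = ?w" and c: "eps ?R = - 2"
      using False by (simp_all add: kap_Suc eps_def)
    have "\<zeta> (e + kap ?R - 2) * Bt ?R e = \<zeta> ?w * X ?R ?u * Bt r e"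
      using False by (simp add: mult.assoc XB)
    also have "\<dots> = \<zeta>' ?u * X ?R ?w * Bt r e"
      using zX[of ?u] by (simp only: c k)
    also have "\<dots> = X ?R ?w * Bt r (e - 2)"
      using IH by (simp only: k Xz[symmetric] mult.assoc)
    also have "\<dots> = Bt ?R (e - 2)" using False by (simp add: XB k)
    finally show ?thesis by simp
  qed
qed

section \<open>Existence of the central series\<close>

text \<open>The coefficients on the left side of \<open>inv_rll\<close> for \<open>i = y\<close>,
  the case in which both of its terms are present.\<close>

definition ct :: "nat \<Rightarrow> nat \<Rightarrow> 'k \<Rightarrow> 'k" where
  "ct j p t = (if j = p then s2 j j * aa j j t else cc j p t)"

text \<open>At \<open>t = q powi kap n\<close> the sum over all \<open>n\<close> rows vanishes. This is what singles out the shift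
  \<open>kap n\<close> and the matrix \<open>E\<close> in the definition of \<open>zsys\<close>.\<close>

lemma E_telescope:
  "(\<Sum>j\<in>blk m. E j * ct j p t) =
     inverse q - (if p \<in> blk m then t else 1) * q powi (- kap m - 1)"
  if "1 \<le> p"
proof (induction m)
  case 0
  then show ?case by (simp add: blk_def kap_def power_int_minus)
next
  case (Suc m)
  let ?P = "q powi (- kap (Suc m))"
  have e: "E (Suc m) = (if Suc m \<le> M then ?P else - (?P * (inverse q * inverse q)))"
  proof (cases "Suc m \<le> M")
    case False
    have "- (4 * int M - 2 * int (Suc m) + 2) = - kap (Suc m) + (- 2)" using False by (simp add: kap_def)
    then have "q powi - (4 * int M - 2 * int (Suc m) + 2) = ?P * q powi (- 2)"
      using q_0 by (simp only: power_int_add simp_thms)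
    then show ?thesis using False by (simp add: E_def s2_def power_int_minus power2_eq_square)
  qed (simp add: E_def kap_def s2_def)
  have k: "q powi (- kap m - 1) = ?P * (if Suc m \<le> M then q else inverse q * inverse q * inverse q)"
  proof -
    have "- kap m - 1 = - kap (Suc m) + (eps (Suc m) - 1)" by (simp add: kap_Suc)
    then have "q powi (- kap m - 1) = ?P * q powi (eps (Suc m) - 1)"
      using q_0 by (simp only: power_int_add simp_thms)
    also have "q powi (eps (Suc m) - 1) = (if Suc m \<le> M then q else inverse q * inverse q * inverse q)"
      by (auto simp: eps_def power_int_def power3_eq_cube)
    finally show ?thesis .
  qed
  have k1: "q powi (- kap (Suc m) - 1) = ?P * inverse q"
    using q_0 by (simp add: power_int_diff divide_inverse)
  have s: "(\<Sum>j\<in>blk (Suc m). E j * ct j p t) = E (Suc m) * ct (Suc m) p t + (\<Sum>j\<in>blk m. E j * ct j p t)"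
    by (simp add: blk_Suc)
  consider "p \<in> blk m" | "p = Suc m" | "p > Suc m" using \<open>1 \<le> p\<close> unfolding in_blk by linarith
  then show ?case
  proof cases
    case 1
    then have "p \<in> blk (Suc m)" "Suc m \<noteq> p" "\<not> Suc m < p" by (auto simp: in_blk)
    then show ?thesis unfolding s Suc.IH e k k1 using 1 q_0
      by (simp add: ct_def cc_def field_simps)
  next
    case 2
    then show ?thesis unfolding s Suc.IH e k k1 using q_0
      by (simp add: ct_def aa_def s2_def qr_def field_simps)
  next
    case 3
    then have "p \<notin> blk (Suc m)" "p \<notin> blk m" "Suc m \<noteq> p" by (auto simp: in_blk)
    then show ?thesis unfolding s Suc.IH e k k1 using 3 q_0
      by (simp add: ct_def cc_def field_simps)
  qed
qed

text \<open>This ratio of neighbouring entries of \<open>E\<close> is the one that two neighbouring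
  diagonal equations produce in \<open>zsys_exists\<close>.\<close>

lemma E_Suc: "E (Suc p) * (s2 (Suc p) (Suc p) * qr (Suc p)) = E p * (s2 p p * inverse (qr p))"
proof -
  consider "Suc p \<le> M" | "p = M" | "p > M" by linarith
  then show ?thesis
  proof cases
    case 1
    have "- (2 * int (Suc p)) = - (2 * int p) + (- 2)" by simp
    then have "q powi - (2 * int (Suc p)) = q powi - (2 * int p) * q powi (- 2)"
      using q_0 by (simp only: power_int_add simp_thms)
    then show ?thesis using 1 q_0
      by (simp add: E_def s2_def qr_def power_int_minus power2_eq_square field_simps del: of_nat_Suc)
  next
    case 2
    then show ?thesis by (simp add: E_def s2_def qr_def)
  next
    case 3
    have "- (4 * int M - 2 * int (Suc p) + 2) = - (4 * int M - 2 * int p + 2) + 2" by simp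
    then have "q powi - (4 * int M - 2 * int (Suc p) + 2) = q powi - (4 * int M - 2 * int p + 2) * q powi 2"
      using q_0 by (simp only: power_int_add simp_thms)
    then show ?thesis using 3 q_0
      by (simp add: E_def s2_def qr_def power2_eq_square field_simps del: of_nat_Suc)
  qed
qed

text \<open>\<open>inv_rll\<close> with \<open>i = y = j\<close>, weighted by \<open>E j\<close> and
  summed over \<open>j\<close>, has a vanishing left side by \<open>E_telescope\<close>. The right
  side gives linear equations for the entries \<open>Y\<close> of the relation: off the diagonal
  they force zero, on the diagonal proportionality to \<open>E\<close>. Solving them divides by
  \<open>1 - t\<close>, whence the condition on \<open>kap n\<close>.\<close>

lemma zsys_exists:
  assumes "kap n \<noteq> 0"
  obtains \<zeta> where "zsys n \<zeta>"
proof -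
  define t where "t = q powi kap n"
  have t1: "1 - t \<noteq> 0" using q_powi[OF assms] by (simp add: t_def)
  have n0: "n \<noteq> 0"
  proof
    assume "n = 0"
    then have "kap n = 0" by (simp add: kap_def)
    with assms show False by simp
  qed
  define Y where "Y e i k = (\<Sum>j\<in>blk n. sc (s2 i j * s2 k j * E j) (l (e - kap n) j i * li n e k j))" for e i k
  have vanish: "(\<Sum>j\<in>blk n. E j * ct j p t) = 0" if p: "p \<in> blk n" for p
  proof -
    have "1 \<le> p" using p by (simp add: in_blk)
    have "t * q powi (- kap n - 1) = inverse q"
      using q_0 by (simp add: t_def power_int_diff power_int_minus divide_inverse)
    with E_telescope[OF \<open>1 \<le> p\<close>, where m = n and t = t] p show ?thesis by simp
  qed
  have main: "sc (s2 i k * aa i k t) (Y e i k)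
      + (if k = i then \<Sum>p\<in>blk n. sc (cc p i t) (Y e p p) else 0) = 0"
    if ik: "i \<in> blk n" "k \<in> blk n" for e i k
  proof -
    let ?z = "e - kap n"
    have "(\<Sum>j\<in>blk n. sc (E j) (sc (s2 i k * s2 j k * s2 j i * aa i k t) (l ?z j i * li n e k j)
      + (if k = i then \<Sum>p\<in>blk n. sc (cc p i t) (l ?z j p * li n e p j) else 0)))
      = (\<Sum>j\<in>blk n. sc (E j) (\<Sum>p\<in>blk n. sc (ct j p t) (li n e k p * l ?z p i)))"
    proof (intro sum.cong refl arg_cong2[of _ _ _ _ sc])
      fix j assume j: "j \<in> blk n"
      have t: "t = q powi (e - ?z)" by (simp add: t_def)
      have "sc (s2 j j * aa j j t) (li n e k j * l ?z j i)
        + (\<Sum>p\<in>blk n. sc (cc j p t) (li n e k p * l ?z p i))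
        = sc (s2 i k * s2 j k * s2 j i * aa i k t) (l ?z j i * li n e k j)
        + (if k = i then \<Sum>p\<in>blk n. sc (cc p i t) (l ?z j p * li n e p j) else 0)"
        using inv_rll[OF order.refl j ik(1) ik(2) j t]
        by (simp add: s2_sym[of i j] mult.assoc)
      moreover have "(\<Sum>p\<in>blk n. sc (ct j p t) (li n e k p * l ?z p i))
        = sc (s2 j j * aa j j t) (li n e k j * l ?z j i)
        + (\<Sum>p\<in>blk n. sc (cc j p t) (li n e k p * l ?z p i))"
        using j by (simp add: sum.remove[of "blk n" j] ct_def cc_def)
      ultimately show "sc (s2 i k * s2 j k * s2 j i * aa i k t) (l ?z j i * li n e k j)
        + (if k = i then \<Sum>p\<in>blk n. sc (cc p i t) (l ?z j p * li n e p j) else 0)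
        = (\<Sum>p\<in>blk n. sc (ct j p t) (li n e k p * l ?z p i))" by simp
    qed
    also have "\<dots> = (\<Sum>p\<in>blk n. sc (\<Sum>j\<in>blk n. E j * ct j p t) (li n e k p * l ?z p i))"
      by (simp add: sc_sum_right sc_sum_left) (rule sum.swap)
    also have "\<dots> = 0" by (intro sum.neutral ballI) (simp add: vanish)
    finally have *: "(\<Sum>j\<in>blk n. sc (E j) (sc (s2 i k * s2 j k * s2 j i * aa i k t) (l ?z j i * li n e k j)
      + (if k = i then \<Sum>p\<in>blk n. sc (cc p i t) (l ?z j p * li n e p j) else 0))) = 0" .
    have "(\<Sum>j\<in>blk n. sc (E j) (sc (s2 i k * s2 j k * s2 j i * aa i k t) (l ?z j i * li n e k j)))
      = sc (s2 i k * aa i k t) (Y e i k)"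
    proof -
      have s: "E j * (s2 i k * s2 j k * s2 j i * aa i k t) = s2 i k * aa i k t * (s2 i j * s2 k j * E j)" for j
        by (auto simp: s2_def)
      show ?thesis by (simp add: Y_def sc_sum_right s)
    qed
    moreover have "(\<Sum>j\<in>blk n. sc (E j) (\<Sum>p\<in>blk n. sc (cc p i t) (l ?z j p * li n e p j)))
      = (\<Sum>p\<in>blk n. sc (cc p i t) (Y e p p))"
      by (simp add: Y_def sc_sum_right mult.commute[of "E _"]) (rule sum.swap)
    ultimately show ?thesis using * by (auto simp: sc_add_right sum.distrib)
  qed
  have off: "Y e i k = 0" if "i \<in> blk n" "k \<in> blk n" "i \<noteq> k" for e i k
    using main[OF that(1,2), of e] that(3) t1 sc_eq_0[of "s2 i k * (1 - t)"]
    by (auto simp: aa_def s2_def split: if_splits)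
  have diag: "(\<Sum>p\<in>blk n. sc (ct p i t) (Y e p p)) = 0" if i: "i \<in> blk n" for e i
    using main[OF i i, of e] i by (simp add: sum.remove[of "blk n" i] ct_def cc_def)
  have step: "sc (inverse (E (Suc a))) (Y e (Suc a) (Suc a)) = sc (inverse (E a)) (Y e a a)"
    if a: "a \<in> blk n" "Suc a \<in> blk n" for e a
  proof -
    let ?Y = "\<lambda>p. Y e p p" and ?d = "q - inverse q"
    let ?f = "\<lambda>p. sc (ct p (Suc a) t - ct p a t) (?Y p)"
    have "0 = (\<Sum>p\<in>blk n. ?f p)"
      using diag[OF a(1), of e] diag[OF a(2), of e] by (simp add: sc_diff_left sum_subtractf)
    \<comment> \<open>Any other \<open>p\<close> lies on the same side of \<open>a\<close> and of
      \<open>Suc a\<close>, so its two coefficients cancel.\<close>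
    also have "\<dots> = (\<Sum>p\<in>{a, Suc a}. ?f p)"
      using a by (intro sum.mono_neutral_right) (auto simp: ct_def cc_def)
    also have "\<dots> = ?f a + ?f (Suc a)" by simp
    also have "ct a (Suc a) t - ct a a t = - ((1 - t) * (s2 a a * inverse (qr a)))"
      using q_0 by (simp add: ct_def cc_def aa_def s2_def qr_def field_simps)
    also have "ct (Suc a) (Suc a) t - ct (Suc a) a t = (1 - t) * (s2 (Suc a) (Suc a) * qr (Suc a))"
      using q_0 by (simp add: ct_def cc_def aa_def s2_def qr_def field_simps)
    finally have "sc (1 - t) (sc (s2 (Suc a) (Suc a) * qr (Suc a)) (?Y (Suc a)))
      = sc (1 - t) (sc (s2 a a * inverse (qr a)) (?Y a))"
      by (simp add: eq_neg_iff_add_eq_0 neg_eq_iff_add_eq_0 add_eq_0_iff)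
    then have "sc (s2 (Suc a) (Suc a) * qr (Suc a)) (?Y (Suc a)) = sc (s2 a a * inverse (qr a)) (?Y a)"
      by (simp only: sc_cancel[OF t1])
    then have "sc (inverse (E (Suc a) * (s2 (Suc a) (Suc a) * qr (Suc a)))) (sc (s2 (Suc a) (Suc a) * qr (Suc a)) (?Y (Suc a)))
      = sc (inverse (E a * (s2 a a * inverse (qr a)))) (sc (s2 a a * inverse (qr a)) (?Y a))"
      by (simp only: E_Suc)
    moreover have "s2 a a * inverse (qr a) \<noteq> 0" "s2 (Suc a) (Suc a) * qr (Suc a) \<noteq> 0"
      using qr_0 by (simp_all add: s2_def)
    ultimately show ?thesis by (simp add: field_simps)
  qed
  have const: "sc (inverse (E i)) (Y e i i) = sc (inverse (E 1)) (Y e 1 1)" if "i \<in> blk n" for e i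
    using that
  proof (induction i)
    case (Suc i)
    show ?case
    proof (cases "i = 0")
      case False
      then have "i \<in> blk n" using Suc.prems by (simp add: in_blk)
      then show ?thesis using Suc.IH step[OF _ Suc.prems] by simp
    qed simp
  qed (simp add: in_blk)
  show thesis
  proof (rule that[of "\<lambda>e. sc (inverse (E 1)) (Y e 1 1)"], unfold zsys_def, intro conjI impI allI ballI)
    fix e i k assume ik: "i \<in> blk n" "k \<in> blk n"
    show "(\<Sum>j\<in>blk n. sc (s2 i j * s2 k j * E j) (l (e - kap n) j i * li n e k j)) =
       (if i = k then sc (E i) (sc (inverse (E 1)) (Y e 1 1)) else 0)"
      unfolding Y_def[symmetric] const[OF ik(1), symmetric]
      using off[OF ik] E_0[of i] by (cases "i = k") simp_all
  qed (use n0 in simp)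
qed

section \<open>Laplace expansion\<close>

definition v :: 'k where
  "v = - inverse q"

lemma q_cancel [simp]: "q * (inverse q * x) = x" "inverse q * (q * x) = x"
    "q * inverse q = 1" "inverse q * q = 1"
  using q_0 by (simp_all flip: mult.assoc)

text \<open>RLL at the ratio q^2. The family is transposed: \<open>\<rho>\<close> is a column of L,
  \<open>c\<close> and \<open>d\<close> are rows. For \<open>d < c\<close> the left side of RLL is a
  multiple of the minor in these rows, and the right side shows its dependence on the
  columns.\<close>

lemma pair_l:
  assumes "M \<le> n" "\<rho> \<in> blk M" "\<rho>' \<in> blk M" "c \<in> blk M" "d \<in> blk M" "lt False c d"
  shows "sc (- q * (q - inverse q)) (pair False v (\<lambda>e \<rho> c. l e c \<rho>) e \<rho> \<rho>' c d)
    = sc (aa \<rho>' \<rho> (q * q)) (l (e + 2) c \<rho> * l e d \<rho>') + sc (cc \<rho> \<rho>' (q * q)) (l (e + 2) c \<rho>' * l e d \<rho>)"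
proof -
  have t: "q * q = q powi (e + 2 - e)" by (simp add: power_int_def power2_eq_square)
  have ix: "d \<in> blk n" "c \<in> blk n" "\<rho>' \<in> blk n" "\<rho> \<in> blk n"
    using assms by (auto intro: blk_mono)
  define \<delta> where "\<delta> = q - inverse q"
  have "d < c" "c \<noteq> d" using assms(6) by (auto simp: lt_def)
  moreover have "1 - q * q = - q * \<delta>" using q_0 by (simp add: \<delta>_def field_simps)
  ultimately have "aa d c (q * q) = - q * \<delta>" "cc d c (q * q) = \<delta>"
    by (simp_all add: aa_def cc_def \<delta>_def)
  then show ?thesis
    using RLL[OF ix t] assms
    by (simp add: pair_def opm_def in_blk s2_def v_def sc_add_right sc_diff_right mult_ac
      flip: \<delta>_def)
qed

lemma pair_l_repeated:
  assumes "M \<le> n" "\<rho> \<in> blk M" "c \<in> blk M" "d \<in> blk M" "lt False c d"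
  shows "pair False v (\<lambda>e \<rho> c. l e c \<rho>) e \<rho> \<rho> c d = 0"
proof -
  have "aa \<rho> \<rho> (q * q) = 0" using assms q_0 by (simp add: aa_def qr_def in_blk)
  then have "sc (- q * (q - inverse q)) (pair False v (\<lambda>e \<rho> c. l e c \<rho>) e \<rho> \<rho> c d) = 0"
    using pair_l[OF assms(1,2,2,3,4,5), of e] by (simp add: cc_def)
  then show ?thesis using sc_eq_0[of "- q * (q - inverse q)"] q_0 q_inv by simp
qed

text \<open>Exchanging the columns interchanges the two terms on the right of \<open>pair_l\<close>
  up to a common scalar, which depends on the order of the columns as \<open>cc\<close>
  does.\<close>

lemma pair_l_swap:
  assumes "M \<le> n" "\<rho> \<in> blk M" "\<rho>' \<in> blk M" "\<rho> \<noteq> \<rho>'" "c \<in> blk M" "d \<in> blk M" "lt False c d"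
  shows "pair False v (\<lambda>e \<rho> c. l e c \<rho>) e \<rho> \<rho>' c d
    = sc (if \<rho> < \<rho>' then - inverse q else - q) (pair False v (\<lambda>e \<rho> c. l e c \<rho>) e \<rho>' \<rho> c d)"
proof -
  let ?G = "pair False v (\<lambda>e \<rho> c. l e c \<rho>) e" and ?s = "- q * (q - inverse q)"
  define \<delta> where "\<delta> = q - inverse q"
  have 1: "1 - q * q = - q * \<delta>" using q_0 by (simp add: \<delta>_def field_simps)
  have "sc ?s (?G \<rho> \<rho>' c d) = sc (if \<rho> < \<rho>' then - inverse q else - q) (sc ?s (?G \<rho>' \<rho> c d))"
    unfolding pair_l[OF assms(1,2,3,5,6,7), of e] pair_l[OF assms(1,3,2,5,6,7), of e] using assms(4)
    by (auto simp: aa_def cc_def 1 sc_diff_right sc_add_right mult_ac simp flip: \<delta>_def)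
  also have "\<dots> = sc ?s (sc (if \<rho> < \<rho>' then - inverse q else - q) (?G \<rho>' \<rho> c d))"
    by (simp add: mult.commute)
  finally show ?thesis using q_0 q_inv by (subst (asm) sc_cancel) auto
qed

text \<open>With opposite multiplication the product is built from its right end, so the list starts
  with the last column. Column \<open>j\<close> has the argument e + 2(j - 1).\<close>

definition adet :: "nat \<Rightarrow> int \<Rightarrow> 'r" where
  "adet r e = alt False v (\<lambda>e \<rho> c. l e c \<rho>) e (blk r) (rev [1..<Suc r])"

text \<open>Cramer's rule: the expansion along the last column is contracted with the last column of
  the inverse. An earlier column in the last place gives zero by \<open>alt_repeated\<close>. The
  contraction leaves only row \<open>Suc r\<close>, whose weight is 1 because no row is
  larger.\<close>

lemma adet_Suc:
  assumes r: "Suc r \<le> M" and n: "M \<le> n"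
  shows "adet r e = adet (Suc r) e * X (Suc r) (e + 2 * int r)"
proof -
  let ?R = "Suc r" and ?F = "\<lambda>e \<rho> c. l e c \<rho>" and ?\<rho>s = "rev [1..<Suc r]" and ?u = "e + 2 * int r"
  let ?A = "\<lambda>j. alt False v ?F e (blk ?R) (j # ?\<rho>s)"
  let ?w = "\<lambda>c. v ^ card {d \<in> blk ?R. lt False d c}"
  have Rn: "?R \<le> n" using r n by simp
  have A0: "?A j = 0" if j: "j \<in> blk r" for j
  proof (rule alt_repeated[where P = "blk M" and Cs = "blk M"])
    show "pair False v ?F e \<rho> \<rho> c d = 0" if "\<rho> \<in> blk M" "c \<in> blk M" "d \<in> blk M" "lt False c d" for e \<rho> c d
      using pair_l_repeated[OF n that] .
    show "\<exists>k. \<forall>e. \<forall>c\<in>blk M. \<forall>d\<in>blk M. lt False c d \<longrightarrow>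
      pair False v ?F e \<rho> \<rho>' c d = sc k (pair False v ?F e \<rho>' \<rho> c d)"
      if "\<rho> \<in> blk M" "\<rho>' \<in> blk M" "\<rho> \<noteq> \<rho>'" for \<rho> \<rho>'
      using pair_l_swap[OF n that] by blast
  qed (use r j in \<open>auto simp: in_blk\<close>)
  have AR: "?A ?R = adet ?R e" by (simp add: adet_def)
  have "(\<Sum>j\<in>blk ?R. ?A j * li ?R ?u j ?R) = adet ?R e * X ?R ?u"
    using A0 AR by (simp add: blk_Suc X_def del: alt.simps)
  also have "(\<Sum>j\<in>blk ?R. ?A j * li ?R ?u j ?R)
    = (\<Sum>c\<in>blk ?R. sc (?w c) (alt False v ?F e (blk ?R - {c}) ?\<rho>s * (\<Sum>j\<in>blk ?R. l ?u c j * li ?R ?u j ?R)))"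
    by (simp add: opm_def sum_distrib_left sum_distrib_right sc_sum_right mult.assoc del: upt_Suc)
       (rule sum.swap)
  also have "\<dots> = (\<Sum>c\<in>blk ?R. if c = ?R then sc (?w c) (alt False v ?F e (blk ?R - {c}) ?\<rho>s) else 0)"
    by (intro sum.cong refl) (simp add: l_li[OF Rn])
  also have "\<dots> = sc (?w ?R) (alt False v ?F e (blk ?R - {?R}) ?\<rho>s)"
    by simp
  also have "{d \<in> blk ?R. lt False d ?R} = {}" by (auto simp: lt_def in_blk)
  also have "blk ?R - {?R} = blk r" by (simp add: blk_Suc)
  finally show ?thesis by (simp add: adet_def)
qed

lemma Bt_adet:
  assumes "M \<le> n" "r \<le> M"
  shows "Bt r e = adet r e"
  using assms(2)
proof (induction r)
  case 0
  then show ?case by (simp add: adet_def)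
next
  case (Suc r)
  then have R: "Suc r \<in> blk n" using assms by (simp add: in_blk)
  show ?case using Suc adet_Suc[OF Suc.prems assms(1), of e] by (simp add: mult.assoc X_hh[OF R])
qed

text \<open>The counterpart for the inverse, at the ratio q^(-2): for odd indices \<open>qr\<close>
  is \<open>inverse q\<close>, and this is where \<open>aa \<rho> \<rho>\<close> vanishes.\<close>

lemma pair_li:
  assumes "r \<le> n" "\<rho> \<in> {Suc M..r}" "\<rho>' \<in> {Suc M..r}" "c \<in> {Suc M..r}" "d \<in> {Suc M..r}" "lt True c d"
  shows "sc (inverse q * (q - inverse q)) (pair True v (li r) e \<rho> \<rho>' c d)
    = sc (aa \<rho> \<rho>' (inverse q * inverse q)) (li r e \<rho>' d * li r (e + 2) \<rho> c)
      - sc (cc \<rho> \<rho>' (inverse q * inverse q)) (li r e \<rho> d * li r (e + 2) \<rho>' c)"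
proof -
  have t: "inverse q * inverse q = q powi (e - (e + 2))" by (simp add: power_int_minus power2_eq_square)
  have ix: "\<rho> \<in> blk r" "c \<in> blk r" "\<rho>' \<in> blk r" "d \<in> blk r"
    using assms by (auto simp: in_blk)
  define \<delta> where "\<delta> = q - inverse q"
  have "\<not> d < c" "c \<noteq> d" "d \<noteq> c" "c < d" using assms(6) by (auto simp: lt_def)
  moreover have "1 - inverse q * inverse q = inverse q * \<delta>" using q_0 by (simp add: \<delta>_def field_simps)
  ultimately show ?thesis
    using inv_inv_rll[OF assms(1) ix t] assms
    by (simp add: pair_def opm_def in_blk s2_def aa_def cc_def v_def sc_add_right sc_diff_right mult_ac
      flip: \<delta>_def)
qed

lemma pair_li_repeated:
  assumes "r \<le> n" "\<rho> \<in> {Suc M..r}" "c \<in> {Suc M..r}" "d \<in> {Suc M..r}" "lt True c d"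
  shows "pair True v (li r) e \<rho> \<rho> c d = 0"
proof -
  have "aa \<rho> \<rho> (inverse q * inverse q) = 0" using assms q_0 by (simp add: aa_def qr_def in_blk)
  then have "sc (inverse q * (q - inverse q)) (pair True v (li r) e \<rho> \<rho> c d) = 0"
    using pair_li[OF assms(1,2,2,3,4,5), of e] by (simp add: cc_def)
  then show ?thesis using sc_eq_0[of "inverse q * (q - inverse q)"] q_0 q_inv by simp
qed

lemma pair_li_swap:
  assumes "r \<le> n" "\<rho> \<in> {Suc M..r}" "\<rho>' \<in> {Suc M..r}" "\<rho> \<noteq> \<rho>'" "c \<in> {Suc M..r}" "d \<in> {Suc M..r}" "lt True c d"
  shows "pair True v (li r) e \<rho> \<rho>' c d
    = sc (if \<rho> < \<rho>' then - q else - inverse q) (pair True v (li r) e \<rho>' \<rho> c d)"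
proof -
  let ?G = "pair True v (li r) e" and ?s = "inverse q * (q - inverse q)"
  define \<delta> where "\<delta> = q - inverse q"
  have 1: "1 - inverse q * inverse q = inverse q * \<delta>" using q_0 by (simp add: \<delta>_def field_simps)
  have "sc ?s (?G \<rho> \<rho>' c d) = sc (if \<rho> < \<rho>' then - q else - inverse q) (sc ?s (?G \<rho>' \<rho> c d))"
    unfolding pair_li[OF assms(1,2,3,5,6,7), of e] pair_li[OF assms(1,3,2,5,6,7), of e] using assms(4)
    by (auto simp: aa_def cc_def 1 sc_diff_right sc_add_right mult_ac simp flip: \<delta>_def)
  also have "\<dots> = sc ?s (sc (if \<rho> < \<rho>' then - q else - inverse q) (?G \<rho>' \<rho> c d))"
    by (simp add: mult.commute)
  finally show ?thesis using q_0 q_inv by (subst (asm) sc_cancel) auto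
qed

text \<open>Subtracting a multiple of row \<open>Suc r\<close> reduces row \<open>\<rho>\<close> of the inverse of block \<open>Suc r\<close> to that of
  block \<open>r\<close>; the multiple of row \<open>Suc r\<close> drops out because that row then occurs twice.\<close>

lemma alt_li_Suc:
  assumes R: "Suc r \<le> n"
    and "C \<subseteq> {Suc M..Suc r}" "Suc r \<in> C" "set \<rho>s \<subseteq> {Suc M..r}" "card C = Suc (length \<rho>s)"
  shows "alt True v (li (Suc r)) e C (\<rho>s @ [Suc r]) = alt True v (li r) (e + 2) (C - {Suc r}) \<rho>s * X (Suc r) e"
  using assms(2-)
proof (induction \<rho>s arbitrary: C)
  case Nil
  then have "C = {Suc r}" by (auto simp: card_1_singleton_iff)
  then have "alt True v (li (Suc r)) e C [Suc r] = X (Suc r) e"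
    by (simp add: opm_def X_def)
  then show ?case using \<open>C = {Suc r}\<close> by simp
next
  case (Cons \<rho> \<rho>s)
  let ?R = "Suc r"
  define u where "u = e + 2 * int (length (\<rho>s @ [Suc r]))"
  have u: "e + 2 + 2 * int (length \<rho>s) = u" by (simp add: u_def)
  have finC: "finite C" using Cons.prems(1) finite_subset by blast
  have \<rho>: "\<rho> \<in> blk ?R" "\<rho> \<noteq> ?R" using Cons.prems(3) by (auto simp: in_blk)
  have Rb: "?R \<in> blk n" using R by (simp add: in_blk)
  let ?w = "\<lambda>c. v ^ card {d \<in> C. lt True d c}"
  let ?D = "\<lambda>c. alt True v (li ?R) e (C - {c}) (\<rho>s @ [?R])"
  \<comment> \<open>The value -1 makes both formulas of \<open>li_Suc\<close> hold in column
    \<open>Suc r\<close> as well.\<close>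
  define z where "z c = (if c = ?R then - 1 else yy r u c)" for c
  have zrow: "li ?R u \<rho> c = (if c = ?R then 0 else li r u \<rho> c) - li ?R u \<rho> ?R * z c"
    and zR: "li ?R u ?R c = - (X ?R u * z c)" if "c \<in> C" for c
  proof -
    have "c \<in> blk r" if "c \<noteq> ?R"
      using that \<open>c \<in> C\<close> Cons.prems(1) by (force simp: in_blk)
    then show "li ?R u \<rho> c = (if c = ?R then 0 else li r u \<rho> c) - li ?R u \<rho> ?R * z c"
      "li ?R u ?R c = - (X ?R u * z c)"
      using li_Suc[OF R \<rho>(1), of c u] li_Suc[OF R Suc_in_blk, of c u] \<rho>(2) by (auto simp: z_def X_def)
  qed
  let ?Z = "\<Sum>c\<in>C. sc (?w c) (z c * ?D c)"
  have "alt True v (li ?R) e C (?R # \<rho>s @ [?R]) = 0"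
  proof (rule alt_repeated[where P = "{Suc M..?R}" and Cs = "{Suc M..?R}"])
    show "pair True v (li ?R) e \<rho> \<rho> c d = 0"
      if "\<rho> \<in> {Suc M..?R}" "c \<in> {Suc M..?R}" "d \<in> {Suc M..?R}" "lt True c d" for e \<rho> c d
      using pair_li_repeated[OF R that] .
    show "\<exists>k. \<forall>e. \<forall>c\<in>{Suc M..?R}. \<forall>d\<in>{Suc M..?R}. lt True c d \<longrightarrow>
      pair True v (li ?R) e \<rho> \<rho>' c d = sc k (pair True v (li ?R) e \<rho>' \<rho> c d)"
      if "\<rho> \<in> {Suc M..?R}" "\<rho>' \<in> {Suc M..?R}" "\<rho> \<noteq> \<rho>'" for \<rho> \<rho>'
      using pair_li_swap[OF R that] by blast
  qed (use finC Cons.prems in auto)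
  also have "alt True v (li ?R) e C (?R # \<rho>s @ [?R]) = (\<Sum>c\<in>C. sc (?w c) (li ?R u ?R c * ?D c))"
    by (simp add: opm_def u_def)
  also have "\<dots> = - (X ?R u * ?Z)"
    by (simp add: zR sum_distrib_left mult.assoc sum_negf)
  finally have "hh ?R u * (X ?R u * ?Z) = 0" by simp
  then have Z: "?Z = 0" by (simp only: mult.assoc[symmetric] X_hh[OF Rb] mult_1_left)
  have "alt True v (li ?R) e C ((\<rho> # \<rho>s) @ [?R]) = (\<Sum>c\<in>C. sc (?w c) (li ?R u \<rho> c * ?D c))"
    by (simp add: opm_def u_def)
  also have "\<dots> = (\<Sum>c\<in>C. sc (?w c) ((if c = ?R then 0 else li r u \<rho> c) * ?D c)) - li ?R u \<rho> ?R * ?Z"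
    unfolding sum_distrib_left sum_subtractf[symmetric]
    by (intro sum.cong refl) (simp add: zrow left_diff_distrib sc_diff_right mult.assoc)
  also have "\<dots> = (\<Sum>c\<in>C. sc (?w c) ((if c = ?R then 0 else li r u \<rho> c) * ?D c))"
    by (simp add: Z)
  also have "\<dots> = (\<Sum>c\<in>C - {?R}. sc (?w c) (li r u \<rho> c * ?D c))"
    using finC Cons.prems(2) by (simp add: sum.remove[of C ?R])
  also have "\<dots> = (\<Sum>c\<in>C - {?R}. sc (v ^ card {d \<in> C - {?R}. lt True d c})
      (li r u \<rho> c * (alt True v (li r) (e + 2) (C - {?R} - {c}) \<rho>s * X ?R e)))"
  proof (intro sum.cong refl)
    fix c assume c: "c \<in> C - {?R}"
    \<comment> \<open>\<open>Suc r\<close> is the largest column, so its removal does not change the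
      weights of the others.\<close>
    have "{d \<in> C - {?R}. lt True d c} = {d \<in> C. lt True d c}"
      using c Cons.prems(1) by (force simp: lt_def)
    moreover have "?D c = alt True v (li r) (e + 2) (C - {c} - {?R}) \<rho>s * X ?R e"
      using Cons.prems c finC by (intro Cons.IH) auto
    moreover have "C - {c} - {?R} = C - {?R} - {c}" by auto
    ultimately show "sc (?w c) (li r u \<rho> c * ?D c) = sc (v ^ card {d \<in> C - {?R}. lt True d c})
      (li r u \<rho> c * (alt True v (li r) (e + 2) (C - {?R} - {c}) \<rho>s * X ?R e))" by simp
  qed
  also have "\<dots> = alt True v (li r) (e + 2) (C - {?R}) (\<rho> # \<rho>s) * X ?R e"
    by (simp add: opm_def sum_distrib_right mult.assoc u)
  finally show ?case .
qed

text \<open>Row M + k has the argument e + \<open>kap r\<close> + 2(r - M - k) = e + 2M - 2k. The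
  base argument contains \<open>kap r\<close> so that this does not depend on
  \<open>r\<close>.\<close>

definition pdet :: "nat \<Rightarrow> int \<Rightarrow> 'r" where
  "pdet r e = alt True v (li r) (e + kap r) {Suc M..r} [Suc M..<Suc r]"

lemma pdet_Suc:
  assumes "Suc r \<le> n" "M \<le> r"
  shows "pdet (Suc r) e = pdet r e * X (Suc r) (e + kap (Suc r))"
proof -
  have "{Suc M..Suc r} - {Suc r} = {Suc M..r}" by auto
  moreover have "e + kap (Suc r) + 2 = e + kap r" using assms by (simp add: kap_Suc eps_def)
  moreover have "[Suc M..<Suc (Suc r)] = [Suc M..<Suc r] @ [Suc r]" using assms by simp
  ultimately show ?thesis
    using alt_li_Suc[OF assms(1), of "{Suc M..Suc r}" "[Suc M..<Suc r]" "e + kap (Suc r)"] assms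
    by (simp only: pdet_def) (simp add: Suc_diff_le atLeastLessThanSuc_atLeastAtMost del: upt_Suc alt.simps)
qed

theorem Bt_dets:
  assumes "M \<le> n" "M \<le> r" "r \<le> n"
  shows "Bt r e = adet M e * pdet r e"
  using assms(2,3)
proof (induction r rule: dec_induct)
  case base
  then show ?case by (simp add: Bt_adet[OF assms(1)] pdet_def)
next
  case (step r)
  then show ?case by (simp add: pdet_Suc mult.assoc)
qed

end

section \<open>Alternating sums over permutations\<close>

lemma permutes_lists:
  "bij_betw (\<lambda>\<sigma>. map (\<lambda>k. a + \<sigma> k) [1..<Suc m]) {\<sigma>. \<sigma> permutes {1..m}} (permutations_of_set {Suc a..a + m})"
proof -
  let ?h = "\<lambda>\<sigma>. map (\<lambda>k. a + \<sigma> k) [1..<Suc m]"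
  have inj: "inj_on ?h {\<sigma>. \<sigma> permutes {1..m}}"
  proof (rule inj_onI)
    fix \<sigma> \<tau> assume st: "\<sigma> \<in> {\<sigma>. \<sigma> permutes {1..m}}" "\<tau> \<in> {\<sigma>. \<sigma> permutes {1..m}}" "?h \<sigma> = ?h \<tau>"
    show "\<sigma> = \<tau>"
    proof
      fix k
      show "\<sigma> k = \<tau> k"
      proof (cases "k \<in> {1..m}")
        case True
        then have "k \<in> set [1..<Suc m]" by auto
        then show ?thesis using st(3) by (auto simp: map_eq_conv simp del: upt_Suc)
      next
        case False
        then show ?thesis using st(1,2) by (simp add: permutes_not_in)
      qed
    qed
  qed
  moreover have "?h ` {\<sigma>. \<sigma> permutes {1..m}} = permutations_of_set {Suc a..a + m}"
  proof (rule card_subset_eq)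
    show "?h ` {\<sigma>. \<sigma> permutes {1..m}} \<subseteq> permutations_of_set {Suc a..a + m}"
    proof clarify
      fix \<sigma> assume s: "\<sigma> permutes {1..m}"
      have "set (?h \<sigma>) = (+) a ` \<sigma> ` {1..m}" by (auto simp: image_image simp del: upt_Suc)
      also have "\<sigma> ` {1..m} = {1..m}" using s by (rule permutes_image)
      also have "(+) a ` {1..m} = {Suc a..a + m}" by (simp add: add.commute)
      finally show "?h \<sigma> \<in> permutations_of_set {Suc a..a + m}"
        using permutes_inj_on[OF s]
        by (intro permutations_of_setI) (auto simp: distinct_map inj_on_def simp del: upt_Suc)
    qed
    show "card (?h ` {\<sigma>. \<sigma> permutes {1..m}}) = card (permutations_of_set {Suc a..a + m})"
      using card_permutations[of "{1..m}" m] by (subst card_image[OF inj]) simp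
  qed simp
  ultimately show ?thesis by (simp add: bij_betw_def)
qed

context scaled_ring
begin

fun invs :: "bool \<Rightarrow> nat list \<Rightarrow> nat" where
  "invs b [] = 0"
| "invs b (x # xs) = card {d \<in> set xs. lt b d x} + invs b xs"

fun chain :: "bool \<Rightarrow> (int \<Rightarrow> nat \<Rightarrow> nat \<Rightarrow> 'r) \<Rightarrow> int \<Rightarrow> nat list \<Rightarrow> nat list \<Rightarrow> 'r" where
  "chain b F e (\<rho> # \<rho>s) (x # xs) = opm b (F (e + 2 * int (length \<rho>s)) \<rho> x) (chain b F e \<rho>s xs)"
| "chain b F e _ _ = 1"

text \<open>The recursion chooses the columns one after another. Each weight counts the columns
  still to come that precede the present choice, that is, the inversions it takes part in as first
  letter.\<close>

lemma alt_permutations: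
  assumes "finite C" "card C = length \<rho>s"
  shows "alt b v F e C \<rho>s = (\<Sum>xs\<in>permutations_of_set C. sc (v ^ invs b xs) (chain b F e \<rho>s xs))"
  using assms
proof (induction \<rho>s arbitrary: C)
  case (Cons \<rho> \<rho>s)
  let ?f = "\<lambda>xs. sc (v ^ invs b xs) (chain b F e (\<rho> # \<rho>s) xs)"
  have ne: "C \<noteq> {}" using Cons.prems by auto
  have "(\<Sum>xs\<in>permutations_of_set C. ?f xs) = (\<Sum>c\<in>C. \<Sum>xs\<in>(#) c ` permutations_of_set (C - {c}). ?f xs)"
    unfolding permutations_of_set_nonempty[OF ne] using Cons.prems
    by (intro sum.UNION_disjoint) auto
  also have "\<dots> = (\<Sum>c\<in>C. \<Sum>xs\<in>permutations_of_set (C - {c}). ?f (c # xs))"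
    by (rule sum.cong[OF refl], subst sum.reindex) auto
  also have "\<dots> = (\<Sum>c\<in>C. sc (v ^ card {d \<in> C. lt b d c})
      (opm b (F (e + 2 * int (length \<rho>s)) \<rho> c) (alt b v F e (C - {c}) \<rho>s)))"
  proof (intro sum.cong refl)
    fix c assume c: "c \<in> C"
    have "alt b v F e (C - {c}) \<rho>s = (\<Sum>xs\<in>permutations_of_set (C - {c}). sc (v ^ invs b xs) (chain b F e \<rho>s xs))"
      using Cons.prems c by (intro Cons.IH) auto
    moreover have "card {d \<in> set xs. lt b d c} = card {d \<in> C. lt b d c}"
      if "xs \<in> permutations_of_set (C - {c})" for xs
    proof -
      have "{d \<in> set xs. lt b d c} = {d \<in> C. lt b d c}"
        using permutations_of_setD(1)[OF that] by (auto simp: lt_def)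
      then show ?thesis by simp
    qed
    ultimately show "(\<Sum>xs\<in>permutations_of_set (C - {c}). ?f (c # xs)) = sc (v ^ card {d \<in> C. lt b d c})
      (opm b (F (e + 2 * int (length \<rho>s)) \<rho> c) (alt b v F e (C - {c}) \<rho>s))"
      by (simp add: opm_sum sc_sum_right power_add)
  qed
  finally show ?case by simp
qed simp

lemma invs_upt:
  assumes "inj_on f {i..<j}" "i \<le> j"
  shows "invs True (map f [i..<j]) = card {(x, y). i \<le> x \<and> x < y \<and> y < j \<and> f y < f x}"
  using assms(2,1)
proof (induction rule: inc_induct)
  case base
  have e: "{(x, y). j \<le> x \<and> x < y \<and> y < j \<and> f y < f x} = {}" by auto
  show ?case unfolding e by simp
next
  case (step i)
  let ?I = "\<lambda>i. {(x, y). i \<le> x \<and> x < y \<and> y < j \<and> f y < f x}"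
  have fin: "finite (?I i)" for i by (rule finite_subset[of _ "{..<j} \<times> {..<j}"]) auto
  have inj: "inj_on f {Suc i..<j}" using step.prems by (rule inj_on_subset) auto
  let ?S = "{y \<in> {Suc i..<j}. f y < f i}"
  have "?I i = ?I (Suc i) \<union> Pair i ` ?S"
    by (auto simp: image_iff Suc_le_eq le_less)
  moreover have "card (?I (Suc i) \<union> Pair i ` ?S) = card (?I (Suc i)) + card (Pair i ` ?S)"
    by (rule card_Un_disjoint[OF fin]) auto
  moreover have "card (Pair i ` ?S) = card ?S"
    by (rule card_image) (simp add: inj_on_def)
  moreover have "card (f ` ?S) = card ?S"
    by (rule card_image, rule inj_on_subset[OF inj]) auto
  moreover have "f ` ?S = {d \<in> f ` {Suc i..<j}. d < f i}" by auto
  moreover have "invs True (map f [i..<j]) = card {d \<in> f ` {Suc i..<j}. d < f i} + card (?I (Suc i))"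
    using step.IH[OF inj] step.hyps by (simp add: upt_conv_Cons lt_def)
  ultimately show ?case by simp
qed

text \<open>The word and the order of the columns are both reversed, so the inversions counted are
  again those of \<open>f\<close>.\<close>

lemma invs_rev_upt:
  assumes "inj_on f {i..<j}" "i \<le> j"
  shows "invs False (rev (map f [i..<j])) = card {(x, y). i \<le> x \<and> x < y \<and> y < j \<and> f y < f x}"
  using assms(2,1)
proof (induction rule: dec_induct)
  case base
  have e: "{(x, y). i \<le> x \<and> x < y \<and> y < i \<and> f y < f x} = {}" by auto
  show ?case unfolding e by simp
next
  case (step j)
  let ?I = "\<lambda>j. {(x, y). i \<le> x \<and> x < y \<and> y < j \<and> f y < f x}"
  have fin: "finite (?I j)" for j by (rule finite_subset[of _ "{..<j} \<times> {..<j}"]) auto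
  have inj: "inj_on f {i..<j}" using step.prems by (rule inj_on_subset) auto
  let ?S = "{x \<in> {i..<j}. f j < f x}"
  have "?I (Suc j) = ?I j \<union> (\<lambda>x. (x, j)) ` ?S"
    by (auto simp: image_iff less_Suc_eq)
  then have "card (?I (Suc j)) = card (?I j) + card ((\<lambda>x. (x, j)) ` ?S)"
    using card_Un_disjoint[of "?I j" "(\<lambda>x. (x, j)) ` ?S"] fin by auto
  moreover have "card ((\<lambda>x. (x, j)) ` ?S) = card ?S"
    by (rule card_image) (simp add: inj_on_def)
  moreover have "card (f ` ?S) = card ?S"
    by (rule card_image, rule inj_on_subset[OF inj]) auto
  moreover have "f ` ?S = {d \<in> f ` {i..<j}. f j < d}" by auto
  moreover have "invs False (rev (map f [i..<Suc j])) = card {d \<in> f ` {i..<j}. f j < d} + card (?I j)"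
    using step.IH[OF inj] step.hyps by (simp add: lt_def)
  ultimately show ?case by simp
qed

lemma chain_upt:
  assumes "i \<le> m"
  shows "chain True F e [Suc (a + i)..<Suc (a + m)] (map f [Suc i..<Suc m]) =
    (\<Prod>k\<leftarrow>[Suc i..<Suc m]. F (e + 2 * (int m - int k)) (a + k) (f k))"
  using assms
proof (induction rule: inc_induct)
  case (step i)
  then have "[Suc (a + i)..<Suc (a + m)] = Suc (a + i) # [Suc (a + Suc i)..<Suc (a + m)]"
    "[Suc i..<Suc m] = Suc i # [Suc (Suc i)..<Suc m]"
    by (simp_all add: upt_conv_Cons del: upt_Suc)
  moreover have "int (length [Suc (a + Suc i)..<Suc (a + m)]) = int m - int (Suc i)"
    using step.hyps by simp
  ultimately show ?case using step.IH by (simp add: opm_def del: upt_Suc)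
qed simp

lemma chain_rev_upt:
  "chain False F e (rev [1..<Suc m]) (rev (map f [1..<Suc m])) =
    (\<Prod>k\<leftarrow>[1..<Suc m]. F (e + 2 * (int k - 1)) k (f k))"
proof (induction m)
  case (Suc m)
  have "[1..<Suc (Suc m)] = [1..<Suc m] @ [Suc m]" by simp
  then show ?case using Suc by (simp add: opm_def del: upt_Suc)
qed simp

lemma alt_permutes:
  "alt True v F e {Suc a..a + m} [Suc a..<Suc (a + m)] = (\<Sum>\<sigma> | \<sigma> permutes {1..m}.
     sc (v ^ card {(i, j). 1 \<le> i \<and> i < j \<and> j \<le> m \<and> \<sigma> j < \<sigma> i})
       (\<Prod>k\<leftarrow>[1..<Suc m]. F (e + 2 * (int m - int k)) (a + k) (a + \<sigma> k)))"
proof -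
  let ?h = "\<lambda>\<sigma>. map (\<lambda>k. a + \<sigma> k) [1..<Suc m]"
  let ?\<rho>s = "[Suc a..<Suc (a + m)]"
  have "alt True v F e {Suc a..a + m} ?\<rho>s = (\<Sum>xs\<in>permutations_of_set {Suc a..a + m}. sc (v ^ invs True xs) (chain True F e ?\<rho>s xs))"
    by (rule alt_permutations) auto
  also have "\<dots> = (\<Sum>\<sigma> | \<sigma> permutes {1..m}. sc (v ^ invs True (?h \<sigma>)) (chain True F e ?\<rho>s (?h \<sigma>)))"
    by (rule sum.reindex_bij_betw[OF permutes_lists, symmetric])
  also have "\<dots> = (\<Sum>\<sigma> | \<sigma> permutes {1..m}.
     sc (v ^ card {(i, j). 1 \<le> i \<and> i < j \<and> j \<le> m \<and> \<sigma> j < \<sigma> i})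
       (\<Prod>k\<leftarrow>[1..<Suc m]. F (e + 2 * (int m - int k)) (a + k) (a + \<sigma> k)))"
  proof (intro sum.cong refl)
    fix \<sigma> assume "\<sigma> \<in> {\<sigma>. \<sigma> permutes {1..m}}"
    then have "inj \<sigma>" by (auto dest: permutes_inj)
    then have inj: "inj_on (\<lambda>k. a + \<sigma> k) {1..<Suc m}" by (auto simp: inj_on_def inj_def)
    have "invs True (?h \<sigma>) = card {(i, j). 1 \<le> i \<and> i < j \<and> j \<le> m \<and> \<sigma> j < \<sigma> i}"
      using invs_upt[OF inj] by (simp add: less_Suc_eq_le del: upt_Suc)
    moreover have "chain True F e ?\<rho>s (?h \<sigma>) = (\<Prod>k\<leftarrow>[1..<Suc m]. F (e + 2 * (int m - int k)) (a + k) (a + \<sigma> k))"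
      using chain_upt[of 0 m F e a "\<lambda>k. a + \<sigma> k"] by (simp del: upt_Suc)
    ultimately show "sc (v ^ invs True (?h \<sigma>)) (chain True F e ?\<rho>s (?h \<sigma>)) =
      sc (v ^ card {(i, j). 1 \<le> i \<and> i < j \<and> j \<le> m \<and> \<sigma> j < \<sigma> i})
       (\<Prod>k\<leftarrow>[1..<Suc m]. F (e + 2 * (int m - int k)) (a + k) (a + \<sigma> k))" by (simp only:)
  qed
  finally show ?thesis .
qed

lemma alt_permutes_rev:
  "alt False v F e {1..m} (rev [1..<Suc m]) = (\<Sum>\<sigma> | \<sigma> permutes {1..m}.
     sc (v ^ card {(i, j). 1 \<le> i \<and> i < j \<and> j \<le> m \<and> \<sigma> j < \<sigma> i})
       (\<Prod>k\<leftarrow>[1..<Suc m]. F (e + 2 * (int k - 1)) k (\<sigma> k)))"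
proof -
  let ?h = "\<lambda>\<sigma>. map (\<lambda>k. 0 + \<sigma> k) [1..<Suc m]"
  let ?\<rho>s = "rev [1..<Suc m]"
  have h: "?h \<sigma> = map \<sigma> [1..<Suc m]" for \<sigma> :: "nat \<Rightarrow> nat" by simp
  have "alt False v F e {1..m} ?\<rho>s = (\<Sum>xs\<in>permutations_of_set {1..m}. sc (v ^ invs False xs) (chain False F e ?\<rho>s xs))"
    by (rule alt_permutations) auto
  also have "\<dots> = (\<Sum>xs\<in>permutations_of_set {1..m}. sc (v ^ invs False (rev xs)) (chain False F e ?\<rho>s (rev xs)))"
    by (rule sum.reindex_bij_witness[of _ rev rev]) (auto intro!: permutations_of_setI dest: permutations_of_setD)
  also have "\<dots> = (\<Sum>\<sigma> | \<sigma> permutes {1..m}. sc (v ^ invs False (rev (?h \<sigma>))) (chain False F e ?\<rho>s (rev (?h \<sigma>))))"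
    using sum.reindex_bij_betw[OF permutes_lists[of 0 m], of "\<lambda>xs. sc (v ^ invs False (rev xs)) (chain False F e ?\<rho>s (rev xs))"]
    by (simp del: upt_Suc)
  also have "\<dots> = (\<Sum>\<sigma> | \<sigma> permutes {1..m}.
     sc (v ^ card {(i, j). 1 \<le> i \<and> i < j \<and> j \<le> m \<and> \<sigma> j < \<sigma> i})
       (\<Prod>k\<leftarrow>[1..<Suc m]. F (e + 2 * (int k - 1)) k (\<sigma> k)))"
  proof (intro sum.cong refl)
    fix \<sigma> assume "\<sigma> \<in> {\<sigma>. \<sigma> permutes {1..m}}"
    then have "inj \<sigma>" by (auto dest: permutes_inj)
    then have inj: "inj_on \<sigma> {1..<Suc m}" by (auto simp: inj_on_def inj_def)
    have "invs False (rev (?h \<sigma>)) = card {(i, j). 1 \<le> i \<and> i < j \<and> j \<le> m \<and> \<sigma> j < \<sigma> i}"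
      using invs_rev_upt[OF inj] unfolding h by (simp add: less_Suc_eq_le del: upt_Suc)
    then show "sc (v ^ invs False (rev (?h \<sigma>))) (chain False F e ?\<rho>s (rev (?h \<sigma>))) =
      sc (v ^ card {(i, j). 1 \<le> i \<and> i < j \<and> j \<le> m \<and> \<sigma> j < \<sigma> i})
       (\<Prod>k\<leftarrow>[1..<Suc m]. F (e + 2 * (int k - 1)) k (\<sigma> k))"
      by (simp only: chain_rev_upt h)
  qed
  finally show ?thesis .
qed

end

section \<open>The normalising series\<close>

lemma qq_0: "qq \<noteq> 0"
  by (simp add: qq_def)

lemma qq_power: "0 < k \<Longrightarrow> qq ^ k \<noteq> 1"
proof
  assume k: "0 < k" "qq ^ k = 1"
  have "qq ^ k = to_fract ([:0, 1:] ^ k)" for k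
    by (induction k) (simp_all only: power_0 power_Suc to_fract_mult to_fract_1 qq_def)
  then have "([:0, 1:] :: complex poly) ^ k = 1" using k(2) by (metis to_fract_1 to_fract_eq_iff)
  then have "poly ([:0, 1:] ^ k) (0::complex) = poly 1 0" by simp
  then show False using k(1) by (simp add: poly_power power_0_left)
qed

lemma qq_powi: "k \<noteq> 0 \<Longrightarrow> qq powi k \<noteq> 1"
  using qq_power[of "nat k"] qq_power[of "nat (- k)"]
  by (auto simp: power_int_def inverse_eq_1_iff power_inverse)

text \<open>The functional equation solved for its highest coefficient: \<open>inverse p\<close> is
  the dilation of the variable and \<open>c\<close> the sum of the two roots on the right.\<close>

fun f_rec :: "Cq \<Rightarrow> Cq \<Rightarrow> nat \<Rightarrow> Cq" where
  "f_rec p c 0 = 1"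
| "f_rec p c (Suc 0) = ((1 + p) - c) / (p * (inverse p ^ Suc 0 - 1))"
| "f_rec p c (Suc (Suc n)) = ((1 + p) * (inverse p ^ Suc n * f_rec p c (Suc n)) - inverse p ^ n * f_rec p c n
     - c * f_rec p c (Suc n) + f_rec p c n) / (p * (inverse p ^ Suc (Suc n) - 1))"

text \<open>In degree 0 the equation says \<open>a * b = p\<close>. In degree \<open>n > 0\<close>
  the new coefficient is multiplied by \<open>p * (inverse p ^ n - 1)\<close>, which is nonzero as
  \<open>p\<close> is not a root of unity.\<close>

lemma f_eq_iff:
  fixes f :: "Cq fps"
  assumes p: "p \<noteq> 0" "\<And>n. 0 < n \<Longrightarrow> p ^ n \<noteq> 1"
    and f0: "fps_nth f 0 = 1"
  shows "fps_compose f (fps_const (inverse p) * fps_X) * ((fps_X - 1) * (fps_X - fps_const p))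
       = f * ((fps_X - fps_const a) * (fps_X - fps_const b))
     \<longleftrightarrow> a * b = p \<and> f = Abs_fps (f_rec p (a + b))"
proof -
  let ?g = "Abs_fps (\<lambda>n. inverse p ^ n * fps_nth f n)"
  have g: "fps_compose f (fps_const (inverse p) * fps_X) = ?g"
    by (rule fps_ext) (simp add: fps_compose_linear)
  have e1: "(fps_X - 1) * (fps_X - fps_const p) = fps_X * fps_X - fps_const (1 + p) * fps_X + fps_const p"
    by (simp add: algebra_simps flip: fps_const_add)
  have e2: "(fps_X - fps_const a) * (fps_X - fps_const b) = fps_X * fps_X - fps_const (a + b) * fps_X + fps_const (a * b)"
    by (simp add: algebra_simps flip: fps_const_add fps_const_mult)
  have nth: "fps_nth (h * (fps_X * fps_X - fps_const c * fps_X + fps_const d)) n =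
     (case n of 0 \<Rightarrow> d * fps_nth h 0 | Suc 0 \<Rightarrow> d * fps_nth h 1 - c * fps_nth h 0
       | Suc (Suc m) \<Rightarrow> d * fps_nth h n - c * fps_nth h (Suc m) + fps_nth h m)" for h :: "Cq fps" and c d n
  proof -
    have "h * (fps_X * fps_X - fps_const c * fps_X + fps_const d)
      = fps_X * (fps_X * h) - fps_const c * (fps_X * h) + fps_const d * h"
      by (simp add: algebra_simps)
    then show ?thesis by (cases n; cases "n - 1") simp_all
  qed
  have np: "p * (inverse p ^ Suc n - 1) \<noteq> 0" for n
    using p(1) p(2)[of "Suc n"] by (simp add: power_inverse del: power_Suc)
  have "?g * ((fps_X - 1) * (fps_X - fps_const p)) = f * ((fps_X - fps_const a) * (fps_X - fps_const b))
    \<longleftrightarrow> a * b = p \<and> f = Abs_fps (f_rec p (a + b))" (is "?L \<longleftrightarrow> ?R")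
  proof
    assume ?L
    then have c: "fps_nth (?g * ((fps_X - 1) * (fps_X - fps_const p))) n = fps_nth (f * ((fps_X - fps_const a) * (fps_X - fps_const b))) n" for n
      by simp
    have ab: "a * b = p" using c[of 0] f0 unfolding e1 e2 nth by simp
    have "fps_nth f n = f_rec p (a + b) n" for n
    proof (induction n rule: less_induct)
      case (less n)
      consider "n = 0" | "n = Suc 0" | m where "n = Suc (Suc m)" by (metis not0_implies_Suc)
      then show ?case
      proof cases
        case 2
        then show ?thesis using c[of 1] f0 ab unfolding e1 e2 nth 2 f_rec.simps nonzero_eq_divide_eq[OF np]
          by (simp add: algebra_simps)
      next
        case (3 m)
        have IH: "f_rec p (a + b) m = fps_nth f m" "f_rec p (a + b) (Suc m) = fps_nth f (Suc m)"
          using less[of m] less[of "Suc m"] 3 by simp_all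
        show ?thesis using c[of n] ab
          unfolding e1 e2 nth 3 f_rec.simps nonzero_eq_divide_eq[OF np] IH
          by (simp add: algebra_simps)
      qed (use f0 in simp)
    qed
    with ab show ?R by (auto intro: fps_ext)
  next
    assume R: ?R
    then have ab: "a * b = p" and f: "fps_nth f n = f_rec p (a + b) n" for n by simp_all
    show ?L
    proof (rule fps_ext)
      fix n
      consider "n = 0" | "n = Suc 0" | m where "n = Suc (Suc m)" by (metis not0_implies_Suc)
      then show "fps_nth (?g * ((fps_X - 1) * (fps_X - fps_const p))) n = fps_nth (f * ((fps_X - fps_const a) * (fps_X - fps_const b))) n"
      proof cases
        case 1
        then show ?thesis unfolding e1 e2 nth using ab by simp
      next
        case 2
        have "fps_nth f (Suc 0) * (p * (inverse p ^ Suc 0 - 1)) = (1 + p) - (a + b)"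
          using f[of "Suc 0"] unfolding f_rec.simps nonzero_eq_divide_eq[OF np] .
        then show ?thesis unfolding e1 e2 nth 2 using ab f0 by (simp add: algebra_simps)
      next
        case (3 m)
        have "fps_nth f n * (p * (inverse p ^ n - 1)) = (1 + p) * (inverse p ^ Suc m * fps_nth f (Suc m))
          - inverse p ^ m * fps_nth f m - (a + b) * fps_nth f (Suc m) + fps_nth f m"
          using f[of n] unfolding 3 f f_rec.simps nonzero_eq_divide_eq[OF np] .
        then show ?thesis unfolding e1 e2 nth 3 using ab by (simp add: algebra_simps)
      qed
    qed
  qed
  then show ?thesis unfolding g .
qed

text \<open>Existence and uniqueness give the definite description its meaning. The constant term
  makes the scalar factor of R invertible.\<close>

lemma f_ser_0:
  assumes "M \<noteq> N"
  shows "fps_nth (f_ser M N) 0 = 1"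
proof -
  define p where "p = qq powi (2 * int N - 2 * int M)"
  have p: "p \<noteq> 0" using qq_0 by (simp add: p_def)
  have pn: "p ^ n \<noteq> 1" if "0 < n" for n
  proof -
    have "p ^ n = qq powi ((2 * int N - 2 * int M) * int n)" by (simp add: p_def power_int_mult)
    then show ?thesis using qq_powi[of "(2 * int N - 2 * int M) * int n"] assms that by simp
  qed
  have ab: "qq powi - 2 * (p * qq\<^sup>2) = p"
    using qq_0 by (simp add: power_int_minus field_simps)
  let ?P = "\<lambda>f. fps_nth f 0 = 1 \<and> fps_compose f (fps_const (inverse p) * fps_X) * ((fps_X - 1) * (fps_X - fps_const p))
         = f * ((fps_X - fps_const (qq powi (-2))) * (fps_X - fps_const (p * qq ^ 2)))"
  let ?f = "Abs_fps (f_rec p (qq powi (-2) + p * qq\<^sup>2))"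
  have "?P ?f"
    using f_eq_iff[OF p pn, of ?f "qq powi (-2)" "p * qq\<^sup>2"] ab by simp
  moreover have "f = ?f" if "?P f" for f
    using f_eq_iff[OF p pn, of f "qq powi (-2)" "p * qq\<^sup>2"] that by blast
  ultimately have "?P (THE f. ?P f)" by (rule theI)
  then show ?thesis unfolding f_ser_def Let_def p_def by blast
qed

section \<open>The defining relations at powers of \<open>q\<close>\<close>

lemma fscal_add: "fscal (a + b) = fscal a + fscal b"
  by (simp add: fscal_def single_add)

lemma fscal_mult: "fscal (a * b) = fscal a * fscal b"
  by (simp add: fscal_def mult_single)

lemma fscal_commute: "x * fscal a = fscal a * x"
  by (induction x rule: free_induct) (simp_all add: fscal_def mult_single algebra_simps)

lemma fscal_1: "fscal 1 = 1"
  by (simp add: fscal_def)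

definition fsc :: "Cq \<Rightarrow> free \<Rightarrow> free" where
  "fsc a x = fscal a * x"

interpretation fsc: scaled_ring fsc
  by standard (simp_all add: fsc_def fscal_add fscal_mult fscal_1 algebra_simps,
    metis fscal_commute mult.assoc)

lemma sign_fsc: "(-1) ^ k * x = fsc ((-1) ^ k) x"
  by (cases "even k") (simp_all add: fsc_def fscal_1, metis fscal_1 fsc.sc_1 fsc.sc_minus_left fsc_def)

lemma free_par_pow_gen:
  "(free_par M ^^ e) (fgen (Lgen s r i j)) = fsc ((-1) ^ (e * (par M i + par M j))) (fgen (Lgen s r i j))"
  by (cases "even e") (simp_all add: free_par_power free_par_gen sign_fsc power_mult)

lemma free_par_pow_0: "(free_par M ^^ e) 0 = 0"
  by (simp add: free_par_power free_par_0)

lemma free_par_pow_id: "free_par M x = x \<Longrightarrow> (free_par M ^^ e) x = x"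
  by (simp add: free_par_power)

lemma sum_two_points:
  assumes "finite S" "i \<in> S" "k \<in> S" "i' \<in> S" "k' \<in> S"
    and "\<And>j l. \<not> (j = i \<and> l = k) \<Longrightarrow> \<not> (j = i' \<and> l = k') \<Longrightarrow> h j l = (0::'a::comm_monoid_add)"
  shows "(\<Sum>j\<in>S. \<Sum>l\<in>S. h j l) = h i k + (if i = i' \<and> k = k' then 0 else h i' k')"
proof -
  have "(\<Sum>j\<in>S. \<Sum>l\<in>S. h j l) = (\<Sum>(j, l)\<in>S \<times> S. h j l)" by (rule sum.cartesian_product)
  also have "\<dots> = (\<Sum>(j, l)\<in>{(i, k), (i', k')}. h j l)"
    by (rule sum.mono_neutral_right) (use assms in auto)
  finally show ?thesis by auto
qed

text \<open>For fixed \<open>i\<close> and \<open>k\<close>, R has at most two nonzero entries, the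
  diagonal and the permuted one, and they coincide for \<open>i = k\<close>.\<close>

lemma gmult2_R_left:
  assumes "i \<in> {1..M+N}" "k \<in> {1..M+N}"
    and X: "\<And>j l. \<not> (j = i \<and> l = k) \<Longrightarrow> \<not> (j = k \<and> l = i) \<Longrightarrow> X i j k l = 0"
  shows "gmult2 (free_par M) M N X Y i m k n = X i i k k * Y i m k n
    + (if i = k then 0 else fsc ((-1) ^ ((par M k + par M i) * (par M k + par M m))) (X i k k i * Y k m i n))"
  unfolding gmult2_def
  by (subst sum_two_points[of _ i k k i]) (use assms in \<open>auto simp: X free_par_power sign_fsc mult.assoc\<close>)

lemma sign_even: "(-1::Cq) ^ (a * (b + b)) = 1"
  by (rule neg_one_even_power) simp

lemma gmult2_R_right:
  assumes "m \<in> {1..M+N}" "n \<in> {1..M+N}"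
    and Y: "\<And>j l. \<not> (j = m \<and> l = n) \<Longrightarrow> \<not> (j = n \<and> l = m) \<Longrightarrow> Y j m l n = 0"
    and par: "\<And>j l. free_par M (Y j m l n) = Y j m l n"
  shows "gmult2 (free_par M) M N X Y i m k n = X i m k n * Y m m n n
    + (if m = n then 0 else fsc ((-1) ^ ((par M k + par M m) * (par M n + par M m))) (X i n k m * Y n m m n))"
  unfolding gmult2_def
  by (subst sum_two_points[of _ m n n m])
    (use assms in \<open>auto simp: Y free_par_pow_id[OF par] free_par_pow_0 sign_fsc sign_even mult.assoc\<close>)

lemma L1_zero: "k \<noteq> l \<Longrightarrow> L1 s r i j k l = 0"
  by (simp add: L1_def)

lemma L2_zero: "i \<noteq> j \<Longrightarrow> L2 s r i j k l = 0"
  by (simp add: L2_def)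

lemma RLL_left:
  assumes ix: "i \<in> {1..M+N}" "k \<in> {1..M+N}" "m \<in> {1..M+N}" "n \<in> {1..M+N}"
  shows "gmult2 (free_par M) M N (gmult2 (free_par M) M N (Rcoeff M N 1 p) (L1 s r)) (L2 t r') i m k n =
    fsc ((-1) ^ ((par M i + par M m) * (par M k + par M n)) * fps_nth (R_ser M N i i k k) p)
      (fgen (Lgen s r i m) * fgen (Lgen t r' k n))
    + fsc (if i = k then 0 else (-1) ^ ((par M k + par M m) * (par M k + par M n)) * fps_nth (R_ser M N i k k i) p)
      (fgen (Lgen s r k m) * fgen (Lgen t r' i n))"
proof -
  let ?Z = "gmult2 (free_par M) M N (Rcoeff M N 1 p) (L1 s r)"
  have R0: "Rcoeff M N 1 p i j k l = 0" if "\<not> (j = i \<and> l = k)" "\<not> (j = k \<and> l = i)" for j l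
    using that R_ser_off[of i j k l M N] by (auto simp: Rcoeff_def fscal_def)
  note Z = gmult2_R_left[where X = "Rcoeff M N 1 p", OF ix(1,2) R0]
  have "gmult2 (free_par M) M N ?Z (L2 t r') i m k n
    = (\<Sum>j\<in>{1..M+N}. \<Sum>l\<in>{1..M+N}. (- 1) ^ ((par M k + par M l) * (par M j + par M m)) * ?Z i j k l *
        (free_par M ^^ (par M i + par M j + par M k + par M l)) (L2 t r' j m l n))"
    by (simp add: gmult2_def)
  also have "\<dots> = ?Z i m k k * (free_par M ^^ (par M i + par M m + par M k + par M k)) (L2 t r' m m k n)
     + (if m = m \<and> k = i then 0 else ?Z i m k i * (free_par M ^^ (par M i + par M m + par M k + par M i)) (L2 t r' m m i n))"
  \<comment> \<open>\<open>L2\<close> forces \<open>j = m\<close>. \<open>L1\<close> keeps the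
    second index that R leaves, which is \<open>k\<close> or \<open>i\<close>.\<close>
  proof (subst sum_two_points[of _ m k m i])
    fix j l assume jl: "\<not> (j = m \<and> l = k)" "\<not> (j = m \<and> l = i)"
    have "?Z i j k l = 0 \<or> L2 t r' j m l n = 0"
      using jl by (cases "j = m") (auto simp: Z L1_zero L2_zero)
    then show "(- 1) ^ ((par M k + par M l) * (par M j + par M m)) * ?Z i j k l *
        (free_par M ^^ (par M i + par M j + par M k + par M l)) (L2 t r' j m l n) = 0"
      by (auto simp: free_par_pow_0)
  qed (use ix in \<open>auto simp: sign_fsc simp flip: mult_2\<close>)
  finally have 1: "gmult2 (free_par M) M N ?Z (L2 t r') i m k n =
     ?Z i m k k * (free_par M ^^ (par M i + par M m + par M k + par M k)) (fgen (Lgen t r' k n))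
     + (if k = i then 0 else ?Z i m k i * (free_par M ^^ (par M i + par M m + par M k + par M i)) (fgen (Lgen t r' i n)))"
    by (simp add: L2_def)
  have s1: "(-1::Cq) ^ ((par M i + par M m + par M k + par M k) * (par M k + par M n))
    = (-1) ^ ((par M i + par M m) * (par M k + par M n))"
    by (rule sign_parity) auto
  have s2: "(-1::Cq) ^ ((par M k + par M i) * (par M k + par M m)) * (-1) ^ ((par M i + par M m + par M k + par M i) * (par M i + par M n))
    = (-1) ^ ((par M k + par M m) * (par M k + par M n))"
    unfolding power_add[symmetric] by (rule sign_parity) auto
  have Zk: "?Z i m k k = fsc (fps_nth (R_ser M N i i k k) p) (fgen (Lgen s r i m))"
    by (auto simp: Z L1_def Rcoeff_def fsc_def)
  show ?thesis
  proof (cases "i = k")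
    case True
    then show ?thesis unfolding 1 free_par_pow_gen Zk s1 by (simp add: mult.commute)
  next
    case False
    define c where "c = (-1::Cq) ^ ((par M k + par M i) * (par M k + par M m))"
    define d where "d = (-1::Cq) ^ ((par M i + par M m + par M k + par M i) * (par M i + par M n))"
    have Zi: "?Z i m k i = fsc (c * fps_nth (R_ser M N i k k i) p) (fgen (Lgen s r k m))"
      using False by (simp add: Z L1_def Rcoeff_def c_def) (simp add: fsc_def fscal_mult mult.assoc)
    show ?thesis using False unfolding 1 free_par_pow_gen Zk Zi s1 s2[symmetric] d_def[symmetric] c_def[symmetric]
      by (simp add: mult_ac)
  qed
qed

lemma RLL_right:
  assumes ix: "i \<in> {1..M+N}" "k \<in> {1..M+N}" "m \<in> {1..M+N}" "n \<in> {1..M+N}"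
  shows "gmult2 (free_par M) M N (gmult2 (free_par M) M N (L2 t r') (L1 s r)) (Rcoeff M N 1 p) i m k n =
    fsc (fps_nth (R_ser M N m m n n) p) (fgen (Lgen t r' k n) * fgen (Lgen s r i m))
    + fsc (if m = n then 0 else (-1) ^ ((par M k + par M m) * (par M n + par M m)) * fps_nth (R_ser M N n m m n) p)
      (fgen (Lgen t r' k m) * fgen (Lgen s r i n))"
proof -
  let ?Z = "gmult2 (free_par M) M N (L2 t r') (L1 s r)"
  have R0: "Rcoeff M N 1 p j m l n = 0" if "\<not> (j = m \<and> l = n)" "\<not> (j = n \<and> l = m)" for j l
    using that R_ser_off[of j m l n M N] by (auto simp: Rcoeff_def fscal_def)
  have par: "free_par M (Rcoeff M N 1 p j m l n) = Rcoeff M N 1 p j m l n" for j l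
    by (simp add: Rcoeff_def free_par_scal)
  have Z: "?Z i a k b = fgen (Lgen t r' k b) * fgen (Lgen s r i a)" if "b \<in> {1..M+N}" for a b
  proof -
    have s: "(-1::Cq) ^ ((par M k + par M b) * (par M i + par M a)) * (-1) ^ ((par M i + par M i + par M k + par M b) * (par M i + par M a)) = 1"
      unfolding power_add[symmetric] by (rule neg_one_even_power) auto
    have "?Z i a k b = fsc ((-1) ^ ((par M k + par M b) * (par M i + par M a))) (fgen (Lgen t r' k b) *
       (free_par M ^^ (par M i + par M i + par M k + par M b)) (fgen (Lgen s r i a)))"
      unfolding gmult2_def
      by (subst sum_two_points[of _ i b i b])
        (use ix that in \<open>auto simp: L1_def L2_def sign_fsc free_par_pow_0 mult.assoc\<close>)
    then show ?thesis by (simp only: free_par_pow_gen fsc.sc_mult_right fsc.sc_sc s fsc.sc_1)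
  qed
  have R: "x * Rcoeff M N 1 p a b c d = fsc (fps_nth (R_ser M N a b c d) p) x" for x a b c d
    by (simp add: Rcoeff_def fsc_def fscal_commute[of x])
  have "gmult2 (free_par M) M N ?Z (Rcoeff M N 1 p) i m k n = ?Z i m k n * Rcoeff M N 1 p m m n n
    + (if m = n then 0 else fsc ((-1) ^ ((par M k + par M m) * (par M n + par M m))) (?Z i n k m * Rcoeff M N 1 p n m m n))"
    using ix by (intro gmult2_R_right R0 par) auto
  then show ?thesis using ix by (simp add: Z R)
qed

section \<open>Passage to the quotient algebra\<close>

lemma abs_Uq_sum: "abs_Uq (sum f A) = (\<Sum>x\<in>A. abs_Uq (f x) :: ('m::len0, 'n::len0) Uq)"
  by (induction A rule: infinite_finite_induct)
    (simp_all add: zero_Uq.abs_eq[symmetric] plus_Uq.abs_eq[symmetric])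

lemma abs_Uq_rels:
  assumes "x \<in> rels LENGTH('m::len0) LENGTH('n::len0)"
  shows "(abs_Uq x :: ('m, 'n) Uq) = 0"
  using two_sided_base[OF assms] by (simp add: zero_Uq.abs_eq Uq.abs_eq_iff)

definition usc :: "Cq \<Rightarrow> ('m::len0, 'n::len0) Uq \<Rightarrow> ('m, 'n) Uq" where
  "usc a x = scal a * x"

lemma abs_Uq_fsc: "(abs_Uq (fsc a x) :: ('m::len0, 'n::len0) Uq) = usc a (abs_Uq x)"
  by (simp add: fsc_def usc_def times_Uq.abs_eq[symmetric] scal.abs_eq)

lemma scal_add: "(scal (a + b) :: ('m::len0, 'n::len0) Uq) = scal a + scal b"
  by (simp add: scal.abs_eq fscal_add plus_Uq.abs_eq)

lemma scal_mult: "(scal (a * b) :: ('m::len0, 'n::len0) Uq) = scal a * scal b"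
  by (simp add: scal.abs_eq fscal_mult times_Uq.abs_eq)

lemma scal_1: "(scal 1 :: ('m::len0, 'n::len0) Uq) = 1"
  by (simp add: scal.abs_eq fscal_1 one_Uq.abs_eq)

lemma scal_commute: "x * scal a = scal a * (x :: ('m::len0, 'n::len0) Uq)"
  by (induction x rule: Uq.abs_induct) (simp add: scal.abs_eq times_Uq.abs_eq fscal_commute)

interpretation usc: scaled_ring "usc :: Cq \<Rightarrow> ('m::len0, 'n::len0) Uq \<Rightarrow> ('m, 'n) Uq"
  by standard (simp_all add: usc_def scal_add scal_mult scal_1 algebra_simps,
    metis scal_commute mult.assoc)

lemma scal_0 [simp]: "(scal 0 :: ('m::len0, 'n::len0) Uq) = 0"
  using scal_add[of 0 0, where 'm = 'm and 'n = 'n] by simp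

definition Sfps :: "Cq fps \<Rightarrow> ('m::len0, 'n::len0) Uq fps" where
  "Sfps f = Abs_fps (\<lambda>k. scal (fps_nth f k))"

lemma scal_sum: "(scal (sum f A) :: ('m::len0, 'n::len0) Uq) = (\<Sum>x\<in>A. scal (f x))"
  by (induction A rule: infinite_finite_induct) (simp_all add: scal_add)

lemma Sfps_mult: "(Sfps (f * g) :: ('m::len0, 'n::len0) Uq fps) = Sfps f * Sfps g"
  by (rule fps_ext) (simp add: Sfps_def fps_mult_nth scal_sum scal_mult)

lemma Sfps_1: "(Sfps 1 :: ('m::len0, 'n::len0) Uq fps) = 1"
  by (rule fps_ext) (simp add: Sfps_def scal_1)

text \<open>For a fixed total degree \<open>d\<close> both signs lead to series in \<open>X = w / z\<close>: \<open>diag_coeff s d B\<close> lists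
  the coefficients \<open>B r r'\<close>, \<open>r + r' = d\<close>, of \<open>z\<^sup>\<mp>\<^sup>r w\<^sup>\<mp>\<^sup>r'\<close> by the power of \<open>X\<close>.\<close>

definition diag_coeff :: "pm \<Rightarrow> nat \<Rightarrow> (nat \<Rightarrow> nat \<Rightarrow> 'a::zero) \<Rightarrow> nat \<Rightarrow> 'a" where
  "diag_coeff s d B t = (if t \<le> d then (case s of Pos \<Rightarrow> B t (d - t) | Neg \<Rightarrow> B (d - t) t) else 0)"

text \<open>The exponents \<open>a\<close> and \<open>b\<close> belong to total degree
  \<open>d\<close> and the power \<open>t\<close> of X, of which R contributes \<open>p\<close> and
  the two factors L the rest.\<close>

lemma rll_exps_sum:
  fixes h :: "nat \<Rightarrow> nat \<Rightarrow> nat \<Rightarrow> 'a::comm_monoid_add"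
  defines "a \<equiv> \<lambda>s d t. case s of Pos \<Rightarrow> - int t | Neg \<Rightarrow> int d - int t"
    and "b \<equiv> \<lambda>s d t. case s of Pos \<Rightarrow> int t - int d | Neg \<Rightarrow> int t"
  shows "(\<Sum>(p, r, r')\<in>rll_exps s s (a s d t) (b s d t). h p r r')
    = (\<Sum>p\<le>t. diag_coeff s d (h p) (t - p))"
proof -
  let ?P = "{p. p \<le> t \<and> t - p \<le> d}"
  let ?f = "\<lambda>p. case s of Pos \<Rightarrow> (p, t - p, d - (t - p)) | Neg \<Rightarrow> (p, d - (t - p), t - p)"
  define S where "S = rll_exps s s (a s d t) (b s d t)"
  have mem: "(p, r, r') \<in> S \<longleftrightarrow> p \<le> t \<and> t - p \<le> d \<and>
      (case s of Pos \<Rightarrow> r = t - p \<and> r' = d - (t - p) | Neg \<Rightarrow> r = d - (t - p) \<and> r' = t - p)" for p r r'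
    by (cases s; simp add: S_def rll_exps_def a_def b_def; presburger)
  have "(\<Sum>(p, r, r')\<in>S. h p r r') = (\<Sum>p\<in>?P. diag_coeff s d (h p) (t - p))"
    by (rule sum.reindex_bij_witness[of _ ?f fst])
      (auto simp: mem diag_coeff_def split: pm.splits)
  also have "\<dots> = (\<Sum>p\<le>t. diag_coeff s d (h p) (t - p))"
    by (rule sum.mono_neutral_left) (auto simp: diag_coeff_def)
  finally show ?thesis unfolding S_def .
qed

text \<open>The scalar prefactor \<open>g\<close> of the R-matrix is invertible and cancels; the remaining relation is a
  polynomial in \<open>X\<close> in each degree, so that \<open>X\<close> can be set to the scalar \<open>x\<close>.\<close>

lemma specialize:
  fixes B :: "'i \<Rightarrow> nat \<Rightarrow> nat \<Rightarrow> ('m::len0, 'n::len0) Uq" and A :: "'i \<Rightarrow> Cq fps"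
  assumes "finite I" and g: "fps_nth g 0 \<noteq> 0"
    and lin: "\<And>\<iota> k. \<iota> \<in> I \<Longrightarrow> 2 \<le> k \<Longrightarrow> fps_nth (A \<iota>) k = 0"
    and rel: "\<And>a b. (\<Sum>(p, r, r')\<in>rll_exps s s a b. \<Sum>\<iota>\<in>I. usc (fps_nth (g * A \<iota>) p) (B \<iota> r r')) = 0"
  shows "(\<Sum>\<iota>\<in>I. usc (fps_nth (A \<iota>) 0 + x * fps_nth (A \<iota>) 1) (\<Sum>t\<le>d. usc (x ^ t) (diag_coeff s d (B \<iota>) t))) = 0"
proof -
  define T where "T \<iota> = Abs_fps (diag_coeff s d (B \<iota>))" for \<iota>
  have sum_dc: "diag_coeff s d (\<lambda>r r'. \<Sum>\<iota>\<in>I. usc (c \<iota>) (B \<iota> r r')) t = (\<Sum>\<iota>\<in>I. usc (c \<iota>) (diag_coeff s d (B \<iota>) t))" for c t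
    by (simp add: diag_coeff_def split: pm.splits)
  have "(\<Sum>\<iota>\<in>I. Sfps (g * A \<iota>) * T \<iota>) = 0"
  proof (rule fps_ext)
    fix t
    have "fps_nth (\<Sum>\<iota>\<in>I. Sfps (g * A \<iota>) * T \<iota>) t
      = (\<Sum>p\<le>t. \<Sum>\<iota>\<in>I. usc (fps_nth (g * A \<iota>) p) (diag_coeff s d (B \<iota>) (t - p)))"
      by (subst sum.swap) (simp add: fps_sum_nth fps_mult_nth Sfps_def T_def usc_def atLeast0AtMost)
    also have "\<dots> = 0"
      unfolding sum_dc[symmetric] rll_exps_sum[symmetric] by (rule rel)
    finally show "fps_nth (\<Sum>\<iota>\<in>I. Sfps (g * A \<iota>) * T \<iota>) t = fps_nth 0 t" by simp
  qed
  then have "Sfps (inverse g) * (Sfps g * (\<Sum>\<iota>\<in>I. Sfps (A \<iota>) * T \<iota>)) = 0"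
    by (simp add: Sfps_mult sum_distrib_left mult.assoc)
  then have "(\<Sum>\<iota>\<in>I. Sfps (A \<iota>) * T \<iota>) = 0"
    by (simp add: mult.assoc[symmetric] Sfps_mult[symmetric] inverse_mult_eq_1[OF g] Sfps_1)
  then have c: "(\<Sum>\<iota>\<in>I. fps_nth (Sfps (A \<iota>) * T \<iota>) t) = 0" for t
    by (metis fps_sum_nth fps_zero_nth)
  have nth: "fps_nth (Sfps (A \<iota>) * T \<iota>) t = usc (fps_nth (A \<iota>) 0) (diag_coeff s d (B \<iota>) t)
     + (case t of 0 \<Rightarrow> 0 | Suc u \<Rightarrow> usc (fps_nth (A \<iota>) 1) (diag_coeff s d (B \<iota>) u))" if "\<iota> \<in> I" for \<iota> t
  proof -
    have "fps_nth (Sfps (A \<iota>) * T \<iota>) t = (\<Sum>i\<le>t. usc (fps_nth (A \<iota>) i) (diag_coeff s d (B \<iota>) (t - i)))"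
      by (simp add: fps_mult_nth Sfps_def T_def usc_def atLeast0AtMost)
    also have "\<dots> = (\<Sum>i\<in>{..t} \<inter> {..1}. usc (fps_nth (A \<iota>) i) (diag_coeff s d (B \<iota>) (t - i)))"
    proof (intro sum.mono_neutral_right ballI)
      fix i assume "i \<in> {..t} - {..t} \<inter> {..1}"
      then have "2 \<le> i" by auto
      then show "usc (fps_nth (A \<iota>) i) (diag_coeff s d (B \<iota>) (t - i)) = 0" using lin[OF that, of i] by simp
    qed auto
    also have "\<dots> = usc (fps_nth (A \<iota>) 0) (diag_coeff s d (B \<iota>) t)
     + (case t of 0 \<Rightarrow> 0 | Suc u \<Rightarrow> usc (fps_nth (A \<iota>) 1) (diag_coeff s d (B \<iota>) u))"
    proof (cases t)
      case (Suc u)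
      then have "{..t} \<inter> {..1} = {0, 1}" by auto
      then show ?thesis using Suc by simp
    qed simp
    finally show ?thesis .
  qed
  \<comment> \<open>Weighting by \<open>x ^ t\<close> and summing evaluates at X = x.
    \<open>Suc d\<close> is the full degree: \<open>d\<close> from the products of generators and
    one from the linear \<open>A\<close>.\<close>
  have "0 = (\<Sum>t\<le>Suc d. usc (x ^ t) (\<Sum>\<iota>\<in>I. fps_nth (Sfps (A \<iota>) * T \<iota>) t))"
    by (simp only: c usc.sc_0_right sum.neutral_const)
  also have "\<dots> = (\<Sum>\<iota>\<in>I. \<Sum>t\<le>Suc d. usc (x ^ t) (fps_nth (Sfps (A \<iota>) * T \<iota>) t))"
    by (subst sum.swap) (simp only: usc.sc_sum_right)
  also have "\<dots> = (\<Sum>\<iota>\<in>I. usc (fps_nth (A \<iota>) 0 + x * fps_nth (A \<iota>) 1) (\<Sum>t\<le>d. usc (x ^ t) (diag_coeff s d (B \<iota>) t)))"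
  proof (intro sum.cong refl)
    fix \<iota> assume \<iota>: "\<iota> \<in> I"
    have "(\<Sum>t\<le>Suc d. usc (x ^ t) (fps_nth (Sfps (A \<iota>) * T \<iota>) t))
      = (\<Sum>t\<le>Suc d. usc (x ^ t) (usc (fps_nth (A \<iota>) 0) (diag_coeff s d (B \<iota>) t)))
       + (\<Sum>t\<le>Suc d. usc (x ^ t) (case t of 0 \<Rightarrow> 0 | Suc u \<Rightarrow> usc (fps_nth (A \<iota>) 1) (diag_coeff s d (B \<iota>) u)))"
      by (simp only: nth[OF \<iota>] usc.sc_add_right sum.distrib)
    also have "(\<Sum>t\<le>Suc d. usc (x ^ t) (usc (fps_nth (A \<iota>) 0) (diag_coeff s d (B \<iota>) t)))
      = usc (fps_nth (A \<iota>) 0) (\<Sum>t\<le>d. usc (x ^ t) (diag_coeff s d (B \<iota>) t))"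
      by (simp add: diag_coeff_def usc.sc_sum_right mult.commute)
    also have "(\<Sum>t\<le>Suc d. usc (x ^ t) (case t of 0 \<Rightarrow> 0 | Suc u \<Rightarrow> usc (fps_nth (A \<iota>) 1) (diag_coeff s d (B \<iota>) u)))
      = usc (x * fps_nth (A \<iota>) 1) (\<Sum>t\<le>d. usc (x ^ t) (diag_coeff s d (B \<iota>) t))"
      by (subst sum.atMost_Suc_shift) (simp add: usc.sc_sum_right mult_ac)
    finally show "(\<Sum>t\<le>Suc d. usc (x ^ t) (fps_nth (Sfps (A \<iota>) * T \<iota>) t)) =
       usc (fps_nth (A \<iota>) 0 + x * fps_nth (A \<iota>) 1) (\<Sum>t\<le>d. usc (x ^ t) (diag_coeff s d (B \<iota>) t))"
      by (simp add: usc.sc_add_left)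
  qed
  finally show ?thesis by simp
qed

section \<open>Series over the algebra at arguments z q^e\<close>

definition psc :: "Cq \<Rightarrow> ('m::len0, 'n::len0) Uq fps \<Rightarrow> ('m, 'n) Uq fps" where
  "psc a F = Abs_fps (\<lambda>r. usc a (fps_nth F r))"

lemma psc_nth [simp]: "fps_nth (psc a F) r = usc a (fps_nth F r)"
  by (simp add: psc_def)

interpretation psc: scaled_ring "psc :: Cq \<Rightarrow> ('m::len0, 'n::len0) Uq fps \<Rightarrow> ('m, 'n) Uq fps"
proof
  fix a :: Cq and F G :: "('m, 'n) Uq fps"
  show "psc a F * G = psc a (F * G)" by (rule fps_ext) (simp add: fps_mult_nth usc.sc_sum_right)
  show "F * psc a G = psc a (F * G)" by (rule fps_ext) (simp add: fps_mult_nth usc.sc_sum_right)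
qed (auto intro!: fps_ext simp: usc.sc_add_right usc.sc_add_left)

lemma psc_const: "fps_const (scal a) * F = psc a F"
  by (rule fps_ext) (simp add: usc_def)

lemma qshift_nth [simp]: "fps_nth (qshift s e F) r = usc (qq powi (zexp s * int r * e)) (fps_nth F r)"
  by (simp add: qshift_def usc_def)

definition lq :: "pm \<Rightarrow> int \<Rightarrow> nat \<Rightarrow> nat \<Rightarrow> ('m::len0, 'n::len0) Uq fps" where
  "lq s e i j = qshift s e (Lser s i j)"

definition diag_scale :: "pm \<Rightarrow> nat \<Rightarrow> int \<Rightarrow> int \<Rightarrow> Cq" where
  "diag_scale s d e f = (case s of Pos \<Rightarrow> qq powi (- (int d * f)) | Neg \<Rightarrow> qq powi (int d * e))"

text \<open>In degree \<open>d\<close> of the single variable z, taking the arguments z q^e and z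
  q^f amounts to evaluation at X = q^(f - e), up to one power of q common to all terms.\<close>

lemma diag_coeff_qshift:
  fixes B :: "nat \<Rightarrow> nat \<Rightarrow> ('m::len0, 'n::len0) Uq"
  shows "(\<Sum>r\<le>d. usc (qq powi (zexp s * int r * e) * qq powi (zexp s * int (d - r) * f)) (B r (d - r)))
    = usc (diag_scale s d e f) (\<Sum>t\<le>d. usc ((qq powi (f - e)) ^ t) (diag_coeff s d B t))"
proof -
  have pw: "(qq powi (f - e)) ^ t = qq powi ((f - e) * int t)" for t
    by (simp add: power_int_mult)
  show ?thesis
  proof (cases s)
    case Pos
    show ?thesis unfolding Pos diag_scale_def usc.sc_sum_right
    proof (rule sum.cong)
      fix t assume t: "t \<in> {..d}"
      have "- (int d * f) + (f - e) * int t = zexp Pos * int t * e + zexp Pos * int (d - t) * f"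
        using t by (simp add: algebra_simps of_nat_diff)
      then have eq: "qq powi (zexp Pos * int t * e) * qq powi (zexp Pos * int (d - t) * f)
        = qq powi (- (int d * f)) * qq powi ((f - e) * int t)"
        using qq_0 by (simp flip: power_int_add)
      then show "usc (qq powi (zexp Pos * int t * e) * qq powi (zexp Pos * int (d - t) * f)) (B t (d - t))
        = usc (case Pos of Pos \<Rightarrow> qq powi (- (int d * f)) | Neg \<Rightarrow> qq powi (int d * e))
           (usc ((qq powi (f - e)) ^ t) (diag_coeff Pos d B t))"
        unfolding eq using t by (simp add: pw diag_coeff_def)
    qed simp
  next
    case Neg
    show ?thesis unfolding Neg diag_scale_def usc.sc_sum_right
    proof (rule sum.reindex_bij_witness[of _ "\<lambda>t. d - t" "\<lambda>t. d - t"])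
      fix r assume r: "r \<in> {..d}"
      have "int d * e + (f - e) * int (d - r) = zexp Neg * int r * e + zexp Neg * int (d - r) * f"
        using r by (simp add: algebra_simps of_nat_diff)
      then have eq: "qq powi (zexp Neg * int r * e) * qq powi (zexp Neg * int (d - r) * f)
        = qq powi (int d * e) * qq powi ((f - e) * int (d - r))"
        using qq_0 by (simp flip: power_int_add)
      then show "usc (case Neg of Pos \<Rightarrow> qq powi (- (int d * f)) | Neg \<Rightarrow> qq powi (int d * e))
           (usc ((qq powi (f - e)) ^ (d - r)) (diag_coeff Neg d B (d - r)))
        = usc (qq powi (zexp Neg * int r * e) * qq powi (zexp Neg * int (d - r) * f)) (B r (d - r))"
        unfolding eq using r by (simp add: pw diag_coeff_def)
    qed auto
  qed
qed

lemma lq_lq_nth: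
  shows "fps_nth (lq s e i m * lq s f k j :: ('m::len0, 'n::len0) Uq fps) d
      = usc (diag_scale s d e f) (\<Sum>t\<le>d. usc ((qq powi (f - e)) ^ t) (diag_coeff s d (\<lambda>r r'. lgen s r i m * lgen s r' k j) t))"
    and "fps_nth (lq s f k j * lq s e i m :: ('m::len0, 'n::len0) Uq fps) d
      = usc (diag_scale s d e f) (\<Sum>t\<le>d. usc ((qq powi (f - e)) ^ t) (diag_coeff s d (\<lambda>r r'. lgen s r' k j * lgen s r i m) t))"
proof -
  show "fps_nth (lq s e i m * lq s f k j :: ('m, 'n) Uq fps) d
      = usc (diag_scale s d e f) (\<Sum>t\<le>d. usc ((qq powi (f - e)) ^ t) (diag_coeff s d (\<lambda>r r'. lgen s r i m * lgen s r' k j) t))"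
    unfolding diag_coeff_qshift[symmetric]
    by (simp add: fps_mult_nth lq_def Lser_def atLeast0AtMost mult.commute)
  show "fps_nth (lq s f k j * lq s e i m :: ('m, 'n) Uq fps) d
      = usc (diag_scale s d e f) (\<Sum>t\<le>d. usc ((qq powi (f - e)) ^ t) (diag_coeff s d (\<lambda>r r'. lgen s r' k j * lgen s r i m) t))"
    unfolding diag_coeff_qshift[symmetric]
    by (simp add: fps_mult_nth lq_def Lser_def atLeast0AtMost mult.commute)
      (rule sum.reindex_bij_witness[of _ "\<lambda>t. d - t" "\<lambda>t. d - t"]; simp add: mult.commute)
qed

definition aq :: "nat \<Rightarrow> nat \<Rightarrow> nat \<Rightarrow> Cq \<Rightarrow> Cq" where
  "aq M i k t = (if i = k then qi M i - t * inverse (qi M i) else 1 - t)"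

definition cq :: "nat \<Rightarrow> nat \<Rightarrow> nat \<Rightarrow> Cq \<Rightarrow> Cq" where
  "cq M i k t = (if i = k then 0 else (if i < k then 1 else t) * (qi M k - inverse (qi M k)))"

lemma Rmat_diag:
  "fps_nth (Rmat M 1 fps_X i i k k) 0 + t * fps_nth (Rmat M 1 fps_X i i k k) 1 = aq M i k t"
  "2 \<le> n \<Longrightarrow> fps_nth (Rmat M 1 fps_X i i k k) n = 0"
  by (simp_all add: Rmat_def aq_def fps_X_nth)

lemma Rmat_swap:
  "i \<noteq> k \<Longrightarrow> fps_nth (Rmat M 1 fps_X i k k i) 0 + t * fps_nth (Rmat M 1 fps_X i k k i) 1 = cq M i k t"
  "i \<noteq> k \<Longrightarrow> 2 \<le> n \<Longrightarrow> fps_nth (Rmat M 1 fps_X i k k i) n = 0"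
  by (simp_all add: Rmat_def cq_def fps_X_nth)

lemma RLL_lq:
  fixes s :: pm
  defines "M \<equiv> LENGTH('m::len0)" and "N \<equiv> LENGTH('n::len0)"
  assumes MN: "M \<noteq> N"
    and ix: "i \<in> {1..M+N}" "k \<in> {1..M+N}" "m \<in> {1..M+N}" "j \<in> {1..M+N}"
    and t: "t = qq powi (f - e)"
  shows "psc ((-1) ^ ((par M i + par M m) * (par M k + par M j)) * aq M i k t)
      (lq s e i m * lq s f k j :: ('m, 'n) Uq fps)
    + psc ((-1) ^ ((par M k + par M m) * (par M k + par M j)) * cq M i k t) (lq s e k m * lq s f i j)
    = psc (aq M m j t) (lq s f k j * lq s e i m)
    + psc ((-1) ^ ((par M k + par M m) * (par M j + par M m)) * cq M j m t) (lq s f k m * lq s e i j)"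
proof (rule fps_ext)
  fix d
  define g where "g = f_ser M N * inverse (fps_const qq - fps_const (inverse qq) * fps_X)"
  define c1 where "c1 = (-1 :: Cq) ^ ((par M i + par M m) * (par M k + par M j))"
  define c2 where "c2 = (-1 :: Cq) ^ ((par M k + par M m) * (par M k + par M j))"
  define c4 where "c4 = (-1 :: Cq) ^ ((par M k + par M m) * (par M j + par M m))"
  \<comment> \<open>The four terms of the relation, those of the right side negated, without the
    common factor \<open>g\<close> of R. This is the form that \<open>specialize\<close>
    expects.\<close>
  define A :: "nat \<Rightarrow> Cq fps" where "A = (!)
    [fps_const c1 * Rmat M 1 fps_X i i k k, if i = k then 0 else fps_const c2 * Rmat M 1 fps_X i k k i,
     - Rmat M 1 fps_X m m j j, if m = j then 0 else - (fps_const c4 * Rmat M 1 fps_X j m m j)]"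
  define B :: "nat \<Rightarrow> nat \<Rightarrow> nat \<Rightarrow> ('m, 'n) Uq" where "B = (!)
    [\<lambda>r r'. lgen s r i m * lgen s r' k j, \<lambda>r r'. lgen s r k m * lgen s r' i j,
     \<lambda>r r'. lgen s r' k j * lgen s r i m, \<lambda>r r'. lgen s r' k m * lgen s r i j]"
  let ?I = "{0, 1, 2, 3} :: nat set"
  have g0: "fps_nth g 0 \<noteq> 0"
    using f_ser_0[OF MN] qq_0 by (simp add: g_def)
  have R: "R_ser M N a b c d = g * Rmat M 1 fps_X a b c d" for a b c d
    by (simp add: R_ser_def g_def mult_ac)
  have nth_const: "fps_nth (g * (fps_const c * F)) p = c * fps_nth (g * F) p" for c p and F :: "Cq fps"
    by (simp add: mult.left_commute[of g])
  have lin: "fps_nth (A \<iota>) n = 0" if "\<iota> \<in> ?I" "2 \<le> n" for \<iota> n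
    using that by (auto simp: A_def Rmat_diag Rmat_swap numeral_2_eq_2 numeral_3_eq_3)
  have rel: "(\<Sum>(p, r, r')\<in>rll_exps s s a b. \<Sum>\<iota>\<in>?I. usc (fps_nth (g * A \<iota>) p) (B \<iota> r r')) = 0" for a b
  proof -
    have "0 = (abs_Uq (rll M N s s 1 1 a b i m k j) :: ('m, 'n) Uq)"
      using abs_Uq_rels[OF RLL_same] ix by (simp add: M_def N_def)
    also have "\<dots> = (\<Sum>(p, r, r')\<in>rll_exps s s a b. \<Sum>\<iota>\<in>?I. usc (fps_nth (g * A \<iota>) p) (B \<iota> r r'))"
      unfolding rll_def Let_def minus_Uq.abs_eq[symmetric] abs_Uq_sum case_prod_unfold sum_subtractf[symmetric]
        RLL_left[OF ix(1,2,3,4)] RLL_right[OF ix(1,2,3,4)] c1_def[symmetric] c2_def[symmetric] c4_def[symmetric]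
      by (intro sum.cong refl)
        (simp add: A_def B_def plus_Uq.abs_eq[symmetric] times_Uq.abs_eq[symmetric] abs_Uq_fsc lgen.abs_eq[symmetric]
          R nth_const numeral_2_eq_2 numeral_3_eq_3)
    finally show ?thesis by simp
  qed
  have "(\<Sum>\<iota>\<in>?I. usc (fps_nth (A \<iota>) 0 + t * fps_nth (A \<iota>) 1) (\<Sum>u\<le>d. usc (t ^ u) (diag_coeff s d (B \<iota>) u))) = 0"
    by (rule specialize[OF _ g0 lin rel]) auto
  moreover have "(\<Sum>\<iota>\<in>?I. usc (P \<iota>) (usc c (W \<iota>))) = usc c (\<Sum>\<iota>\<in>?I. usc (P \<iota>) (W \<iota>))"
    for P c and W :: "nat \<Rightarrow> ('m, 'n) Uq"
    by (simp only: usc.sc_sum_right usc.sc_sc mult.commute)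
  ultimately have 0: "(\<Sum>\<iota>\<in>?I. usc (fps_nth (A \<iota>) 0 + t * fps_nth (A \<iota>) 1)
      (usc (diag_scale s d e f) (\<Sum>u\<le>d. usc (t ^ u) (diag_coeff s d (B \<iota>) u)))) = 0"
    by (simp only: usc.sc_0_right)
  have ev: "fps_nth (fps_const c * F) 0 + t * fps_nth (fps_const c * F) 1 = c * (fps_nth F 0 + t * fps_nth F 1)" for c and F :: "Cq fps"
    by (simp add: algebra_simps)
  have ev2: "fps_nth (- F) 0 + t * fps_nth (- F) 1 = - (fps_nth F 0 + t * fps_nth F 1)" for F :: "Cq fps"
    by (simp add: algebra_simps)
  have A: "A 0 = fps_const c1 * Rmat M 1 fps_X i i k k"
    "A 1 = (if i = k then 0 else fps_const c2 * Rmat M 1 fps_X i k k i)"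
    "A 2 = - Rmat M 1 fps_X m m j j"
    "A 3 = (if j = m then 0 else - (fps_const c4 * Rmat M 1 fps_X j m m j))"
    by (auto simp: A_def numeral_2_eq_2 numeral_3_eq_3)
  have e0: "fps_nth (A 0) 0 + t * fps_nth (A 0) 1 = c1 * aq M i k t"
    unfolding A by (simp only: ev Rmat_diag)
  have e1: "fps_nth (A 1) 0 + t * fps_nth (A 1) 1 = c2 * cq M i k t"
  proof (cases "i = k")
    case False
    then show ?thesis unfolding A by (simp only: False if_False ev Rmat_swap(1)[OF False])
  next
    case True
    then show ?thesis unfolding A by (simp add: cq_def)
  qed
  have e2: "fps_nth (A 2) 0 + t * fps_nth (A 2) 1 = - aq M m j t"
    unfolding A by (simp only: ev2 Rmat_diag)
  have e3: "fps_nth (A 3) 0 + t * fps_nth (A 3) 1 = - (c4 * cq M j m t)"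
  proof (cases "j = m")
    case False
    then show ?thesis unfolding A by (simp only: False if_False ev2 ev Rmat_swap(1)[OF False])
  next
    case True
    then show ?thesis unfolding A by (simp add: cq_def)
  qed
  have B: "B 0 = (\<lambda>r r'. lgen s r i m * lgen s r' k j)" "B 1 = (\<lambda>r r'. lgen s r k m * lgen s r' i j)"
    "B 2 = (\<lambda>r r'. lgen s r' k j * lgen s r i m)" "B 3 = (\<lambda>r r'. lgen s r' k m * lgen s r i j)"
    by (simp_all add: B_def numeral_2_eq_2 numeral_3_eq_3)
  have "usc (c1 * aq M i k t) (fps_nth (lq s e i m * lq s f k j :: ('m, 'n) Uq fps) d)
    + usc (c2 * cq M i k t) (fps_nth (lq s e k m * lq s f i j) d)
    + usc (- aq M m j t) (fps_nth (lq s f k j * lq s e i m) d)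
    + usc (- (c4 * cq M j m t)) (fps_nth (lq s f k m * lq s e i j) d) = 0"
    using 0 unfolding lq_lq_nth(1)[where e = e and f = f] lq_lq_nth(2)[where e = e and f = f] t[symmetric] B[symmetric] e0[symmetric] e1[symmetric] e2[symmetric] e3[symmetric]
    by (simp add: add.assoc)
  then show "fps_nth (psc ((-1) ^ ((par M i + par M m) * (par M k + par M j)) * aq M i k t)
      (lq s e i m * lq s f k j :: ('m, 'n) Uq fps)
    + psc ((-1) ^ ((par M k + par M m) * (par M k + par M j)) * cq M i k t) (lq s e k m * lq s f i j)) d
    = fps_nth (psc (aq M m j t) (lq s f k j * lq s e i m)
    + psc ((-1) ^ ((par M k + par M m) * (par M j + par M m)) * cq M j m t) (lq s f k m * lq s e i j)) d"
    unfolding c1_def[symmetric] c2_def[symmetric] c4_def[symmetric] by (simp add: algebra_simps)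
qed

section \<open>Inverses of blocks and the grading\<close>

lemma fps_unit:
  fixes F :: "'a::ring_1 fps"
  assumes "a * fps_nth F 0 = 1" "fps_nth F 0 * a = 1"
  obtains G where "G * F = 1" "F * G = 1"
proof -
  have l: "fps_left_inverse F a * F = 1" using assms(1) by (rule fps_left_inverse)
  have r: "F * fps_right_inverse F a = 1" using assms(2) by (rule fps_right_inverse)
  have "fps_left_inverse F a = fps_left_inverse F a * (F * fps_right_inverse F a)" by (simp add: r)
  also have "\<dots> = fps_right_inverse F a" by (simp add: mult.assoc[symmetric] l)
  finally show thesis using that[of "fps_left_inverse F a"] l r by simp
qed

definition is_inv :: "nat set \<Rightarrow> (nat \<Rightarrow> nat \<Rightarrow> 'r::ring_1) \<Rightarrow> (nat \<Rightarrow> nat \<Rightarrow> 'r) \<Rightarrow> bool" where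
  "is_inv S A B \<longleftrightarrow> (\<forall>i\<in>S. \<forall>k\<in>S. (\<Sum>j\<in>S. A i j * B j k) = (if i = k then 1 else 0)) \<and>
     (\<forall>i\<in>S. \<forall>k\<in>S. (\<Sum>j\<in>S. B i j * A j k) = (if i = k then 1 else 0))"

text \<open>Bordering by one row and one column: \<open>h\<close> inverts the Schur complement. Over
  a noncommutative ring both products with the resulting matrix have to be checked.\<close>

lemma schur_inverse:
  fixes A B :: "nat \<Rightarrow> nat \<Rightarrow> 'r::ring_1"
  assumes S: "finite S" "z \<notin> S" and B: "is_inv S A B"
    and h: "h * (A z z - (\<Sum>i\<in>S. \<Sum>j\<in>S. A z i * B i j * A j z)) = 1"
      "(A z z - (\<Sum>i\<in>S. \<Sum>j\<in>S. A z i * B i j * A j z)) * h = 1"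
  shows "\<exists>C. is_inv (insert z S) A C"
proof -
  define y where "y j = (\<Sum>i\<in>S. A z i * B i j)" for j
  define x where "x i = (\<Sum>j\<in>S. B i j * A j z)" for i
  define u where "u = A z z - (\<Sum>i\<in>S. A z i * x i)"
  have u1: "u = A z z - (\<Sum>i\<in>S. \<Sum>j\<in>S. A z i * B i j * A j z)"
    by (simp add: u_def x_def sum_distrib_left mult.assoc)
  have u2: "u = A z z - (\<Sum>j\<in>S. y j * A j z)"
    unfolding u1 y_def sum_distrib_right by (subst sum.swap) simp
  have hu: "h * u = 1" "u * h = 1" using h u1 by simp_all
  have AB: "(\<Sum>j\<in>S. A i j * B j k) = (if i = k then 1 else 0)" "(\<Sum>j\<in>S. B i j * A j k) = (if i = k then 1 else 0)"
    if "i \<in> S" "k \<in> S" for i k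
    using B that by (auto simp: is_inv_def)
  have dl: "(\<Sum>j\<in>S. (if i = j then 1 else 0) * w j) = w i" and dr: "(\<Sum>j\<in>S. w j * (if j = i then 1 else 0)) = w i"
    if "i \<in> S" for i and w :: "nat \<Rightarrow> 'r"
    using that S(1) by (simp_all add: if_distrib[of "\<lambda>c. c * _"] if_distrib[of "\<lambda>c. _ * c"] cong: if_cong)
  have Ax: "(\<Sum>j\<in>S. A i j * x j) = A i z" if "i \<in> S" for i
  proof -
    have "(\<Sum>j\<in>S. A i j * x j) = (\<Sum>k\<in>S. (\<Sum>j\<in>S. A i j * B j k) * A k z)"
      unfolding x_def sum_distrib_left sum_distrib_right by (subst sum.swap) (simp add: mult.assoc)
    also have "\<dots> = (\<Sum>k\<in>S. (if i = k then 1 else 0) * A k z)"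
      by (intro sum.cong refl) (simp add: AB that)
    finally show ?thesis using dl[OF that] by simp
  qed
  have yA: "(\<Sum>j\<in>S. y j * A j k) = A z k" if "k \<in> S" for k
  proof -
    have "(\<Sum>j\<in>S. y j * A j k) = (\<Sum>i\<in>S. A z i * (\<Sum>j\<in>S. B i j * A j k))"
      unfolding y_def sum_distrib_left sum_distrib_right by (subst sum.swap) (simp add: mult.assoc)
    also have "\<dots> = (\<Sum>i\<in>S. A z i * (if i = k then 1 else 0))"
      by (intro sum.cong refl) (simp add: AB that)
    finally show ?thesis using dr[OF that] by simp
  qed
  define C where "C i j = (if i = z then (if j = z then h else - h * y j)
    else if j = z then - x i * h else B i j + x i * h * y j)" for i j
  have Czz: "C z z = h" and Czj: "j \<in> S \<Longrightarrow> C z j = - h * y j" and Ciz: "i \<in> S \<Longrightarrow> C i z = - x i * h"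
    and Cij: "i \<in> S \<Longrightarrow> j \<in> S \<Longrightarrow> C i j = B i j + x i * h * y j" for i j
    using S(2) by (auto simp: C_def)
  have s1: "(\<Sum>j\<in>S. A i j * C j z) = - ((\<Sum>j\<in>S. A i j * x j) * h)" for i
    by (simp add: Ciz sum_distrib_right sum_negf mult.assoc)
  have s2: "(\<Sum>j\<in>S. A i j * C j k) = (\<Sum>j\<in>S. A i j * B j k) + (\<Sum>j\<in>S. A i j * x j) * h * y k" if "k \<in> S" for i k
    by (simp add: Cij that sum_distrib_right distrib_left sum.distrib mult.assoc)
  have s3: "(\<Sum>j\<in>S. C z j * A j k) = - (h * (\<Sum>j\<in>S. y j * A j k))" for k
    by (simp add: Czj sum_distrib_left sum_negf mult.assoc)
  have s4: "(\<Sum>j\<in>S. C i j * A j k) = (\<Sum>j\<in>S. B i j * A j k) + x i * h * (\<Sum>j\<in>S. y j * A j k)" if "i \<in> S" for i k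
    by (simp add: Cij that sum_distrib_left distrib_right sum.distrib mult.assoc)
  have ins: "(\<Sum>j\<in>insert z S. g j) = g z + (\<Sum>j\<in>S. g j)" for g :: "nat \<Rightarrow> 'r"
    using S by simp
  have Ax': "(\<Sum>j\<in>S. A z j * x j) = A z z - u" and yA': "(\<Sum>j\<in>S. y j * A j z) = A z z - u"
    by (simp add: u_def, simp add: u2)
  have zS: "i \<noteq> z" if "i \<in> S" for i using that S(2) by auto
  have R: "(\<Sum>j\<in>insert z S. A i j * C j k) = (if i = k then 1 else 0)"
    if "i \<in> insert z S" "k \<in> insert z S" for i k
  proof (cases "k = z")
    case True
    then show ?thesis using that zS unfolding True ins s1 Czz
      by (cases "i = z") (auto simp: Ax Ax' algebra_simps hu)
  next
    case False
    then have k: "k \<in> S" using that by simp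
    show ?thesis
    proof (cases "i = z")
      case True
      have "A z z * C z k + ((\<Sum>j\<in>S. A z j * B j k) + (A z z - u) * h * y k) = 0"
        unfolding Czj[OF k] y_def[symmetric] left_diff_distrib hu(2) by (simp add: mult.assoc)
      then show ?thesis unfolding True ins s2[OF k] Ax' using zS[OF k] by simp
    next
      case False
      then have i: "i \<in> S" using that by simp
      show ?thesis unfolding ins s2[OF k] Ax[OF i] AB(1)[OF i k] by (simp add: Czj[OF k] mult.assoc)
    qed
  qed
  have L: "(\<Sum>j\<in>insert z S. C i j * A j k) = (if i = k then 1 else 0)"
    if "i \<in> insert z S" "k \<in> insert z S" for i k
  proof (cases "i = z")
    case True
    then show ?thesis using that zS unfolding True ins s3 Czz
      by (cases "k = z") (auto simp: yA yA' algebra_simps hu)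
  next
    case False
    then have i: "i \<in> S" using that by simp
    show ?thesis
    proof (cases "k = z")
      case True
      have "C i z * A z z + ((\<Sum>j\<in>S. B i j * A j z) + x i * h * (A z z - u)) = 0"
        unfolding Ciz[OF i] x_def[symmetric] right_diff_distrib mult.assoc hu(1) by (simp add: mult.assoc)
      then show ?thesis unfolding True ins s4[OF i] yA' using zS[OF i] by simp
    next
      case False
      then have k: "k \<in> S" using that by simp
      show ?thesis unfolding ins s4[OF i] yA[OF k] AB(2)[OF i k] by (simp add: Ciz[OF i] mult.assoc)
    qed
  qed
  show ?thesis unfolding is_inv_def using L R by (intro exI[of _ C] conjI ballI)
qed

definition tsg :: "nat \<Rightarrow> nat \<Rightarrow> nat \<Rightarrow> Cq" where
  "tsg M i j = (if i \<le> M \<and> M < j then -1 else 1)"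

text \<open>The signs turn the graded matrix product \<open>mmult\<close> into the ordinary one.\<close>

definition lsg :: "pm \<Rightarrow> int \<Rightarrow> nat \<Rightarrow> nat \<Rightarrow> ('m::len0, 'n::len0) Uq fps" where
  "lsg s e i j = psc (tsg LENGTH('m) i j) (lq s e i j)"

lemma lgen_0:
  assumes "i \<in> {1..LENGTH('m::len0) + LENGTH('n::len0)}" "j \<in> {1..LENGTH('m) + LENGTH('n)}"
  shows "i < j \<Longrightarrow> (lgen Pos 0 j i :: ('m, 'n) Uq) = 0" "i < j \<Longrightarrow> (lgen Neg 0 i j :: ('m, 'n) Uq) = 0"
    "(lgen Neg 0 i i * lgen Pos 0 i i :: ('m, 'n) Uq) = 1" "(lgen Pos 0 i i * lgen Neg 0 i i :: ('m, 'n) Uq) = 1"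
proof -
  show "i < j \<Longrightarrow> (lgen Pos 0 j i :: ('m, 'n) Uq) = 0" "i < j \<Longrightarrow> (lgen Neg 0 i j :: ('m, 'n) Uq) = 0"
    using abs_Uq_rels[OF upper[of i j "LENGTH('m)" "LENGTH('n)"]] abs_Uq_rels[OF lower[of i j "LENGTH('m)" "LENGTH('n)"]] assms
    by (auto simp: lgen.abs_eq)
  show "(lgen Neg 0 i i * lgen Pos 0 i i :: ('m, 'n) Uq) = 1" "(lgen Pos 0 i i * lgen Neg 0 i i :: ('m, 'n) Uq) = 1"
    using abs_Uq_rels[OF diag1[OF assms(1)]] abs_Uq_rels[OF diag2[OF assms(1)]]
    by (auto simp: lgen.abs_eq times_Uq.abs_eq one_Uq.abs_eq minus_Uq.abs_eq[symmetric])
qed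

text \<open>The constant term of L is triangular, so the constant term of the Schur complement is
  the diagonal generator. That one is invertible, hence so is the series.\<close>

lemma block_inverse:
  assumes "r \<le> LENGTH('m::len0) + LENGTH('n::len0)"
  shows "\<exists>B. is_inv (blk r) (lsg s e :: nat \<Rightarrow> nat \<Rightarrow> ('m, 'n) Uq fps) B"
  using assms
proof (induction r)
  case 0
  then show ?case by (simp add: is_inv_def blk_def)
next
  case (Suc r)
  let ?A = "lsg s e :: nat \<Rightarrow> nat \<Rightarrow> ('m, 'n) Uq fps" and ?z = "Suc r"
  from Suc obtain B where B: "is_inv (blk r) ?A B" by auto
  let ?u = "?A ?z ?z - (\<Sum>i\<in>blk r. \<Sum>j\<in>blk r. ?A ?z i * B i j * ?A j ?z)"
  have z: "?z \<in> {1..LENGTH('m) + LENGTH('n)}" using Suc.prems by simp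
  \<comment> \<open>For \<open>Pos\<close> the constant terms below the diagonal vanish, for
    \<open>Neg\<close> those above it. Every product in the Schur complement thus has a factor
    without constant term.\<close>
  have off: "fps_nth (?A ?z i) 0 = 0 \<or> fps_nth (?A j ?z) 0 = 0" if "i \<in> blk r" "j \<in> blk r" for i j
    using that Suc.prems by (cases s) (auto simp: lsg_def lq_def Lser_def in_blk lgen_0[OF _ z] lgen_0[where i = i and j = ?z])
  have "fps_nth (\<Sum>i\<in>blk r. \<Sum>j\<in>blk r. ?A ?z i * B i j * ?A j ?z) 0 = 0"
    unfolding fps_sum_nth
  proof (intro sum.neutral ballI)
    fix i j assume "i \<in> blk r" "j \<in> blk r"
    then show "fps_nth (?A ?z i * B i j * ?A j ?z) 0 = 0" using off[of i j] by auto
  qed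
  then have u0: "fps_nth ?u 0 = lgen s 0 ?z ?z"
    by (auto simp: lsg_def lq_def Lser_def tsg_def)
  obtain a where "a * fps_nth ?u 0 = 1" "fps_nth ?u 0 * a = 1"
    unfolding u0 using lgen_0(3,4)[OF z z] by (cases s) auto
  then obtain h where "h * ?u = 1" "?u * h = 1" by (rule fps_unit)
  then show ?case using schur_inverse[OF _ _ B, of ?z h] by (simp add: blk_Suc)
qed

section \<open>Continuation from shifted to equal arguments\<close>

lemma vandermonde_zero:
  fixes w :: "nat \<Rightarrow> ('m::len0, 'n::len0) Uq"
  assumes p: "p \<noteq> 0" "\<And>i j. i \<noteq> j \<Longrightarrow> p ^ i \<noteq> p ^ j"
    and z: "\<And>d. 0 < d \<Longrightarrow> (\<Sum>i\<le>n. usc ((p ^ d) ^ i) (w i)) = 0"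
    and i: "i \<le> n"
  shows "w i = 0"
  using z i
proof (induction n arbitrary: w i)
  case 0
  then show ?case using "0.prems"(1)[of 1] by simp
next
  case (Suc n)
  let ?c = "\<lambda>i. p ^ i - p ^ Suc n"
  \<comment> \<open>The equation for \<open>Suc d\<close> minus \<open>p ^ Suc n\<close> times that
    for \<open>d\<close>: the last unknown drops out and the others acquire nonzero factors.\<close>
  have "(\<Sum>i\<le>n. usc ((p ^ d) ^ i) (usc (?c i) (w i))) = 0" if d: "0 < d" for d
  proof -
    have "(\<Sum>i\<le>n. usc ((p ^ d) ^ i) (usc (?c i) (w i))) = (\<Sum>i\<le>Suc n. usc ((p ^ d) ^ i * ?c i) (w i))"
      by simp
    also have "\<dots> = (\<Sum>i\<le>Suc n. usc ((p ^ Suc d) ^ i - p ^ Suc n * (p ^ d) ^ i) (w i))"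
      by (intro sum.cong refl) (simp add: algebra_simps power_mult_distrib)
    also have "\<dots> = (\<Sum>i\<le>Suc n. usc ((p ^ Suc d) ^ i) (w i)) - usc (p ^ Suc n) (\<Sum>i\<le>Suc n. usc ((p ^ d) ^ i) (w i))"
      by (simp only: usc.sc_diff_left sum_subtractf usc.sc_sum_right usc.sc_sc)
    also have "\<dots> = 0"
      using Suc.prems(1)[of d] Suc.prems(1)[of "Suc d"] d by (simp only: usc.sc_0_right zero_less_Suc diff_self)
    finally show ?thesis .
  qed
  then have "usc (?c i) (w i) = 0" if "i \<le> n" for i
    using Suc.IH[of "\<lambda>i. usc (?c i) (w i)" i] that by blast
  then have w: "w i = 0" if "i \<le> n" for i
    using usc.sc_eq_0[of "?c i"] p(2)[of i "Suc n"] that by auto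
  have "usc ((p ^ 1) ^ Suc n) (w (Suc n)) = 0"
    using Suc.prems(1)[of 1] by (simp add: w)
  then have "w (Suc n) = 0" by (rule usc.sc_eq_0[THEN iffD1, rotated]) (use p(1) in simp)
  then show ?case using w Suc.prems(2) by (cases "i = Suc n") auto
qed

lemma qq_powi_inj: "c \<noteq> 0 \<Longrightarrow> i \<noteq> j \<Longrightarrow> (qq powi c) ^ i \<noteq> (qq powi c) ^ j"
proof
  assume c: "c \<noteq> 0" "i \<noteq> j" "(qq powi c) ^ i = (qq powi c) ^ j"
  then have "qq powi (c * int i) / qq powi (c * int j) = 1"
    using qq_0 by (simp add: power_int_mult)
  then have "qq powi (c * int i - c * int j) = 1" using qq_0 by (simp add: power_int_diff)
  then show False using qq_powi[of "c * int i - c * int j"] c(1,2) by simp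
qed

lemma qshift_add: "qshift s d (F + G) = qshift s d F + qshift s d G"
  by (rule fps_ext) (simp add: usc.sc_add_right)

lemma qshift_0: "qshift s d 0 = 0"
  by (rule fps_ext) simp

lemma qshift_sum: "qshift s d (sum f A) = (\<Sum>x\<in>A. qshift s d (f x))"
  by (induction A rule: infinite_finite_induct) (simp_all add: qshift_add qshift_0)

lemma qshift_mult: "qshift s d (F * G) = qshift s d F * qshift s d G"
proof (rule fps_ext)
  fix n
  have "qq powi (zexp s * int n * d) = qq powi (zexp s * int i * d) * qq powi (zexp s * int (n - i) * d)"
    if "i \<in> {0..n}" for i
  proof -
    have "zexp s * int n * d = zexp s * int i * d + zexp s * int (n - i) * d"
      using that by (simp add: algebra_simps of_nat_diff)
    then show ?thesis using qq_0 by (simp only: power_int_add simp_thms)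
  qed
  then show "fps_nth (qshift s d (F * G)) n = fps_nth (qshift s d F * qshift s d G) n"
    by (simp add: fps_mult_nth usc.sc_sum_right mult.commute)
qed

lemma qshift_1: "qshift s d 1 = 1"
  by (rule fps_ext) simp

lemma qshift_psc: "qshift s d (psc c F) = psc c (qshift s d F)"
  by (rule fps_ext) (simp add: mult.commute)

lemma qshift_qshift: "qshift s d (qshift s e F) = qshift s (e + d) F"
proof (rule fps_ext)
  fix n
  have "zexp s * int n * (e + d) = zexp s * int n * d + zexp s * int n * e" by (simp add: algebra_simps)
  then have "qq powi (zexp s * int n * (e + d)) = qq powi (zexp s * int n * d) * qq powi (zexp s * int n * e)"
    using qq_0 by (simp only: power_int_add simp_thms)
  then show "fps_nth (qshift s d (qshift s e F)) n = fps_nth (qshift s (e + d) F) n" by simp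
qed

lemma qshift_lsg: "qshift s d (lsg s e i j) = lsg s (e + d) i j"
  by (simp add: lsg_def lq_def qshift_psc qshift_qshift)

text \<open>In degree \<open>n\<close> the difference of the products is a polynomial in
  \<open>(qq powi zexp s) ^ d\<close> that vanishes for all \<open>d > 0\<close>. Its coefficients
  are the commutators of coefficients of F and G in complementary degrees, and these are therefore
  all zero.\<close>

lemma qshift_continuation:
  fixes F G :: "('m::len0, 'n::len0) Uq fps"
  assumes "\<And>d. d \<noteq> 0 \<Longrightarrow> qshift s d F * G = G * qshift s d F"
  shows "F * G = G * F"
proof (rule fps_ext)
  fix n
  let ?p = "qq powi zexp s"
  let ?w = "\<lambda>i. fps_nth F i * fps_nth G (n - i) - fps_nth G (n - i) * fps_nth F i"
  have z: "zexp s \<noteq> 0" by (cases s) auto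
  have GF: "fps_nth (G * H) n = (\<Sum>i\<le>n. fps_nth G (n - i) * fps_nth H i)" for H
    unfolding fps_mult_nth atLeast0AtMost
    by (rule sum.reindex_bij_witness[of _ "\<lambda>i. n - i" "\<lambda>i. n - i"]) auto
  have "(\<Sum>i\<le>n. usc ((?p ^ d) ^ i) (?w i)) = 0" if d: "0 < d" for d
  proof -
    have "(?p ^ d) ^ i = qq powi (zexp s * int i * int d)" for i
      by (simp add: power_int_mult flip: power_mult) (simp add: mult.commute power_mult)
    then have "(\<Sum>i\<le>n. usc ((?p ^ d) ^ i) (?w i)) = fps_nth (qshift s (int d) F * G) n - fps_nth (G * qshift s (int d) F) n"
      unfolding GF by (simp add: fps_mult_nth atLeast0AtMost usc.sc_diff_right sum_subtractf)
    then show ?thesis using assms[of "int d"] d by simp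
  qed
  then have "?w i = 0" if "i \<le> n" for i
    using vandermonde_zero[where p = ?p and n = n and w = ?w and i = i] qq_powi_inj[OF z] qq_0 that by auto
  then show "fps_nth (F * G) n = fps_nth (G * F) n"
    unfolding GF by (simp add: fps_mult_nth atLeast0AtMost)
qed

lemma qi_eq: "qi M i = (if i \<le> M then qq else inverse qq)"
  by (simp add: qi_def par_def power_int_minus)

lemma RLL_lsg:
  fixes s :: pm
  defines "M \<equiv> LENGTH('m::len0)" and "N \<equiv> LENGTH('n::len0)"
  defines "s2 \<equiv> \<lambda>i j. if i \<le> M \<or> j \<le> M then 1 else - 1 :: Cq"
    and "qr \<equiv> \<lambda>i. if i \<le> M then qq else inverse qq"
  defines "aa \<equiv> \<lambda>i k t. if i = k then qr i - t * inverse (qr i) else 1 - t"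
    and "cc \<equiv> \<lambda>i k t. if i = k then 0 else if i < k then qq - inverse qq else t * (qq - inverse qq)"
  assumes MN: "M \<noteq> N"
    and ix: "i \<in> blk (M + N)" "k \<in> blk (M + N)" "m \<in> blk (M + N)" "j \<in> blk (M + N)"
    and t: "t = qq powi (f - e)"
  shows "psc (s2 i k * s2 m k * s2 i m * aa i k t) (lsg s e i m * lsg s f k j)
      + psc (cc i k t) (lsg s e k m * lsg s f i j)
    = psc (s2 m j * s2 i j * s2 i m * aa m j t) (lsg s f k j * lsg s e i m)
      + psc (cc j m t) (lsg s f k m * lsg s e i j :: ('m, 'n) Uq fps)"
proof -
  let ?t = "tsg M"
  \<comment> \<open>The factor required by the third term, which carries no sign of the grading;
    \<open>e1\<close>, \<open>e2\<close> and \<open>e4\<close> confirm that it suits the other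
    terms.\<close>
  define K where "K = ?t i m * ?t k j * (s2 m j * s2 i j * s2 i m)"
  let ?l = "\<lambda>e i j. lq s e i j :: ('m, 'n) Uq fps"
  have aq: "aq M a b t = aa a b t" for a b
    by (simp add: aq_def aa_def qi_eq qr_def)
  have cq: "cq M a b t = s2 b b * cc a b t" for a b
    by (auto simp: cq_def cc_def qi_eq s2_def)
  have ixc: "i \<in> {1..M+N}" "k \<in> {1..M+N}" "m \<in> {1..M+N}" "j \<in> {1..M+N}" using ix by (simp_all add: blk_def)
  have lsg: "lsg s a b c * lsg s a' b' c' = psc (?t b c * ?t b' c') (?l a b c * ?l a' b' c')" for a b c a' b' c'
    by (simp add: lsg_def M_def mult.commute)
  have e1: "K * ((-1) ^ ((par M i + par M m) * (par M k + par M j)) * aa i k t) = s2 i k * s2 m k * s2 i m * aa i k t * (?t i m * ?t k j)"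
    by (simp add: K_def tsg_def s2_def par_def)
  have e2: "K * ((-1) ^ ((par M k + par M m) * (par M k + par M j)) * (s2 k k * cc i k t)) = cc i k t * (?t k m * ?t i j)"
    by (simp add: K_def tsg_def s2_def par_def)
  have e3: "K * aa m j t = s2 m j * s2 i j * s2 i m * aa m j t * (?t k j * ?t i m)"
    by (simp add: K_def mult_ac)
  have e4: "K * ((-1) ^ ((par M k + par M m) * (par M j + par M m)) * (s2 m m * cc j m t)) = cc j m t * (?t k m * ?t i j)"
    by (simp add: K_def tsg_def s2_def par_def)
  have "psc K (psc ((-1) ^ ((par M i + par M m) * (par M k + par M j)) * aa i k t) (?l e i m * ?l f k j)
      + psc ((-1) ^ ((par M k + par M m) * (par M k + par M j)) * (s2 k k * cc i k t)) (?l e k m * ?l f i j))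
    = psc K (psc (aa m j t) (?l f k j * ?l e i m)
      + psc ((-1) ^ ((par M k + par M m) * (par M j + par M m)) * (s2 m m * cc j m t)) (?l f k m * ?l e i j))"
    using RLL_lq[where 'm = 'm and 'n = 'n, folded M_def N_def, OF MN ixc t, where s = s] unfolding aq cq by (simp only:)
  then show ?thesis
    unfolding lsg psc.sc_add_right psc.sc_sc e1 e2 e3 e4 .
qed

section \<open>Graded inverses\<close>

lemma ser_par_nth [simp]: "fps_nth (ser_par F) r = Uq_par (fps_nth F r)"
  by (simp add: ser_par_def)

lemma Uq_par_add: "Uq_par (x + y) = Uq_par x + Uq_par (y :: ('m::len0, 'n::len0) Uq)"
  by (induction x rule: Uq.abs_induct, induction y rule: Uq.abs_induct)
    (simp add: plus_Uq.abs_eq Uq_par.abs_eq free_par_add)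

lemma Uq_par_mult: "Uq_par (x * y) = Uq_par x * Uq_par (y :: ('m::len0, 'n::len0) Uq)"
  by (induction x rule: Uq.abs_induct, induction y rule: Uq.abs_induct)
    (simp add: times_Uq.abs_eq Uq_par.abs_eq free_par_mult)

lemma Uq_par_usc: "Uq_par (usc a x) = usc a (Uq_par (x :: ('m::len0, 'n::len0) Uq))"
  by (induction x rule: Uq.abs_induct)
    (simp add: usc_def scal.abs_eq times_Uq.abs_eq Uq_par.abs_eq free_par_mult free_par_scal)

lemma Uq_par_lgen: "Uq_par (lgen s r i j :: ('m::len0, 'n::len0) Uq) = usc ((-1) ^ (par LENGTH('m) i + par LENGTH('m) j)) (lgen s r i j)"
  by (simp add: lgen.abs_eq Uq_par.abs_eq free_par_gen sign_fsc abs_Uq_fsc)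

lemma Uq_par_0: "Uq_par (0 :: ('m::len0, 'n::len0) Uq) = 0"
  using Uq_par_add[of 0 "0 :: ('m, 'n) Uq"] by simp

lemma Uq_par_sum: "Uq_par (sum f A :: ('m::len0, 'n::len0) Uq) = (\<Sum>x\<in>A. Uq_par (f x))"
  by (induction A rule: infinite_finite_induct) (simp_all add: Uq_par_add Uq_par_0)

lemma Uq_par_1: "Uq_par (1 :: ('m::len0, 'n::len0) Uq) = 1"
  by (simp add: one_Uq.abs_eq Uq_par.abs_eq free_par_1)

lemma ser_par_psc: "ser_par (psc a F) = psc a (ser_par F)"
  by (rule fps_ext) (simp add: Uq_par_usc)

lemma ser_par_mult: "ser_par (F * G) = ser_par F * ser_par G"
  by (rule fps_ext) (simp add: fps_mult_nth Uq_par_sum Uq_par_mult)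

lemma ser_par_0: "ser_par 0 = 0"
  by (rule fps_ext) (simp add: Uq_par_0)

lemma ser_par_add: "ser_par (F + G) = ser_par F + ser_par G"
  by (rule fps_ext) (simp add: Uq_par_add)

lemma ser_par_1: "ser_par 1 = 1"
  by (rule fps_ext) (simp add: Uq_par_0 Uq_par_1)

lemma ser_par_sum: "ser_par (sum f A) = (\<Sum>x\<in>A. ser_par (f x))"
  by (induction A rule: infinite_finite_induct) (simp_all add: ser_par_add ser_par_0)

lemma ser_par_lq:
  "ser_par (lq s e i j :: ('m::len0, 'n::len0) Uq fps) = psc ((-1) ^ (par LENGTH('m) i + par LENGTH('m) j)) (lq s e i j)"
  by (rule fps_ext) (simp add: lq_def Lser_def Uq_par_usc Uq_par_lgen mult.commute)

lemma is_inv_left_unique: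
  assumes S: "finite S" "is_inv S A B"
    and C: "\<And>k. k \<in> S \<Longrightarrow> (\<Sum>j\<in>S. C j * A j k) = (if i = k then 1 else 0)"
    and ik: "i \<in> S" "k \<in> S"
  shows "C k = B i (k :: nat)"
proof -
  have "(\<Sum>b\<in>S. \<Sum>a\<in>S. C a * A a b * B b k) = (\<Sum>b\<in>S. if i = b then B b k else 0)"
    using C by (simp add: sum_distrib_right[symmetric] if_distrib[of "\<lambda>c. c * _"] cong: if_cong)
  also have "\<dots> = B i k" using S ik by simp
  also have "(\<Sum>b\<in>S. \<Sum>a\<in>S. C a * A a b * B b k) = (\<Sum>a\<in>S. C a * (\<Sum>b\<in>S. A a b * B b k))"
    by (subst sum.swap) (simp add: sum_distrib_left mult.assoc)
  also have "\<dots> = (\<Sum>a\<in>S. if a = k then C a else 0)"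
    using S(2) ik by (intro sum.cong refl) (auto simp: is_inv_def)
  also have "\<dots> = C k" using S ik by simp
  finally show ?thesis .
qed

lemma ser_par_pow:
  assumes "ser_par F = psc ((-1) ^ a) F"
  shows "(ser_par ^^ k) F = psc ((-1) ^ (k * a)) F"
  by (induction k) (simp_all add: ser_par_psc assms power_add mult.commute)

lemma sign_sq: "(-1 :: Cq) ^ a * (-1) ^ a = 1"
  by (simp flip: power_add)

context
  fixes s :: pm and e :: int and B :: "nat \<Rightarrow> nat \<Rightarrow> ('m::len0, 'n::len0) Uq fps" and M n :: nat
  defines "M \<equiv> LENGTH('m)" and "n \<equiv> LENGTH('m) + LENGTH('n)"
  assumes B: "is_inv (blk n) (lsg s e) B"
begin

lemma ser_par_lsg: "ser_par (lsg s e' i j :: ('m, 'n) Uq fps) = psc ((-1) ^ (par M i + par M j)) (lsg s e' i j)"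
  by (simp add: lsg_def ser_par_psc ser_par_lq M_def mult.commute)

text \<open>The parity automorphism combined with the signs of the indices turns a row of the
  inverse into another solution of the same left inverse equations, so uniqueness makes the entries
  homogeneous.\<close>

lemma ser_par_inv:
  assumes ik: "i \<in> blk n" "k \<in> blk n"
  shows "ser_par (B i k) = psc ((-1) ^ (par M i + par M k)) (B i k)"
proof -
  let ?C = "\<lambda>j. psc ((-1) ^ (par M i + par M j)) (ser_par (B i j))"
  have "?C k = B i k"
  proof (rule is_inv_left_unique[OF finite_blk B _ ik])
    fix k assume k: "k \<in> blk n"
    have s: "(-1 :: Cq) ^ (par M i + par M j) = (-1) ^ (par M i + par M k) * (-1) ^ (par M j + par M k)" for j
      unfolding power_add[symmetric] by (rule sign_parity) auto
    have "(\<Sum>j\<in>blk n. ?C j * lsg s e j k) = psc ((-1) ^ (par M i + par M k)) (\<Sum>j\<in>blk n. ser_par (B i j * lsg s e j k))"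
      unfolding psc.sc_sum_right
    proof (intro sum.cong refl)
      fix j
      show "?C j * lsg s e j k = psc ((-1) ^ (par M i + par M k)) (ser_par (B i j * lsg s e j k))"
        unfolding s[of j] by (simp add: ser_par_mult ser_par_lsg)
    qed
    also have "\<dots> = psc ((-1) ^ (par M i + par M k)) (ser_par (if i = k then 1 else 0))"
      using B ik(1) k by (simp add: is_inv_def flip: ser_par_sum)
    also have "\<dots> = (if i = k then 1 else 0)"
      by (auto simp: ser_par_1 ser_par_0 power_add sign_sq)
    finally show "(\<Sum>j\<in>blk n. ?C j * lsg s e j k) = (if i = k then 1 else 0)" .
  qed
  then have "psc ((-1) ^ (par M i + par M k)) (?C k) = psc ((-1) ^ (par M i + par M k)) (B i k)" by simp
  then show ?thesis by (simp only: psc.sc_sc sign_sq psc.sc_1)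
qed

text \<open>The sign in the graded product of homogeneous matrices is a cocycle, and
  \<open>tsg\<close> exhibits it as a coboundary. This is why changing the signs of entries removes
  it.\<close>

lemma tsg_mult: "tsg M i j * (tsg M j k * (-1) ^ ((par M i + par M j) * (par M j + par M k))) = tsg M i k"
  by (auto simp: tsg_def par_def)

lemma lq_lsg: "lq s e' i j = psc (tsg M i j) (lsg s e' i j :: ('m, 'n) Uq fps)"
  by (simp add: lsg_def M_def tsg_def)

lemma minv_mshift:
  assumes ij: "i \<in> blk n" "j \<in> blk n"
  shows "minv (mshift s e (Lser s)) i j = psc (tsg M i j) (B i j)"
proof -
  let ?A = "mshift s e (Lser s) :: ('m, 'n) umat"
  \<comment> \<open>The zeros outside the index range are those that the definition of
    \<open>minv\<close> demands for uniqueness.\<close>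
  define B0 where "B0 i j = (if i \<in> blk n \<and> j \<in> blk n then psc (tsg M i j) (B i j) else 0)" for i j
  have A: "?A i j = psc (tsg M i j) (lsg s e i j)" for i j
    by (simp add: mshift_def lq_def[symmetric] lq_lsg)
  have n: "{1..LENGTH('m) + LENGTH('n)} = blk n" by (simp add: blk_def n_def)
  have P: "meq (mmult ?A B0) mone" "meq (mmult B0 ?A) mone"
    unfolding meq_def mmult_def gmult_def n unfolding M_def[symmetric]
  proof (safe)
    fix i k assume ik: "i \<in> blk n" "k \<in> blk n"
    have "(\<Sum>j\<in>blk n. ?A i j * (ser_par ^^ (par M i + par M j)) (B0 j k))
      = (\<Sum>j\<in>blk n. psc (tsg M i k) (lsg s e i j * B j k))"
    proof (intro sum.cong refl)
      fix j assume j: "j \<in> blk n"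
      have "ser_par (B0 j k) = psc ((-1) ^ (par M j + par M k)) (B0 j k)"
        using j ik by (simp add: B0_def ser_par_psc ser_par_inv mult.commute)
      note pow = ser_par_pow[OF this]
      show "?A i j * (ser_par ^^ (par M i + par M j)) (B0 j k) = psc (tsg M i k) (lsg s e i j * B j k)"
        unfolding pow tsg_mult[of i j k, symmetric] using j ik by (simp add: A B0_def mult_ac)
    qed
    also have "\<dots> = psc (tsg M i k) (if i = k then 1 else 0)"
      using B ik by (simp add: is_inv_def flip: psc.sc_sum_right)
    also have "\<dots> = mone i k" by (auto simp: mone_def tsg_def)
    finally show "(\<Sum>j\<in>blk n. ?A i j * (ser_par ^^ (par M i + par M j)) (B0 j k)) = mone i k" .
    have "(\<Sum>j\<in>blk n. B0 i j * (ser_par ^^ (par M i + par M j)) (?A j k))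
      = (\<Sum>j\<in>blk n. psc (tsg M i k) (B i j * lsg s e j k))"
    proof (intro sum.cong refl)
      fix j assume j: "j \<in> blk n"
      have "ser_par (?A j k) = psc ((-1) ^ (par M j + par M k)) (?A j k)"
        by (simp add: A ser_par_psc ser_par_lsg mult.commute)
      note pow = ser_par_pow[OF this]
      show "B0 i j * (ser_par ^^ (par M i + par M j)) (?A j k) = psc (tsg M i k) (B i j * lsg s e j k)"
        unfolding pow tsg_mult[of i j k, symmetric] using j ik by (simp add: A B0_def mult_ac)
    qed
    also have "\<dots> = psc (tsg M i k) (if i = k then 1 else 0)"
      using B ik by (simp add: is_inv_def flip: psc.sc_sum_right)
    also have "\<dots> = mone i k" by (auto simp: mone_def tsg_def)
    finally show "(\<Sum>j\<in>blk n. B0 i j * (ser_par ^^ (par M i + par M j)) (?A j k)) = mone i k" .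
  qed
  have "minv ?A = B0"
    unfolding minv_def n
  proof (rule the_equality)
    show "meq (mmult ?A B0) mone \<and> meq (mmult B0 ?A) mone \<and> (\<forall>i j. i \<notin> blk n \<or> j \<notin> blk n \<longrightarrow> B0 i j = 0)"
      using P by (auto simp: B0_def)
  next
    fix C assume "meq (mmult ?A C) mone \<and> meq (mmult C ?A) mone \<and> (\<forall>i j. i \<notin> blk n \<or> j \<notin> blk n \<longrightarrow> C i j = 0)"
    then have C: "meq (mmult C ?A) mone" and C0: "\<And>i j. i \<notin> blk n \<or> j \<notin> blk n \<Longrightarrow> C i j = 0" by auto
    have "C i k = B0 i k" for i k
    proof (cases "i \<in> blk n \<and> k \<in> blk n")
      case True
      then have ik: "i \<in> blk n" "k \<in> blk n" by auto
      have "psc (tsg M i k) (C i k) = B i k"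
      proof (rule is_inv_left_unique[OF finite_blk B _ ik])
        fix k assume k: "k \<in> blk n"
        have t: "tsg M i k * (tsg M j k * (-1) ^ ((par M i + par M j) * (par M j + par M k))) = tsg M i j" for j
          by (auto simp: tsg_def par_def)
        have "(\<Sum>j\<in>blk n. psc (tsg M i j) (C i j) * lsg s e j k)
          = psc (tsg M i k) (\<Sum>j\<in>blk n. C i j * (ser_par ^^ (par M i + par M j)) (?A j k))"
          unfolding psc.sc_sum_right
        proof (intro sum.cong refl)
          fix j
          have "ser_par (?A j k) = psc ((-1) ^ (par M j + par M k)) (?A j k)"
            by (simp add: A ser_par_psc ser_par_lsg mult.commute)
          note pow = ser_par_pow[OF this]
          show "psc (tsg M i j) (C i j) * lsg s e j k
            = psc (tsg M i k) (C i j * (ser_par ^^ (par M i + par M j)) (?A j k))"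
            unfolding pow t[of j, symmetric] by (simp add: A mult_ac)
        qed
        also have "(\<Sum>j\<in>blk n. C i j * (ser_par ^^ (par M i + par M j)) (?A j k)) = (if i = k then 1 else 0)"
          using C ik(1) k unfolding meq_def mmult_def gmult_def mone_def n unfolding M_def[symmetric] by blast
        also have "psc (tsg M i k) (if i = k then 1 else 0) = (if i = k then 1 else 0)"
          by (auto simp: tsg_def)
        finally show "(\<Sum>j\<in>blk n. psc (tsg M i j) (C i j) * lsg s e j k) = (if i = k then 1 else 0)" .
      qed
      then have "psc (tsg M i k) (psc (tsg M i k) (C i k)) = psc (tsg M i k) (B i k)" by simp
      then show ?thesis using ik by (auto simp: B0_def tsg_def split: if_splits)
    qed (use C0 in \<open>auto simp: B0_def\<close>)
    then show "C = B0" by blast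
  qed
  then show ?thesis using ij by (simp add: B0_def)
qed

end

section \<open>The Berezinian of the quantum affine superalgebra\<close>

lemma sign_psc: "(-1) ^ k * F = psc ((-1) ^ k) F"
  by (cases "even k") simp_all

lemma mshift_mshift: "mshift s a (mshift s x A) = mshift s (x + a) A"
  by (simp add: mshift_def qshift_qshift)

lemma mshift_0: "mshift s 0 A = (A :: ('m::len0, 'n::len0) umat)"
proof -
  have "qshift s 0 F = F" for F :: "('m, 'n) Uq fps" by (rule fps_ext) simp
  then show ?thesis by (simp add: mshift_def)
qed

lemma minus_qq_powi: "(- qq) powi (- int k) = (- inverse qq) ^ k"
  by (simp add: power_int_minus flip: power_inverse)

lemma rll_family_lsg:
  fixes li :: "nat \<Rightarrow> int \<Rightarrow> nat \<Rightarrow> nat \<Rightarrow> ('m::len0, 'n::len0) Uq fps"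
  assumes MN: "LENGTH('m) \<noteq> LENGTH('n)"
    and li: "\<And>r e. r \<le> LENGTH('m) + LENGTH('n) \<Longrightarrow> is_inv (blk r) (lsg s e) (li r e)"
  shows "rll_family psc LENGTH('m) (LENGTH('m) + LENGTH('n)) qq (lsg s) li (qshift s)"
proof
  show "qq \<noteq> 0" by (rule qq_0)
  show "qq powi d \<noteq> 1" if "d \<noteq> 0" for d using qq_powi[OF that] .
  show "(\<Sum>j\<in>blk r. lsg s e i j * li r e j k) = (if i = k then 1 else 0)"
    "(\<Sum>j\<in>blk r. li r e i j * lsg s e j k) = (if i = k then 1 else 0)"
    if "r \<le> LENGTH('m) + LENGTH('n)" "i \<in> blk r" "k \<in> blk r" for r i k e
    using li[OF that(1), of e] that by (auto simp: is_inv_def)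
  show "qshift s d (lsg s e i j) = lsg s (e + d) i j" for d e i j by (rule qshift_lsg)
  show "F * G = G * F" if "\<And>d. d \<noteq> 0 \<Longrightarrow> qshift s d F * G = G * qshift s d F" for F G :: "('m, 'n) Uq fps"
    using that by (rule qshift_continuation)
qed ((rule RLL_lsg[OF MN]; assumption) | simp add: qshift_add qshift_mult qshift_1)+

context
  fixes s :: pm and li :: "nat \<Rightarrow> int \<Rightarrow> nat \<Rightarrow> nat \<Rightarrow> ('m::len0, 'n::len0) Uq fps"
    and M N n :: nat
  defines "M \<equiv> LENGTH('m)" and "N \<equiv> LENGTH('n)" and "n \<equiv> LENGTH('m) + LENGTH('n)"
  assumes MN: "M \<noteq> N"
    and li: "\<And>r e. r \<le> n \<Longrightarrow> is_inv (blk r) (lsg s e) (li r e)"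
begin

interpretation rll_family psc M n qq "lsg s" li
    "\<lambda>i j. if i \<le> M \<or> j \<le> M then 1 else -1" "\<lambda>i. if i \<le> M then qq else inverse qq"
    "\<lambda>i k t. if i = k then (if i \<le> M then qq else inverse qq) - t * inverse (if i \<le> M then qq else inverse qq) else 1 - t"
    "\<lambda>i k t. if i = k then 0 else if i < k then qq - inverse qq else t * (qq - inverse qq)" "qshift s"
  unfolding M_def n_def using MN li by (intro rll_family_lsg) (simp_all add: M_def N_def n_def)

lemma blk_n: "{1..LENGTH('m) + LENGTH('n)} = blk n"
  by (simp add: blk_def n_def)

lemma n_eq: "n = M + N"
  by (simp add: n_def M_def N_def)

lemma kap_n: "kap n = 2 * int M - 2 * int N"
  by (auto simp: kap_def n_eq)

lemmas minv_li = minv_mshift[where 'm = 'm and 'n = 'n and s = s, folded M_def n_def, OF li[OF order.refl]]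

lemma Berezinian_Bt: "Berezinian s (mshift s x (Lser s) :: ('m, 'n) umat) = Bt n x"
proof -
  have Mn: "M \<le> n" "n \<le> n" by (simp_all add: M_def n_def)
  let ?A = "mshift s x (Lser s) :: ('m, 'n) umat"
  have 1: "(\<Sum>\<sigma> | \<sigma> permutes {1..M}. fps_const (scal ((- qq) powi (- int (perm_length M \<sigma>)))) *
         (\<Prod>j\<leftarrow>[1..<M+1]. mshift s (2 * int j - 2) ?A (\<sigma> j) j)) = adet M x"
    unfolding adet_def blk_def psc.alt_permutes_rev
  proof (intro sum.cong refl)
    fix \<sigma>
    \<comment> \<open>The column \<open>j\<close> is even, so \<open>tsg\<close> is 1 here. In the
      other sum it is 1 because the row M + k is odd.\<close>
    have fac: "mshift s (2 * int j - 2) ?A (\<sigma> j) j = lsg s (x + 2 * (int j - 1)) (\<sigma> j) j" if "j \<in> set [1..<M+1]" for j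
    proof -
      have e: "x + (2 * int j - 2) = x + 2 * (int j - 1)" by simp
      show ?thesis unfolding mshift_mshift e using that
        by (auto simp: mshift_def lsg_def lq_def tsg_def M_def)
    qed
    have "(\<Prod>j\<leftarrow>[1..<M+1]. mshift s (2 * int j - 2) ?A (\<sigma> j) j) = (\<Prod>j\<leftarrow>[1..<Suc M]. lsg s (x + 2 * (int j - 1)) (\<sigma> j) j)"
      by (intro arg_cong[of _ _ prod_list] map_cong fac) simp_all
    then show "fps_const (scal ((- qq) powi (- int (perm_length M \<sigma>)))) * (\<Prod>j\<leftarrow>[1..<M+1]. mshift s (2 * int j - 2) ?A (\<sigma> j) j)
      = psc (v ^ card {(i, j). 1 \<le> i \<and> i < j \<and> j \<le> M \<and> \<sigma> j < \<sigma> i}) (\<Prod>j\<leftarrow>[1..<Suc M]. lsg s (x + 2 * (int j - 1)) (\<sigma> j) j)"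
      by (simp only: psc_const minus_qq_powi perm_length_def v_def)
  qed
  have 2: "(\<Sum>\<tau> | \<tau> permutes {1..N}. fps_const (scal ((- qq) powi (- int (perm_length N \<tau>)))) *
         (\<Prod>k\<leftarrow>[1..<N+1]. minv (mshift s (2 * int M - 2 * int k) ?A) (M + k) (M + \<tau> k))) = pdet n x"
  proof -
    have "(\<Sum>\<tau> | \<tau> permutes {1..N}. fps_const (scal ((- qq) powi (- int (perm_length N \<tau>)))) *
         (\<Prod>k\<leftarrow>[1..<N+1]. minv (mshift s (2 * int M - 2 * int k) ?A) (M + k) (M + \<tau> k)))
      = (\<Sum>\<tau> | \<tau> permutes {1..N}. psc (v ^ card {(i, j). 1 \<le> i \<and> i < j \<and> j \<le> N \<and> \<tau> j < \<tau> i})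
           (\<Prod>k\<leftarrow>[1..<Suc N]. li n (x + kap n + 2 * (int N - int k)) (M + k) (M + \<tau> k)))"
    proof (intro sum.cong refl)
      fix \<tau> assume "\<tau> \<in> {\<tau>. \<tau> permutes {1..N}}"
      then have p: "\<tau> permutes {1..N}" by simp
      have fac: "minv (mshift s (2 * int M - 2 * int k) ?A) (M + k) (M + \<tau> k) = li n (x + kap n + 2 * (int N - int k)) (M + k) (M + \<tau> k)"
        if "k \<in> set [1..<N+1]" for k
      proof -
        have k: "k \<in> {1..N}" using that by auto
        then have "\<tau> k \<in> {1..N}" using permutes_in_image[OF p] by simp
        then have b: "M + k \<in> blk n" "M + \<tau> k \<in> blk n" using k by (simp_all add: blk_def n_eq)
        have e: "x + (2 * int M - 2 * int k) = x + kap n + 2 * (int N - int k)" by (simp add: kap_n)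
        have "tsg M (M + k) (M + \<tau> k) = 1" using k by (simp add: tsg_def)
        then show ?thesis unfolding mshift_mshift e using minv_li[OF b] by simp
      qed
      have "(\<Prod>k\<leftarrow>[1..<N+1]. minv (mshift s (2 * int M - 2 * int k) ?A) (M + k) (M + \<tau> k))
        = (\<Prod>k\<leftarrow>[1..<Suc N]. li n (x + kap n + 2 * (int N - int k)) (M + k) (M + \<tau> k))"
        by (intro arg_cong[of _ _ prod_list] map_cong fac) simp_all
      then show "fps_const (scal ((- qq) powi (- int (perm_length N \<tau>)))) *
         (\<Prod>k\<leftarrow>[1..<N+1]. minv (mshift s (2 * int M - 2 * int k) ?A) (M + k) (M + \<tau> k))
        = psc (v ^ card {(i, j). 1 \<le> i \<and> i < j \<and> j \<le> N \<and> \<tau> j < \<tau> i})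
           (\<Prod>k\<leftarrow>[1..<Suc N]. li n (x + kap n + 2 * (int N - int k)) (M + k) (M + \<tau> k))"
        by (simp only: psc_const minus_qq_powi perm_length_def v_def)
    qed
    also have "\<dots> = pdet n x" unfolding pdet_def psc.alt_permutes[symmetric] n_eq ..
    finally show ?thesis .
  qed
  show ?thesis
    unfolding Berezinian_def Let_def M_def[symmetric] N_def[symmetric] 1 2 Bt_dets[OF Mn(1) Mn(1) Mn(2)] ..
qed

text \<open>The shift 2N - 2M is \<open>- kap n\<close>. The signs of the supertransposes, of the
  graded product and of \<open>tsg\<close> combine to those of \<open>zsys\<close> and one sign in
  \<open>i\<close> and \<open>k\<close> alone. On the diagonal the latter turns \<open>E i\<close>
  back into an entry of the inverse of D.\<close>

lemma zsys_entry:
  assumes ik: "i \<in> blk n" "k \<in> blk n"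
  shows "mmult (mmult (strans (mshift s (2 * int N - 2 * int M) (Lser s))) D_inv) (strans (minv (Lser s))) i k
    = psc (if i \<le> M \<or> k \<le> M then 1 else -1)
        (\<Sum>j\<in>blk n. psc ((if i \<le> M \<or> j \<le> M then 1 else -1) * (if k \<le> M \<or> j \<le> M then 1 else -1) * E j)
           (lsg s (0 - kap n) j i * li n 0 k j :: ('m, 'n) Uq fps))"
proof -
  let ?X = "strans (mshift s (2 * int N - 2 * int M) (Lser s)) :: ('m, 'n) umat"
  define D where "D j = qq powi (- D_exp M j)" for j
  have X: "?X i j = psc ((-1) ^ (par M i * (par M i + par M j)) * tsg M j i) (lsg s (0 - kap n) j i)" for j
    by (simp add: strans_def mshift_def sign_psc lq_def[symmetric] kap_n M_def[symmetric])
      (simp add: lsg_def tsg_def M_def)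
  have XD: "mmult ?X D_inv i j = psc (D j) (?X i j)" if "j \<in> blk n" for j
  proof -
    have c: "fps_const (scal (D j)) = (psc (D j) 1 :: ('m, 'n) Uq fps)"
      using psc_const[of "D j" "1 :: ('m, 'n) Uq fps"] by simp
    have DI: "D_inv b j = (if b = j then psc (D j) 1 else 0 :: ('m, 'n) Uq fps)" for b
      unfolding c[symmetric] by (simp add: D_inv_def D_def M_def)
    have "(ser_par ^^ a) (psc (D j) 1 :: ('m, 'n) Uq fps) = psc (D j) 1" "(ser_par ^^ a) (0 :: ('m, 'n) Uq fps) = 0" for a
      by (induction a) (simp_all add: ser_par_psc ser_par_1 ser_par_0)
    then have "(ser_par ^^ a) (D_inv b j) = (if b = j then psc (D j) 1 else 0 :: ('m, 'n) Uq fps)" for a b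
      by (simp add: DI)
    then have "mmult ?X D_inv i j = (\<Sum>b\<in>blk n. if b = j then psc (D j) (?X i b) else 0)"
      unfolding mmult_def gmult_def blk_n by (intro sum.cong refl) simp
    then show ?thesis using that by simp
  qed
  show ?thesis
    unfolding mmult_def[of "mmult _ _"] gmult_def blk_n psc.sc_sum_right
  proof (intro sum.cong refl)
    fix j assume j: "j \<in> blk n"
    have m: "minv (Lser s) k j = psc (tsg M k j) (li n 0 k j)"
      using minv_li[OF ik(2) j, of 0] by (simp add: mshift_0)
    have "ser_par (li n 0 k j) = psc ((-1) ^ (par M k + par M j)) (li n 0 k j)"
      using ser_par_inv[where 'm = 'm and 'n = 'n, folded M_def n_def, OF li[OF order.refl] ik(2) j] .
    then have "ser_par (strans (minv (Lser s)) j k) = psc ((-1) ^ (par M k + par M j)) (strans (minv (Lser s)) j k :: ('m, 'n) Uq fps)"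
      by (simp add: strans_def sign_psc m ser_par_psc mult_ac)
    note pow = ser_par_pow[OF this]
    have L: "strans (minv (Lser s)) j k = psc ((-1) ^ (par M j * (par M j + par M k)) * tsg M k j) (li n 0 k j)"
      by (simp add: strans_def sign_psc m M_def)
    have sg: "D j * ((-1) ^ (par M i * (par M i + par M j)) * tsg M j i) *
       ((-1) ^ ((par M i + par M j) * (par M k + par M j)) * ((-1) ^ (par M j * (par M j + par M k)) * tsg M k j))
      = (if i \<le> M \<or> k \<le> M then 1 else -1) * ((if i \<le> M \<or> j \<le> M then 1 else -1) * (if k \<le> M \<or> j \<le> M then 1 else -1) * E j)"
    proof -
      have "E j = (if j \<le> M then 1 else - 1) * D j"
        by (auto simp: E_def D_def D_exp_def algebra_simps)
      then show ?thesis by (simp add: tsg_def par_def)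
    qed
    show "mmult ?X D_inv i j * (ser_par ^^ (par LENGTH('m) i + par LENGTH('m) j)) (strans (minv (Lser s)) j k) =
      psc (if i \<le> M \<or> k \<le> M then 1 else -1) (psc ((if i \<le> M \<or> j \<le> M then 1 else -1) * (if k \<le> M \<or> j \<le> M then 1 else -1) * E j)
           (lsg s (0 - kap n) j i * li n 0 k j))"
      unfolding M_def[symmetric] pow unfolding XD[OF j] X L psc.sc_sc sg[symmetric]
      by (simp only: psc.sc_mult_left psc.sc_mult_right psc.sc_sc mult_ac)
  qed
qed

theorem Berezinian_shift:
  "Berezinian s (mshift s (-2) (Lser s) :: ('m, 'n) umat)
    = qshift s (2 * int M - 2 * int N - 2) (zser s) * Berezinian s (Lser s)"
proof -
  have "kap n \<noteq> 0" using MN by (simp add: kap_n)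
  then obtain \<zeta> where z: "zsys n \<zeta>" by (rule zsys_exists)
  have zE: "(\<Sum>j\<in>blk n. psc ((if i \<le> M \<or> j \<le> M then 1 else -1) * (if k \<le> M \<or> j \<le> M then 1 else -1) * E j)
      (lsg s (e - kap n) j i * li n e k j)) = (if i = k then psc (E i) (\<zeta> e) else 0)"
    if "i \<in> blk n" "k \<in> blk n" for i k e
    using z that unfolding zsys_def by blast
  have n1: "1 \<in> blk n" using MN by (auto simp: blk_def n_def M_def N_def)
  \<comment> \<open>\<open>zsys\<close> allows any family indexed by \<open>e\<close>. That its
    members are shifts of one series is read off from the (1, 1) entry.\<close>
  have zshift: "\<zeta> e = qshift s e (\<zeta> 0)" for e
  proof -
    have "psc (E 1) (qshift s e (\<zeta> 0)) = qshift s e (psc (E 1) (\<zeta> 0))" by (simp add: qshift_psc)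
    also have "psc (E 1) (\<zeta> 0) = (\<Sum>j\<in>blk n. psc ((if 1 \<le> M \<or> j \<le> M then 1 else -1) * (if 1 \<le> M \<or> j \<le> M then 1 else -1) * E j)
      (lsg s (0 - kap n) j 1 * li n 0 1 j))" using zE[OF n1 n1, of 0] by (simp only: if_True simp_thms)
    also have "qshift s e \<dots> = (\<Sum>j\<in>blk n. psc ((if 1 \<le> M \<or> j \<le> M then 1 else -1) * (if 1 \<le> M \<or> j \<le> M then 1 else -1) * E j)
      (lsg s (e - kap n) j 1 * li n e 1 j))"
      unfolding qshift_sum
    proof (intro sum.cong refl)
      fix j assume "j \<in> blk n"
      then show "qshift s e (psc ((if 1 \<le> M \<or> j \<le> M then 1 else -1) * (if 1 \<le> M \<or> j \<le> M then 1 else -1) * E j)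
          (lsg s (0 - kap n) j 1 * li n 0 1 j)) = psc ((if 1 \<le> M \<or> j \<le> M then 1 else -1) * (if 1 \<le> M \<or> j \<le> M then 1 else -1) * E j)
          (lsg s (e - kap n) j 1 * li n e 1 j)"
        using sh_li[OF order.refl n1, of j e 0] by (simp only: qshift_psc qshift_mult qshift_lsg) (simp add: algebra_simps)
    qed
    also have "\<dots> = psc (E 1) (\<zeta> e)" using zE[OF n1 n1, of e] by (simp only: if_True simp_thms)
    finally show ?thesis by (simp add: psc.sc_cancel[OF E_0])
  qed
  have entry: "mmult (mmult (strans (mshift s (2 * int N - 2 * int M) (Lser s))) D_inv) (strans (minv (Lser s))) i k
    = \<zeta> 0 * (D_inv :: ('m, 'n) umat) i k" if ik: "i \<in> blk n" "k \<in> blk n" for i k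
  proof -
    have "psc (if i \<le> M \<or> k \<le> M then 1 else -1) (if i = k then psc (E i) (\<zeta> 0) else 0) = \<zeta> 0 * (D_inv :: ('m, 'n) umat) i k"
    proof (cases "i = k")
      case True
      have "(if i \<le> M then 1 else -1) * E i = qq powi (- D_exp M i)"
        by (auto simp: E_def D_exp_def algebra_simps)
      moreover have "\<zeta> 0 * D_inv i i = psc (qq powi (- D_exp M i)) (\<zeta> 0)"
        using psc_const[of "qq powi (- D_exp M i)" "1 :: ('m, 'n) Uq fps"] by (simp add: D_inv_def M_def)
      ultimately show ?thesis using True by simp
    qed (simp add: D_inv_def)
    then show ?thesis unfolding zsys_entry[OF ik] zE[OF ik] .
  qed
  \<comment> \<open>Uniqueness follows from the (1, 1) entry alone, where the inverse of D is a
    nonzero scalar.\<close>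
  have zser: "zser s = \<zeta> 0"
    unfolding zser_def M_def[symmetric] N_def[symmetric]
  proof (rule the_equality)
    show "meq (mmult (mmult (strans (mshift s (2 * int N - 2 * int M) (Lser s))) D_inv) (strans (minv (Lser s))))
      (\<lambda>i j. \<zeta> 0 * (D_inv :: ('m, 'n) umat) i j)"
      unfolding meq_def blk_n using entry by blast
  next
    fix \<xi> assume "meq (mmult (mmult (strans (mshift s (2 * int N - 2 * int M) (Lser s))) D_inv) (strans (minv (Lser s))))
      (\<lambda>i j. \<xi> * (D_inv :: ('m, 'n) umat) i j)"
    then have "\<xi> * (D_inv :: ('m, 'n) umat) 1 1 = \<zeta> 0 * (D_inv :: ('m, 'n) umat) 1 1"
      unfolding meq_def blk_n using entry[OF n1 n1] n1 by metis
    moreover have "F * D_inv 1 1 = psc (qq powi (- D_exp M 1)) F" for F :: "('m, 'n) Uq fps"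
      using psc_const[of "qq powi (- D_exp M 1)" "1 :: ('m, 'n) Uq fps"] by (simp add: D_inv_def M_def)
    ultimately have "psc (qq powi (- D_exp M 1)) \<xi> = psc (qq powi (- D_exp M 1)) (\<zeta> 0)" by simp
    then show "\<xi> = \<zeta> 0" by (rule psc.sc_cancel[THEN iffD1, rotated]) (simp add: qq_0)
  qed
  have "Bt n (0 - 2) = \<zeta> (0 + kap n - 2) * Bt n 0" by (rule Bt_shift[OF order.refl z])
  moreover have "Berezinian s (Lser s :: ('m, 'n) umat) = Bt n 0" using Berezinian_Bt[of 0] by (simp add: mshift_0)
  ultimately show ?thesis unfolding Berezinian_Bt zser zshift[symmetric] by (simp add: kap_n)
qed

end

theorem theorem1p2:
  fixes s :: pm
  assumes "LENGTH('m::len0) \<noteq> LENGTH('n::len0)"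
  shows "Berezinian s (mshift s (-2) (Lser s :: ('m, 'n) umat))
    = qshift s (2 * int LENGTH('m) - 2 * int LENGTH('n) - 2) (zser s) * Berezinian s (Lser s)"
proof -
  have "\<exists>B. r \<le> LENGTH('m) + LENGTH('n) \<longrightarrow> is_inv (blk r) (lsg s e :: nat \<Rightarrow> nat \<Rightarrow> ('m, 'n) Uq fps) B" for r e
    using block_inverse[where 'm = 'm and 'n = 'n] by blast
  then obtain li where "\<And>r e. r \<le> LENGTH('m) + LENGTH('n) \<Longrightarrow> is_inv (blk r) (lsg s e :: nat \<Rightarrow> nat \<Rightarrow> ('m, 'n) Uq fps) (li r e)"
    by metis
  then show ?thesis using Berezinian_shift[OF assms, of s li] by blast
qed

end
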